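(* Let $n\geq 3$, let $G=D_{2n}=\langle a,b\mid a^n=b^2=1,\ bab=a^{-1}\rangle$, and let $C$ be an inverse-closed generating set for $G$ with $|C|=4$. Then $\mathrm{Cay}(G;C)$ is a $4$-valent normal edge-transitive Cayley graph if and only if there exists $\sigma\in\mathrm{Aut}(G)$ such that $C^\sigma$ is one of the following sets. (1) $\{b, ba, ba^i, ba^{1-i}\}$, for some integer $i$ with $2\leq i\leq n-1$, $\gcd(2i-1,n)=1$ and $2i(i-1)\equiv 0\pmod n$. (2) $\{b, ba, ba^{k+1}, ba^{k^2+k+1}\}$, for some integer $k$ with $1\leq k\leq n-2$, $\gcd(k,n)=1$ and $1+k+k^2+k^3\equiv 0\pmod n$. (3) $\{b, ba^i, ba^j, ba^k\}$, where $n\geq 5$ and $i,j,k$ are integers such that: (i) $1<i,j,k<n$ and $i,j,k$ are pairwise coprime; (ii) $\gcd(x,n)>1$ for each $x\in\{i,j,k\}$; and (iii) there exist integers $\ell,m$ such that $\ell^2\equiv m^2\equiv 1\pmod n$, none of $\ell, m,\ell m$ is congruent to $1$ modulo $n$, $k\equiv j\ell+i\equiv im+j\pmod n$, and $i(\ell+1)\equiv j(m+1)\equiv 0\pmod n$.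
   Context: An inverse-closed generating set $C$ for a finite group $G$ is a non-empty subset $C\subseteq G\setminus\{1\}$ with $\langle C\rangle=G$ and $c^{-1}\in C$ for each $c\in C$. $C^\sigma$ denotes the image of $C$ under $\sigma$. $\mathrm{Cay}(G;C)$ is the undirected graph with vertex set $G$ whose edges are all pairs $\{g,h\}$ with $gh^{-1}\in C$. Let $\mathrm{Aut}(G;C)=\{\sigma\in\mathrm{Aut}(G)\mid C^\sigma=C\}$ and $G_R=\{\rho_g\mid g\in G\}$, where $\rho_g:h\mapsto hg$. The graph $\mathrm{Cay}(G;C)$ is normal edge-transitive if the group $G_R\rtimes\mathrm{Aut}(G;C)$ of graph automorphisms is transitive on the edge set. *)

theory Defs
  imports
    "HOL-Algebra.Bij"
    "HOL-Algebra.Generated_Groups"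
    "HOL-Number_Theory.Cong"
    "HOL-Library.Countable"
begin

section \<open>The dihedral group given by its presentation\<close>

definition dihedral_relations :: "('a, 'm) monoid_scheme \<Rightarrow> nat \<Rightarrow> 'a \<Rightarrow> 'a \<Rightarrow> bool" where
  "dihedral_relations G n a b \<longleftrightarrow>
     a \<in> carrier G \<and> b \<in> carrier G \<and>
     a [^]\<^bsub>G\<^esub> n = \<one>\<^bsub>G\<^esub> \<and> b [^]\<^bsub>G\<^esub> (2::nat) = \<one>\<^bsub>G\<^esub> \<and> b \<otimes>\<^bsub>G\<^esub> a \<otimes>\<^bsub>G\<^esub> b = inv\<^bsub>G\<^esub> a"

text \<open>
  \<open>G\<close> is the group presented by generators \<open>a\<close>, \<open>b\<close> and the above relations: any choice of
  \<open>x\<close>, \<open>y\<close> subject to the relations in a group \<open>H\<close> extends to a homomorphism \<open>G \<rightarrow> H\<close> (unique,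
  as \<open>a\<close>, \<open>b\<close> generate). A definition cannot quantify over types, so \<open>H\<close> ranges over groups on
  \<open>nat\<close>. This loses nothing: see \<open>dihedral_group_universal\<close> for \<open>H\<close> over an arbitrary type,
  and \<open>dihedral_group_iff_order\<close> for the description as such a group of order \<open>2n\<close>.
\<close>

definition dihedral_group :: "('a, 'm) monoid_scheme \<Rightarrow> nat \<Rightarrow> 'a \<Rightarrow> 'a \<Rightarrow> bool" where
  "dihedral_group G n a b \<longleftrightarrow>
     group G \<and> dihedral_relations G n a b \<and> generate G {a, b} = carrier G \<and>
     (\<forall>(H :: nat monoid) x y. group H \<and> dihedral_relations H n x y \<longrightarrow>
        (\<exists>h \<in> hom G H. h a = x \<and> h b = y))"


section \<open>Cayley graphs and normal edge-transitivity\<close>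

definition inverse_closed_generating_set :: "('a, 'm) monoid_scheme \<Rightarrow> 'a set \<Rightarrow> bool" where
  "inverse_closed_generating_set G C \<longleftrightarrow>
     C \<noteq> {} \<and> C \<subseteq> carrier G - {\<one>\<^bsub>G\<^esub>} \<and> generate G C = carrier G \<and> (\<forall>c\<in>C. inv\<^bsub>G\<^esub> c \<in> C)"

text \<open>An undirected graph is a pair consisting of its vertex set and its set of edges, each
  edge being an unordered pair of vertices.\<close>

type_synonym 'a ugraph = "'a set \<times> 'a set set"

definition cayley_graph :: "('a, 'm) monoid_scheme \<Rightarrow> 'a set \<Rightarrow> 'a ugraph" where
  "cayley_graph G C =
     (carrier G, {{g, h} | g h. g \<in> carrier G \<and> h \<in> carrier G \<and> g \<otimes>\<^bsub>G\<^esub> inv\<^bsub>G\<^esub> h \<in> C})"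

definition has_valency :: "'a ugraph \<Rightarrow> nat \<Rightarrow> bool" where
  "has_valency \<Gamma> k \<longleftrightarrow> (\<forall>v \<in> fst \<Gamma>. card {w \<in> fst \<Gamma>. {v, w} \<in> snd \<Gamma>} = k)"

definition graph_automorphisms :: "'a ugraph \<Rightarrow> ('a \<Rightarrow> 'a) set" where
  "graph_automorphisms \<Gamma> =
     {\<phi> \<in> Bij (fst \<Gamma>). \<forall>v \<in> fst \<Gamma>. \<forall>w \<in> fst \<Gamma>. {\<phi> v, \<phi> w} \<in> snd \<Gamma> \<longleftrightarrow> {v, w} \<in> snd \<Gamma>}"

definition right_translations :: "('a, 'm) monoid_scheme \<Rightarrow> ('a \<Rightarrow> 'a) set" where
  "right_translations G = (\<lambda>g. \<lambda>h \<in> carrier G. h \<otimes>\<^bsub>G\<^esub> g) ` carrier G"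

definition auto_stabilizer :: "('a, 'm) monoid_scheme \<Rightarrow> 'a set \<Rightarrow> ('a \<Rightarrow> 'a) set" where
  "auto_stabilizer G C = {\<sigma> \<in> auto G. \<sigma> ` C = C}"

text \<open>The semidirect product of the right translations with \<open>auto_stabilizer G C\<close>, taken
  inside the group of permutations of \<open>carrier G\<close>.\<close>

definition cayley_normalizer :: "('a, 'm) monoid_scheme \<Rightarrow> 'a set \<Rightarrow> ('a \<Rightarrow> 'a) set" where
  "cayley_normalizer G C =
     right_translations G <#>\<^bsub>BijGroup (carrier G)\<^esub> auto_stabilizer G C"

definition normal_edge_transitive :: "('a, 'm) monoid_scheme \<Rightarrow> 'a set \<Rightarrow> bool" where
  "normal_edge_transitive G C \<longleftrightarrow>
     (\<forall>e \<in> snd (cayley_graph G C). \<forall>f \<in> snd (cayley_graph G C).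
        \<exists>\<phi> \<in> cayley_normalizer G C. \<phi> ` e = f)"


section \<open>Sanity checks\<close>

subsection \<open>The permutation group acting on the Cayley graph\<close>

lemma (in group) right_translation_Bij:
  assumes "g \<in> carrier G"
  shows "(\<lambda>h \<in> carrier G. h \<otimes> g) \<in> Bij (carrier G)"
proof -
  have "bij_betw (\<lambda>h. h \<otimes> g) (carrier G) (carrier G)"
    by (rule bij_betw_byWitness[where f' = "\<lambda>h. h \<otimes> inv g"]) (use assms in \<open>auto simp: m_assoc\<close>)
  then show ?thesis by (simp add: Bij_def)
qed

lemma auto_stabilizer_Bij: "\<sigma> \<in> auto_stabilizer G C \<Longrightarrow> \<sigma> \<in> Bij (carrier G)"
  by (simp add: auto_stabilizer_def auto_def)

lemma (in group) cayley_normalizer_eq: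
  "cayley_normalizer G C =
     {\<lambda>h \<in> carrier G. \<sigma> h \<otimes> g | g \<sigma>. g \<in> carrier G \<and> \<sigma> \<in> auto_stabilizer G C}"
proof -
  have "(\<lambda>h \<in> carrier G. h \<otimes> g) \<otimes>\<^bsub>BijGroup (carrier G)\<^esub> \<sigma> = (\<lambda>h \<in> carrier G. \<sigma> h \<otimes> g)"
    if "g \<in> carrier G" "\<sigma> \<in> auto_stabilizer G C" for g \<sigma>
    using right_translation_Bij[OF that(1)] auto_stabilizer_Bij[OF that(2)]
      Bij_imp_funcset[OF auto_stabilizer_Bij[OF that(2)]]
    by (auto simp: BijGroup_def compose_def fun_eq_iff restrict_def Pi_iff)
  then show ?thesis
    unfolding cayley_normalizer_def set_mult_def right_translations_def by (auto; metis)
qed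

lemma (in group) subgroup_auto_stabilizer:
  assumes "C \<subseteq> carrier G"
  shows "subgroup (auto_stabilizer G C) (BijGroup (carrier G))"
proof -
  interpret S: subgroup "auto G" "BijGroup (carrier G)" by (rule subgroup_auto)
  interpret B: group "BijGroup (carrier G)" by (rule group_BijGroup)
  have mult: "\<sigma> \<otimes>\<^bsub>BijGroup (carrier G)\<^esub> \<tau> = compose (carrier G) \<sigma> \<tau>"
    if "\<sigma> \<in> auto G" "\<tau> \<in> auto G" for \<sigma> \<tau>
    using that by (simp add: BijGroup_def auto_def)
  have im: "compose (carrier G) \<sigma> \<tau> ` C = \<sigma> ` \<tau> ` C" for \<sigma> \<tau> :: "'a \<Rightarrow> 'a"
    using assms by (force simp: compose_def image_iff)
  show ?thesis
  proof (rule B.subgroupI)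
    show "auto_stabilizer G C \<subseteq> carrier (BijGroup (carrier G))"
      using S.subset by (auto simp: auto_stabilizer_def)
    have "(\<lambda>x\<in>carrier G. x) ` C = C" using assms by (force simp: image_iff)
    then show "auto_stabilizer G C \<noteq> {}"
      using id_in_auto unfolding auto_stabilizer_def by blast
  next
    fix \<sigma> assume s: "\<sigma> \<in> auto_stabilizer G C"
    then have sB: "\<sigma> \<in> Bij (carrier G)" by (rule auto_stabilizer_Bij)
    have C: "\<sigma> ` C = C" using s by (simp add: auto_stabilizer_def)
    have inj: "inj_on \<sigma> (carrier G)" using sB by (simp add: Bij_def bij_betw_def)
    have "(\<lambda>x\<in>carrier G. inv_into (carrier G) \<sigma> x) ` C = inv_into (carrier G) \<sigma> ` C"
      using assms by (intro image_cong) auto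
    also have "\<dots> = inv_into (carrier G) \<sigma> ` \<sigma> ` C" using C by simp
    also have "\<dots> = C" by (rule inv_into_image_cancel[OF inj assms])
    finally show "inv\<^bsub>BijGroup (carrier G)\<^esub> \<sigma> \<in> auto_stabilizer G C"
      using s S.m_inv_closed[of \<sigma>] inv_BijGroup[OF sB] by (simp add: auto_stabilizer_def)
  next
    fix \<sigma> \<tau> assume "\<sigma> \<in> auto_stabilizer G C" "\<tau> \<in> auto_stabilizer G C"
    then show "\<sigma> \<otimes>\<^bsub>BijGroup (carrier G)\<^esub> \<tau> \<in> auto_stabilizer G C"
      using mult im S.m_closed by (simp add: auto_stabilizer_def)
  qed
qed

lemma (in group) cayley_normalizer_subgroup:
  assumes C: "C \<subseteq> carrier G"
  shows "subgroup (cayley_normalizer G C) (BijGroup (carrier G))"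
proof -
  let ?B = "BijGroup (carrier G)"
  let ?r = "\<lambda>g. \<lambda>h \<in> carrier G. h \<otimes> g"
  interpret B: group ?B by (rule group_BijGroup)
  interpret A: subgroup "auto_stabilizer G C" ?B by (rule subgroup_auto_stabilizer[OF C])
  have mem: "?r g \<in> carrier ?B" if "g \<in> carrier G" for g
    using right_translation_Bij[OF that] by (simp add: BijGroup_def)
  have rr: "?r g \<otimes>\<^bsub>?B\<^esub> ?r h = ?r (h \<otimes> g)" if "g \<in> carrier G" "h \<in> carrier G" for g h
    using that right_translation_Bij
    by (auto simp: BijGroup_def compose_def fun_eq_iff restrict_def m_assoc)
  have r1: "?r \<one> = \<one>\<^bsub>?B\<^esub>" by (auto simp: BijGroup_def fun_eq_iff)
  have ri: "inv\<^bsub>?B\<^esub> ?r g = ?r (inv g)" if "g \<in> carrier G" for g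
    using that by (intro B.inv_equality) (simp_all add: rr mem r1[symmetric])
  have R: "subgroup (right_translations G) ?B"
    by (rule B.subgroupI) (use mem rr ri in \<open>auto simp: right_translations_def\<close>)
  have swap: "\<sigma> \<otimes>\<^bsub>?B\<^esub> ?r g = ?r (\<sigma> g) \<otimes>\<^bsub>?B\<^esub> \<sigma> \<and> \<sigma> g \<in> carrier G"
    if "\<sigma> \<in> auto_stabilizer G C" "g \<in> carrier G" for \<sigma> g
  proof -
    have s: "\<sigma> \<in> Bij (carrier G)" "\<sigma> \<in> hom G G"
      using that(1) by (auto simp: auto_stabilizer_def auto_def)
    then have sg: "\<sigma> x \<in> carrier G" if "x \<in> carrier G" for x
      using that by (auto simp: hom_def Pi_iff)
    show ?thesis
      using s that(2) sg right_translation_Bij[OF that(2)] right_translation_Bij[OF sg[OF that(2)]]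
      by (auto simp: BijGroup_def compose_def fun_eq_iff restrict_def hom_mult)
  qed
  have mulR: "?r g \<otimes>\<^bsub>?B\<^esub> \<sigma> \<in> cayley_normalizer G C"
    if "g \<in> carrier G" "\<sigma> \<in> auto_stabilizer G C" for g \<sigma>
    using that by (auto simp: cayley_normalizer_def set_mult_def right_translations_def)
  have dest: "\<exists>g\<in>carrier G. \<exists>\<sigma>\<in>auto_stabilizer G C. x = ?r g \<otimes>\<^bsub>?B\<^esub> \<sigma>"
    if "x \<in> cayley_normalizer G C" for x
    using that by (auto simp: cayley_normalizer_def set_mult_def right_translations_def)
  show ?thesis
  proof (rule B.subgroupI)
    show "cayley_normalizer G C \<subseteq> carrier ?B"
      using dest mem A.mem_carrier by fastforce
    show "cayley_normalizer G C \<noteq> {}"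
      using mulR[OF one_closed A.one_closed] by blast
  next
    fix x assume "x \<in> cayley_normalizer G C"
    then obtain g \<sigma> where g: "g \<in> carrier G" and s: "\<sigma> \<in> auto_stabilizer G C"
      and x: "x = ?r g \<otimes>\<^bsub>?B\<^esub> \<sigma>" using dest by blast
    have "inv\<^bsub>?B\<^esub> x = inv\<^bsub>?B\<^esub> \<sigma> \<otimes>\<^bsub>?B\<^esub> ?r (inv g)"
      using B.inv_mult_group[OF mem[OF g] A.mem_carrier[OF s]] ri[OF g] x by simp
    then show "inv\<^bsub>?B\<^esub> x \<in> cayley_normalizer G C"
      using swap[OF A.m_inv_closed[OF s] inv_closed[OF g]] mulR A.m_inv_closed[OF s] by simp
  next
    fix x y assume xy: "x \<in> cayley_normalizer G C" "y \<in> cayley_normalizer G C"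
    obtain g \<sigma> where 1: "g \<in> carrier G" "\<sigma> \<in> auto_stabilizer G C"
      and x: "x = ?r g \<otimes>\<^bsub>?B\<^esub> \<sigma>" using dest[OF xy(1)] by blast
    obtain h \<tau> where 2: "h \<in> carrier G" "\<tau> \<in> auto_stabilizer G C"
      and y: "y = ?r h \<otimes>\<^bsub>?B\<^esub> \<tau>" using dest[OF xy(2)] by blast
    note g = 1(1) 2(1) and s = 1(2) 2(2)
    note [simp] = mem[OF g(1)] mem[OF g(2)] A.mem_carrier[OF s(1)] A.mem_carrier[OF s(2)]
    have sh: "\<sigma> h \<in> carrier G" using swap[OF s(1) g(2)] by blast
    have "x \<otimes>\<^bsub>?B\<^esub> y = ?r g \<otimes>\<^bsub>?B\<^esub> (\<sigma> \<otimes>\<^bsub>?B\<^esub> ?r h) \<otimes>\<^bsub>?B\<^esub> \<tau>"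
      unfolding x y by (simp add: B.m_assoc)
    also have "\<dots> = (?r g \<otimes>\<^bsub>?B\<^esub> ?r (\<sigma> h)) \<otimes>\<^bsub>?B\<^esub> (\<sigma> \<otimes>\<^bsub>?B\<^esub> \<tau>)"
      using swap[OF s(1) g(2)] mem[OF sh] by (simp add: B.m_assoc)
    finally show "x \<otimes>\<^bsub>?B\<^esub> y \<in> cayley_normalizer G C"
      using mulR[OF m_closed[OF sh g(1)] A.m_closed[OF s]] rr[OF g(1) sh] by simp
  qed
qed

lemma (in group) cayley_normalizer_graph_automorphisms:
  assumes C: "C \<subseteq> carrier G"
  shows "cayley_normalizer G C \<subseteq> graph_automorphisms (cayley_graph G C)"
proof
  fix \<phi> assume p: "\<phi> \<in> cayley_normalizer G C"
  then have B: "\<phi> \<in> Bij (carrier G)"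
    using subgroup.subset[OF cayley_normalizer_subgroup[OF C]] by (auto simp: BijGroup_def)
  obtain g \<sigma> where g: "g \<in> carrier G" and s: "\<sigma> \<in> auto_stabilizer G C"
    and \<phi>: "\<phi> = (\<lambda>h \<in> carrier G. \<sigma> h \<otimes> g)"
    using p unfolding cayley_normalizer_eq by blast
  have sB: "\<sigma> \<in> Bij (carrier G)" and hom: "\<sigma> \<in> hom G G" and sC: "\<sigma> ` C = C"
    using s by (auto simp: auto_stabilizer_def auto_def)
  have inj: "inj_on \<sigma> (carrier G)" using sB by (simp add: Bij_def bij_betw_def)
  have sin: "\<sigma> x \<in> carrier G" if "x \<in> carrier G" for x
    using hom that by (auto simp: hom_def Pi_iff)
  interpret h: group_hom G G \<sigma> using hom by unfold_locales
  have quot: "\<phi> v \<otimes> inv (\<phi> w) = \<sigma> (v \<otimes> inv w)" if "v \<in> carrier G" "w \<in> carrier G" for v w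
    using that g sin by (simp add: \<phi> inv_mult_group m_assoc[symmetric]) (simp add: m_assoc)
  have mem: "\<sigma> x \<in> C \<longleftrightarrow> x \<in> C" if "x \<in> carrier G" for x
    using inj_on_image_mem_iff[OF inj that C] sC by simp
  have pin: "\<phi> v \<in> carrier G" if "v \<in> carrier G" for v
    using that g sin by (simp add: \<phi>)
  have edge: "{v, w} \<in> snd (cayley_graph G C) \<longleftrightarrow> v \<otimes> inv w \<in> C \<or> w \<otimes> inv v \<in> C"
    if "v \<in> carrier G" "w \<in> carrier G" for v w
    using that by (auto simp: cayley_graph_def doubleton_eq_iff)
  show "\<phi> \<in> graph_automorphisms (cayley_graph G C)"
  proof -
    have "\<phi> v \<otimes> inv (\<phi> w) \<in> C \<longleftrightarrow> v \<otimes> inv w \<in> C" if "v \<in> carrier G" "w \<in> carrier G" for v w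
      unfolding quot[OF that] using that by (intro mem) auto
    then have "{\<phi> v, \<phi> w} \<in> snd (cayley_graph G C) \<longleftrightarrow> {v, w} \<in> snd (cayley_graph G C)"
      if "v \<in> carrier G" "w \<in> carrier G" for v w
      using that by (simp only: edge pin)
    moreover have "fst (cayley_graph G C) = carrier G" by (simp add: cayley_graph_def)
    ultimately show ?thesis using B unfolding graph_automorphisms_def by simp
  qed
qed

subsection \<open>The presentation of the dihedral group\<close>

text \<open>The normal form \<open>b\<^sup>e a\<^sup>i\<close> with \<open>e \<in> {0, 1}\<close>.\<close>

definition dihedral_nf :: "('a, 'm) monoid_scheme \<Rightarrow> 'a \<Rightarrow> 'a \<Rightarrow> bool \<times> int \<Rightarrow> 'a" where
  "dihedral_nf G a b = (\<lambda>(e, i). (if e then b else \<one>\<^bsub>G\<^esub>) \<otimes>\<^bsub>G\<^esub> a [^]\<^bsub>G\<^esub> i)"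

locale dihedral_pair = group G for G (structure) +
  fixes n :: nat and a b :: 'a
  assumes rels: "dihedral_relations G n a b" and n: "n \<ge> 1"
begin

abbreviation "nf \<equiv> dihedral_nf G a b"

lemma closed [simp, intro]: "a \<in> carrier G" "b \<in> carrier G"
  using rels by (auto simp: dihedral_relations_def)

lemma nf_closed [simp]: "nf p \<in> carrier G"
  by (cases p) (auto simp: dihedral_nf_def)

lemma bb: "b \<otimes> b = \<one>"
  using rels by (simp add: dihedral_relations_def numeral_2_eq_2)

lemma inv_b: "inv b = b"
  by (rule inv_equality) (auto simp: bb)

lemma an: "a [^] (int n) = \<one>"
  using rels by (simp add: dihedral_relations_def int_pow_int)

lemma pow_a_cong: "[i = j] (mod int n) \<Longrightarrow> a [^] i = a [^] j"
proof -
  assume "[i = j] (mod int n)"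
  then obtain k where k: "i - j = int n * k" by (auto simp: cong_iff_dvd_diff dvd_def)
  have "a [^] (i - j) = (a [^] int n) [^] k" by (simp add: k int_pow_pow)
  then have "a [^] (i - j) = \<one>" by (simp add: an)
  moreover have "a [^] i = a [^] (i - j) \<otimes> a [^] j" by (simp add: int_pow_mult[symmetric])
  ultimately show ?thesis by simp
qed

lemma bab: "b \<otimes> a [^] (i::int) \<otimes> b = a [^] (- i)"
proof -
  have "(\<lambda>x. b \<otimes> x \<otimes> b) \<in> hom G G"
  proof (rule homI)
    fix x y assume "x \<in> carrier G" "y \<in> carrier G"
    then have "b \<otimes> x \<otimes> b \<otimes> (b \<otimes> y \<otimes> b) = b \<otimes> x \<otimes> (b \<otimes> b) \<otimes> y \<otimes> b"
      by (simp add: m_assoc)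
    then show "b \<otimes> (x \<otimes> y) \<otimes> b = b \<otimes> x \<otimes> b \<otimes> (b \<otimes> y \<otimes> b)"
      using \<open>x \<in> carrier G\<close> \<open>y \<in> carrier G\<close> by (simp add: bb m_assoc)
  qed auto
  then interpret c: group_hom G G "\<lambda>x. b \<otimes> x \<otimes> b" by unfold_locales
  have "b \<otimes> a [^] i \<otimes> b = (b \<otimes> a \<otimes> b) [^] i" by (rule c.hom_int_pow) simp
  also have "b \<otimes> a \<otimes> b = inv a" using rels by (simp add: dihedral_relations_def)
  finally show ?thesis by (simp add: int_pow_inv int_pow_neg)
qed

lemma pow_b: "a [^] (i::int) \<otimes> b = b \<otimes> a [^] (- i)"
proof -
  have "b \<otimes> (b \<otimes> a [^] i \<otimes> b) = (b \<otimes> b) \<otimes> (a [^] i \<otimes> b)" by (simp add: m_assoc)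
  then show ?thesis by (simp add: bab bb)
qed

lemma nf_mult: "nf (e, i) \<otimes> nf (f, j) = nf (e \<noteq> f, (if f then - i else i) + j)"
proof (cases f)
  case True
  have "nf (e, i) \<otimes> nf (f, j) = (if e then b else \<one>) \<otimes> (a [^] i \<otimes> b) \<otimes> a [^] j"
    using True by (simp add: dihedral_nf_def m_assoc)
  also have "\<dots> = ((if e then b else \<one>) \<otimes> b) \<otimes> (a [^] (- i) \<otimes> a [^] j)"
    by (simp add: pow_b m_assoc)
  also have "\<dots> = nf (e \<noteq> f, - i + j)"
    unfolding int_pow_mult[OF closed(1), symmetric] using True by (auto simp: dihedral_nf_def bb)
  finally show ?thesis using True by simp
next
  case False
  then show ?thesis by (auto simp: dihedral_nf_def m_assoc int_pow_mult)
qed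

lemma nf_cong: "[i = j] (mod int n) \<Longrightarrow> nf (e, i) = nf (e, j)"
  using pow_a_cong by (simp add: dihedral_nf_def)

lemma nf_gens: "nf (False, 1) = a" "nf (True, 0) = b" "nf (False, 0) = \<one>"
  by (auto simp: dihedral_nf_def)

lemma generate_nf: "generate G {a, b} = nf ` (UNIV \<times> {0..<int n})"
proof -
  have red: "nf p \<in> nf ` (UNIV \<times> {0..<int n})" for p
  proof (cases p)
    case (Pair e i)
    have "nf p = nf (e, i mod int n)" unfolding Pair by (rule nf_cong) (simp add: cong_def)
    then show ?thesis using n by auto
  qed
  show ?thesis
  proof (intro equalityI subsetI)
    fix x assume "x \<in> generate G {a, b}"
    then have "\<exists>p. x = nf p"
    proof induction
      case one
      then show ?case by (metis nf_gens(3))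
    next
      case (incl h)
      then show ?case by (metis nf_gens(1,2) insertE singletonD)
    next
      case (inv h)
      have "inv a = nf (False, -1)" by (simp add: dihedral_nf_def int_pow_neg)
      then show ?case using inv inv_b by (metis nf_gens(2) insertE singletonD)
    next
      case (eng h1 h2)
      then show ?case by (metis nf_mult surj_pair)
    qed
    then show "x \<in> nf ` (UNIV \<times> {0..<int n})" using red by blast
  next
    fix x assume "x \<in> nf ` (UNIV \<times> {0..<int n})"
    then obtain e i where x: "x = nf (e, i)" and "i \<ge> 0" by auto
    have pow: "a [^] k \<in> generate G {a, b}" for k :: nat
      by (induction k) (auto intro: generate.intros)
    have "a [^] i \<in> generate G {a, b}"
      using pow[of "nat i"] \<open>i \<ge> 0\<close> by (metis int_nat_eq int_pow_int)
    then show "x \<in> generate G {a, b}"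
      by (auto simp: x dihedral_nf_def intro: generate.intros)
  qed
qed

end

lemma dihedral_order_le:
  fixes G (structure)
  assumes "group G" "dihedral_relations G n a b" "generate G {a, b} = carrier G" "n \<ge> 1"
  shows "finite (carrier G) \<and> order G \<le> 2 * n"
proof -
  interpret dihedral_pair G n a b using assms by (simp add: dihedral_pair_def dihedral_pair_axioms_def)
  have "carrier G = nf ` (UNIV \<times> {0..<int n})" using generate_nf assms(3) by simp
  moreover have "card (nf ` (UNIV \<times> {0..<int n})) \<le> card ((UNIV :: bool set) \<times> {0..<int n})"
    by (rule card_image_le) simp
  ultimately show ?thesis by (simp add: order_def card_cartesian_product)
qed

lemma dihedral_order_universal:
  fixes G (structure) and H :: "('c, 'd) monoid_scheme"
  assumes G: "group G" "dihedral_relations G n a b" "generate G {a, b} = carrier G" "n \<ge> 1"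
    and ord: "order G = 2 * n"
    and H: "group H" "dihedral_relations H n x y"
  shows "\<exists>h \<in> hom G H. h a = x \<and> h b = y"
proof -
  interpret G: dihedral_pair G n a b using G by (simp add: dihedral_pair_def dihedral_pair_axioms_def)
  interpret H: dihedral_pair H n x y using G(4) H by (simp add: dihedral_pair_def dihedral_pair_axioms_def)
  let ?D = "(UNIV :: bool set) \<times> {0..<int n}"
  have car: "carrier G = G.nf ` ?D" using G.generate_nf G(3) by simp
  have "inj_on G.nf ?D"
    by (rule eq_card_imp_inj_on) (use ord car in \<open>simp_all add: order_def card_cartesian_product\<close>)
  then have nfeq: "H.nf p = H.nf q" if "G.nf p = G.nf q" for p q
  proof -
    obtain e i where p: "p = (e, i)" by fastforce
    obtain f j where q: "q = (f, j)" by fastforce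
    have "G.nf (e, i mod int n) = G.nf (f, j mod int n)"
      using that G.nf_cong[of i "i mod int n" e] G.nf_cong[of j "j mod int n" f]
      by (simp add: p q cong_def)
    then have "e = f \<and> i mod int n = j mod int n"
      using \<open>inj_on G.nf ?D\<close> G(4) by (auto dest!: inj_onD)
    then show ?thesis using H.nf_cong[of i j e] by (simp add: p q cong_def)
  qed
  define h where "h = (\<lambda>g. H.nf (SOME p. G.nf p = g))"
  have h: "h (G.nf p) = H.nf p" for p
    unfolding h_def by (rule nfeq, rule someI[of "\<lambda>q. G.nf q = G.nf p"]) simp
  have "h \<in> hom G H"
  proof (rule homI)
    fix u v assume "u \<in> carrier G" "v \<in> carrier G"
    then obtain e i f j where "u = G.nf (e, i)" "v = G.nf (f, j)" unfolding car by auto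
    then show "h (u \<otimes> v) = h u \<otimes>\<^bsub>H\<^esub> h v" by (simp only: G.nf_mult H.nf_mult h)
  qed (simp add: h_def)
  moreover have "h a = x" "h b = y" using h G.nf_gens H.nf_gens by metis+
  ultimately show ?thesis by blast
qed

text \<open>A concrete model on \<open>nat\<close> with \<open>2n\<close> elements.\<close>

definition dihedral_model :: "nat \<Rightarrow> (bool \<times> int) monoid" where
  "dihedral_model n =
     \<lparr>carrier = UNIV \<times> {0..<int n},
      monoid.mult = (\<lambda>(e, i) (f, j). (e \<noteq> f, ((if f then - i else i) + j) mod int n)),
      one = (False, 0)\<rparr>"

lemma group_dihedral_model:
  assumes "n \<ge> 1"
  shows "group (dihedral_model n)"
proof (rule groupI)
  fix x assume "x \<in> carrier (dihedral_model n)"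
  then obtain e i where x: "x = (e, i)" "0 \<le> i" "i < int n" by (auto simp: dihedral_model_def)
  let ?y = "(e, (if e then i else - i) mod int n)"
  have "?y \<in> carrier (dihedral_model n)" using assms by (simp add: dihedral_model_def)
  moreover have "?y \<otimes>\<^bsub>dihedral_model n\<^esub> x = \<one>\<^bsub>dihedral_model n\<^esub>"
    using x by (auto simp: dihedral_model_def mod_simps)
  ultimately show "\<exists>y\<in>carrier (dihedral_model n). y \<otimes>\<^bsub>dihedral_model n\<^esub> x = \<one>\<^bsub>dihedral_model n\<^esub>"
    by blast
next
  fix x y z :: "bool \<times> int"
  obtain e i f j g k where xyz: "x = (e, i)" "y = (f, j)" "z = (g, k)" by (metis surj_pair)
  show "x \<otimes>\<^bsub>dihedral_model n\<^esub> y \<otimes>\<^bsub>dihedral_model n\<^esub> z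
           = x \<otimes>\<^bsub>dihedral_model n\<^esub> (y \<otimes>\<^bsub>dihedral_model n\<^esub> z)"
    unfolding xyz by (cases e; cases f; cases g) (simp_all add: dihedral_model_def mod_simps algebra_simps)
qed (use assms in \<open>auto simp: dihedral_model_def\<close>)

lemma dihedral_model_relations:
  assumes "n \<ge> 1"
  shows "dihedral_relations (dihedral_model n) n (False, 1 mod int n) (True, 0)"
proof -
  interpret group "dihedral_model n" by (rule group_dihedral_model[OF assms])
  let ?a = "(False, 1 mod int n)" and ?b = "(True, 0 :: int)"
  have car: "?a \<in> carrier (dihedral_model n)" "?b \<in> carrier (dihedral_model n)"
    using assms by (auto simp: dihedral_model_def)
  have pow: "?a [^]\<^bsub>dihedral_model n\<^esub> k = (False, int k mod int n)" for k :: nat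
    by (induction k) (auto simp: dihedral_model_def mod_simps algebra_simps)
  have "?b \<otimes>\<^bsub>dihedral_model n\<^esub> ?a \<otimes>\<^bsub>dihedral_model n\<^esub> ?b = inv\<^bsub>dihedral_model n\<^esub> ?a"
  proof (rule inv_equality[symmetric])
    show "?b \<otimes>\<^bsub>dihedral_model n\<^esub> ?a \<otimes>\<^bsub>dihedral_model n\<^esub> ?b \<otimes>\<^bsub>dihedral_model n\<^esub> ?a
      = \<one>\<^bsub>dihedral_model n\<^esub>" by (simp add: dihedral_model_def mod_simps)
  qed (use car in auto)
  moreover have "?b [^]\<^bsub>dihedral_model n\<^esub> (2::nat) = \<one>\<^bsub>dihedral_model n\<^esub>"
    by (simp add: numeral_2_eq_2 dihedral_model_def)
  moreover have "?a [^]\<^bsub>dihedral_model n\<^esub> n = \<one>\<^bsub>dihedral_model n\<^esub>"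
    unfolding pow by (simp add: dihedral_model_def)
  ultimately show ?thesis using car by (simp add: dihedral_relations_def)
qed

lemma dihedral_model_generate:
  assumes "n \<ge> 1"
  shows "generate (dihedral_model n) {(False, 1 mod int n), (True, 0)} = carrier (dihedral_model n)"
proof -
  let ?M = "dihedral_model n"
  let ?a = "(False, 1 mod int n)" and ?b = "(True, 0 :: int)"
  interpret M: dihedral_pair ?M n ?a ?b
    using assms group_dihedral_model dihedral_model_relations
    by (simp add: dihedral_pair_def dihedral_pair_axioms_def)
  have pow: "?a [^]\<^bsub>?M\<^esub> k = (False, int k mod int n)" for k :: nat
    by (induction k) (auto simp: dihedral_model_def mod_simps algebra_simps)
  have "M.nf (e, i) = (e, i)" if "0 \<le> i" "i < int n" for e i
  proof -
    have "?a [^]\<^bsub>?M\<^esub> i = (False, i)"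
      using pow[of "nat i"] that int_pow_int[of ?M ?a "nat i"] by simp
    then show ?thesis using that by (simp add: dihedral_nf_def dihedral_model_def)
  qed
  then have "M.nf ` (UNIV \<times> {0..<int n}) = UNIV \<times> {0..<int n}" by (force simp: image_iff)
  then show ?thesis using M.generate_nf by (simp add: dihedral_model_def)
qed

lemma dihedral_nat_model:
  assumes "n \<ge> 1"
  shows "\<exists>(H :: nat monoid) x y. group H \<and> dihedral_relations H n x y \<and>
           generate H {x, y} = carrier H \<and> order H = 2 * n"
proof -
  let ?M = "dihedral_model n"
  let ?a = "(False, 1 mod int n)" and ?b = "(True, 0 :: int)"
  interpret M: group ?M by (rule group_dihedral_model[OF assms])
  let ?t = "to_nat :: bool \<times> int \<Rightarrow> nat"
  define K :: "nat monoid" where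
    "K = \<lparr>carrier = UNIV, monoid.mult = (\<lambda>x y. ?t (from_nat x \<otimes>\<^bsub>?M\<^esub> from_nat y)), one = 0\<rparr>"
  define H where "H = K \<lparr>carrier := ?t ` carrier ?M, one := ?t \<one>\<^bsub>?M\<^esub>\<rparr>"
  have carH: "carrier H = ?t ` carrier ?M" unfolding H_def K_def by (simp only: partial_object.simps monoid.simps)
  have "?t \<in> hom ?M K" by (rule homI) (auto simp: K_def)
  then have H: "group H" unfolding H_def by (rule M.hom_imp_img_group)
  have thom: "?t \<in> hom ?M H" by (rule homI) (auto simp: H_def K_def)
  interpret h: group_hom ?M H ?t
    using thom H by (simp add: group_hom_def group_hom_axioms_def M.group_axioms)
  have rel: "dihedral_relations ?M n ?a ?b" by (rule dihedral_model_relations[OF assms])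
  then have ab: "?a \<in> carrier ?M" "?b \<in> carrier ?M" by (auto simp: dihedral_relations_def)
  have "?t ?b \<otimes>\<^bsub>H\<^esub> ?t ?a \<otimes>\<^bsub>H\<^esub> ?t ?b = inv\<^bsub>H\<^esub> ?t ?a"
    using rel ab by (metis dihedral_relations_def h.hom_inv h.hom_mult M.m_closed)
  then have "dihedral_relations H n (?t ?a) (?t ?b)"
    using rel ab unfolding dihedral_relations_def
    by (metis h.hom_closed h.hom_nat_pow h.hom_one)
  moreover have "generate H {?t ?a, ?t ?b} = carrier H"
  proof -
    have "generate H (?t ` {?a, ?b}) = ?t ` generate ?M {?a, ?b}"
      using ab by (intro h.generate_img) auto
    then have "generate H {?t ?a, ?t ?b} = ?t ` carrier ?M"
      unfolding dihedral_model_generate[OF assms] image_insert image_empty .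
    then show ?thesis unfolding carH .
  qed
  moreover have "order H = 2 * n"
  proof -
    have "order H = card (?t ` carrier ?M)" unfolding order_def carH ..
    also have "\<dots> = card (carrier ?M)" by (rule card_image) (simp add: inj_on_def)
    also have "\<dots> = 2 * n" by (simp add: dihedral_model_def card_cartesian_product)
    finally show ?thesis .
  qed
  ultimately show ?thesis using H by blast
qed

theorem dihedral_group_iff_order:
  fixes G (structure)
  assumes "n \<ge> 1"
  shows "dihedral_group G n a b \<longleftrightarrow>
     group G \<and> dihedral_relations G n a b \<and> generate G {a, b} = carrier G \<and> order G = 2 * n"
proof
  assume D: "dihedral_group G n a b"
  then have G: "group G" "dihedral_relations G n a b" "generate G {a, b} = carrier G"
    by (auto simp: dihedral_group_def)
  obtain H :: "nat monoid" and x y where H: "group H" "dihedral_relations H n x y"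
    "generate H {x, y} = carrier H" "order H = 2 * n"
    using dihedral_nat_model[OF assms] by blast
  obtain h where h: "h \<in> hom G H" "h a = x" "h b = y"
    using D H(1,2) unfolding dihedral_group_def by blast
  interpret h: group_hom G H h
    using G(1) H(1) h(1) by (simp add: group_hom_def group_hom_axioms_def)
  have "a \<in> carrier G" "b \<in> carrier G" using G(2) by (auto simp: dihedral_relations_def)
  then have "h ` generate G {a, b} = generate H (h ` {a, b})"
    by (intro h.generate_img[symmetric]) auto
  then have "h ` carrier G = carrier H" using G(3) H(3) h(2,3) by simp
  then have "order H \<le> order G"
    using dihedral_order_le[OF G assms] card_image_le[of "carrier G" h] by (simp add: order_def)
  then show "group G \<and> dihedral_relations G n a b \<and> generate G {a, b} = carrier G \<and> order G = 2 * n"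
    using G H(4) dihedral_order_le[OF G assms] by simp
next
  assume *: "group G \<and> dihedral_relations G n a b \<and> generate G {a, b} = carrier G \<and> order G = 2 * n"
  have "\<exists>h \<in> hom G H. h a = x \<and> h b = y"
    if "group H" "dihedral_relations H n x y" for H :: "nat monoid" and x y
    by (rule dihedral_order_universal[of G n a b]) (use * assms that in simp_all)
  then show "dihedral_group G n a b"
    unfolding dihedral_group_def using * by blast
qed

theorem dihedral_group_universal:
  fixes G (structure) and H :: "('c, 'd) monoid_scheme"
  assumes "dihedral_group G n a b" "n \<ge> 1" "group H" "dihedral_relations H n x y"
  shows "\<exists>h \<in> hom G H. h a = x \<and> h b = y"
proof -
  have "group G \<and> dihedral_relations G n a b \<and> generate G {a, b} = carrier G \<and> order G = 2 * n"
    using iffD1[OF dihedral_group_iff_order[OF assms(2)] assms(1)] .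
  then show ?thesis
    by (intro dihedral_order_universal[of G n a b H x y] assms(2-4)) simp_all
qed

theorem dihedral_group_exists:
  assumes "n \<ge> 1"
  shows "\<exists>(H :: nat monoid) x y. dihedral_group H n x y"
proof -
  obtain H :: "nat monoid" and x y where
    *: "group H" "dihedral_relations H n x y" "generate H {x, y} = carrier H" "order H = 2 * n"
    using dihedral_nat_model[OF assms] by blast
  have "dihedral_group H n x y"
    by (rule iffD2[OF dihedral_group_iff_order[OF assms]]) (intro conjI *)
  then show ?thesis by (intro exI)
qed

end

theory Submission
  imports Defs "HOL-Number_Theory.Number_Theory"
begin

text \<open>
  The set \<open>C\<close> contains a reflection and hence, by edge-transitivity, consists of reflections
  \<open>b a\<^sup>x\<close>. On these \<open>Aut(G)\<close> acts by the affine maps \<open>x \<mapsto> u x + v\<close> of \<open>\<int>/n\<close>, so the question is which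
  generating \<open>4\<close>-subsets of \<open>\<int>/n\<close> have a transitive affine stabilizer. A commutator of affine maps is
  a translation; this forces the stabilizer to contain a \<open>4\<close>-cycle, which is case (2), or a regular
  Klein four-group generated by \<open>t \<mapsto> l t + i\<close> and \<open>t \<mapsto> m t + j\<close> acting on \<open>{0, i, j, k}\<close>. If one of
  \<open>i, j, k\<close> is a unit, it can be scaled to \<open>1\<close>, which gives case (1).

  Otherwise \<open>n = A B C\<close> with pairwise coprime factors greater than \<open>1\<close> such that \<open>i\<close>, \<open>j\<close>, \<open>k\<close> vanish
  modulo \<open>A\<close>, \<open>B\<close>, \<open>C\<close>, up to the exception \<open>A/2\<close> modulo an \<open>A\<close> divisible by \<open>4\<close>, and these residues
  determine \<open>(i, j, k)\<close> up to a unit of \<open>\<int>/n\<close>. It remains to choose the unit such that the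
  representatives between \<open>0\<close> and \<open>n\<close> are pairwise coprime integers. For \<open>C\<close> the largest factor,
  normalize \<open>k\<close> to a divisor of \<open>C\<close>; then \<open>i - j = d\<close> is a constant with \<open>d \<le> n/2\<close>, without loss of
  generality, and \<open>i\<close> runs through the terms coprime to \<open>C\<close> of an arithmetic progression with
  difference \<open>A B\<close>. It suffices that \<open>i\<close> is coprime to \<open>d\<close>, and for \<open>C \<ge> 60\<close> sieve bounds for
  Jacobsthal's function provide such a term. Small \<open>C\<close> are settled by explicit solutions.
\<close>

section \<open>Sieving an arithmetic progression\<close>

text \<open>As \<open>Q\<close> is invertible modulo \<open>p\<close>, divisibility of
  \<open>s + Q * t\<close> by \<open>p\<close> pins \<open>t\<close> to a single residue
  class.\<close>

lemma linear_form_class: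
  fixes p s Q :: nat
  assumes "p > 0" "coprime p Q"
  obtains b where "b < p" "\<And>t. p dvd s + Q * t \<longleftrightarrow> t mod p = b"
proof -
  obtain x where x: "[Q * x = 1] (mod p)"
    using cong_solve_coprime_nat[of Q p] assms by (auto simp: coprime_commute)
  \<comment> \<open>Over the naturals \<open>p - s mod p\<close> stands for \<open>- s\<close>, so
    \<open>b\<close> is \<open>- s / Q\<close> modulo \<open>p\<close>.\<close>
  define b where "b = ((p - s mod p) * x) mod p"
  have "[s + Q * b = s mod p + Q * ((p - s mod p) * x)] (mod p)"
    unfolding b_def by (intro cong_add cong_mult) (simp_all add: cong_def)
  also have "s mod p + Q * ((p - s mod p) * x) = s mod p + (p - s mod p) * (Q * x)"
    by (simp add: algebra_simps)
  also have "[\<dots> = s mod p + (p - s mod p) * 1] (mod p)"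
    using x by (intro cong_add cong_mult) auto
  also have "s mod p + (p - s mod p) * 1 = p" using \<open>p > 0\<close> by simp
  finally have b0: "[s + Q * b = 0] (mod p)" by (simp add: cong_def)
  have "p dvd s + Q * t \<longleftrightarrow> t mod p = b" for t
  proof -
    have "p dvd s + Q * t \<longleftrightarrow> [s + Q * t = s + Q * b] (mod p)"
      using b0 by (simp add: cong_def mod_eq_0_iff_dvd)
    also have "\<dots> \<longleftrightarrow> [t = b] (mod p)"
      using assms by (simp add: cong_add_lcancel_nat cong_mult_lcancel_nat coprime_commute)
    finally show ?thesis by (simp add: cong_def b_def)
  qed
  moreover have "b < p" using \<open>p > 0\<close> by (simp add: b_def)
  ultimately show ?thesis using that by blast
qed

text \<open>Indexing the terms divisible by \<open>p\<close> by \<open>i\<close> makes them a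
  progression with difference \<open>Q * p\<close>, to which a sieve applies again. The first bound
  on \<open>K\<close> serves the union bound, the second Legendre's sieve.\<close>

lemma linear_form_class_image:
  fixes p s Q M :: nat
  assumes "p > 0" "coprime p Q"
  obtains b K where "{t \<in> {..<M}. p dvd s + Q * t} = (\<lambda>i. b + p * i) ` {..<K}"
    "K \<le> (M + p - 1) div p" "\<bar>real K - real M / real p\<bar> \<le> 1"
proof -
  obtain b where b: "b < p" "\<And>t. p dvd s + Q * t \<longleftrightarrow> t mod p = b"
    using linear_form_class[OF assms, of s] by metis
  \<comment> \<open>Since \<open>b < p\<close>, the subtraction does not truncate; \<open>K\<close>
    is the ceiling of \<open>(M - b) / p\<close>.\<close>
  define K where "K = (M + p - 1 - b) div p"
  have iK: "i < K \<longleftrightarrow> b + p * i < M" for i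
  proof -
    have "i < K \<longleftrightarrow> Suc i \<le> K" by auto
    also have "\<dots> \<longleftrightarrow> Suc i * p \<le> M + p - 1 - b"
      unfolding K_def using assms(1) by (simp add: less_eq_div_iff_mult_less_eq)
    also have "\<dots> \<longleftrightarrow> b + p * i < M" using b(1) by (auto simp: algebra_simps)
    finally show ?thesis .
  qed
  have "{t \<in> {..<M}. p dvd s + Q * t} = (\<lambda>i. b + p * i) ` {..<K}"
  proof (intro equalityI subsetI)
    fix t assume "t \<in> {t \<in> {..<M}. p dvd s + Q * t}"
    then have t: "t < M" "t mod p = b" using b(2) by auto
    have "t = b + p * (t div p)" using t(2) by (metis mod_mult_div_eq)
    then show "t \<in> (\<lambda>i. b + p * i) ` {..<K}" using iK[of "t div p"] t(1) by auto
  next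
    fix t assume "t \<in> (\<lambda>i. b + p * i) ` {..<K}"
    then show "t \<in> {t \<in> {..<M}. p dvd s + Q * t}" using iK b by auto
  qed
  moreover have "K \<le> (M + p - 1) div p" unfolding K_def by (intro div_le_mono) simp
  moreover have "\<bar>real K - real M / real p\<bar> \<le> 1"
  proof -
    have "p * K \<le> M + p" unfolding K_def
      using times_div_less_eq_dividend[of p "M + p - 1 - b"] by linarith
    then have 1: "real p * real K \<le> real M + real p" by (metis of_nat_add of_nat_le_iff of_nat_mult)
    have "M \<le> b + p * K" using iK[of K] by simp
    then have "M \<le> p + p * K" using b(1) by linarith
    then have 2: "real M \<le> real p + real p * real K" by (metis of_nat_add of_nat_le_iff of_nat_mult)
    show ?thesis using 1 2 assms(1) by (simp add: abs_le_iff field_simps)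
  qed
  ultimately show ?thesis using that by blast
qed

lemma card_image_filter_linear:
  fixes b p K :: nat
  assumes "p > 0"
  shows "card {t \<in> (\<lambda>i. b + p * i) ` {..<K}. P t} = card {i \<in> {..<K}. P (b + p * i)}"
proof -
  have "{t \<in> (\<lambda>i. b + p * i) ` {..<K}. P t} = (\<lambda>i. b + p * i) ` {i \<in> {..<K}. P (b + p * i)}" by auto
  moreover have "inj_on (\<lambda>i. b + p * i) {i \<in> {..<K}. P (b + p * i)}"
    using assms by (auto simp: inj_on_def)
  ultimately show ?thesis by (simp add: card_image)
qed

text \<open>Inclusion and exclusion by induction on \<open>S\<close>: the multiples of a new prime
  \<open>p\<close> form a progression with difference \<open>Q * p\<close>, so two error terms and a
  rounding error of at most \<open>1\<close> add up, which turns \<open>2 ^ k - 1\<close> into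
  \<open>2 ^ (k + 1) - 1\<close>. Hence \<open>s\<close>, \<open>Q\<close> and \<open>M\<close> vary
  in the induction.\<close>

lemma legendre_sieve:
  fixes S :: "nat set"
  assumes "finite S" "\<And>p. p \<in> S \<Longrightarrow> prime p" "\<And>p. p \<in> S \<Longrightarrow> coprime p Q"
  shows "\<bar>real (card {t \<in> {..<M}. \<forall>p\<in>S. \<not> p dvd s + Q * t}) - real M * (\<Prod>p\<in>S. 1 - 1 / real p)\<bar>
           \<le> 2 ^ card S - 1"
  using assms
proof (induction S arbitrary: s Q M rule: finite_induct)
  case empty
  then show ?case by simp
next
  case (insert p S)
  define F where "F = (\<lambda>s Q M. card {t \<in> {..<M}. \<forall>p\<in>S. \<not> p dvd s + Q * t})"
  define r where "r = (\<Prod>p\<in>S. 1 - 1 / real p)"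
  have p: "prime p" "coprime p Q" using insert.prems by auto
  then have p0: "p > 0" by (simp add: prime_gt_0_nat)
  obtain b K where K: "{t \<in> {..<M}. p dvd s + Q * t} = (\<lambda>i. b + p * i) ` {..<K}"
    "\<bar>real K - real M / real p\<bar> \<le> 1"
    using linear_form_class_image[OF p0 p(2), of M s] by metis
  have IH: "\<bar>real (F s' Q' M') - real M' * r\<bar> \<le> 2 ^ card S - 1"
    if "\<And>q. q \<in> S \<Longrightarrow> coprime q Q'" for s' Q' M'
    unfolding F_def r_def using insert.IH[of Q' M' s'] that insert.prems by blast
  have 1: "\<bar>real (F s Q M) - real M * r\<bar> \<le> 2 ^ card S - 1" by (rule IH) (use insert.prems in auto)
  \<comment> \<open>The new difference stays coprime to the other primes because \<open>p\<close> is
    not in \<open>S\<close>.\<close>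
  have "coprime q (Q * p)" if "q \<in> S" for q
    using that insert.prems insert.hyps by (metis coprime_mult_right_iff insertCI primes_coprime)
  then have 2: "\<bar>real (F (s + Q * b) (Q * p) K) - real K * r\<bar> \<le> 2 ^ card S - 1" by (rule IH)
  let ?A = "{t \<in> {..<M}. \<forall>p\<in>S. \<not> p dvd s + Q * t}"
  let ?B = "{t \<in> {t \<in> {..<M}. p dvd s + Q * t}. \<forall>p\<in>S. \<not> p dvd s + Q * t}"
  have "card ?B = F (s + Q * b) (Q * p) K"
    unfolding K(1) card_image_filter_linear[OF p0] F_def by (simp add: algebra_simps)
  moreover have "{t \<in> {..<M}. \<forall>p\<in>insert p S. \<not> p dvd s + Q * t} = ?A - ?B" by auto
  moreover have "card (?A - ?B) = card ?A - card ?B" by (rule card_Diff_subset) auto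
  moreover have "card ?B \<le> card ?A" by (rule card_mono) auto
  ultimately have 3: "real (card {t \<in> {..<M}. \<forall>p\<in>insert p S. \<not> p dvd s + Q * t})
      = real (F s Q M) - real (F (s + Q * b) (Q * p) K)" by (simp add: F_def)
  have r: "0 \<le> r" "r \<le> 1" unfolding r_def
    using insert.prems by (auto intro!: prod_nonneg prod_le_1 simp: prime_gt_0_nat Suc_leI)
  have 4: "\<bar>(real K - real M / real p) * r\<bar> \<le> 1"
    using K(2) r by (simp add: abs_mult mult_le_one)
  have 5: "real M * ((1 - 1 / real p) * r) = real M * r - real K * r + (real K - real M / real p) * r"
    by (simp add: algebra_simps)
  have 6: "(\<Prod>q\<in>insert p S. 1 - 1 / real q) = (1 - 1 / real p) * r"
    "(2::real) ^ card (insert p S) = 2 * 2 ^ card S" using insert.hyps by (simp_all add: r_def)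
  have "\<bar>x - y - (u - v + d)\<bar> \<le> 2 * c - 1"
    if "\<bar>x - u\<bar> \<le> c - 1" "\<bar>y - v\<bar> \<le> c - 1" "\<bar>d\<bar> \<le> 1" for x y u v d c :: real
    using that by linarith
  from this[OF 1 2 4] show ?case unfolding 3 5 6 .
qed

text \<open>Each prime rules out at most \<open>(M + p - 1) div p\<close> of the \<open>M\<close>
  terms, so by \<open>lt\<close> some term survives.\<close>

lemma union_sieve:
  fixes S :: "nat set"
  assumes "finite S" "\<And>p. p \<in> S \<Longrightarrow> prime p" "\<And>p. p \<in> S \<Longrightarrow> coprime p Q"
    and lt: "(\<Sum>p\<in>S. (M + p - 1) div p) < M"
  shows "\<exists>t<M. \<forall>p\<in>S. \<not> p dvd s + Q * t"
proof (rule ccontr)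
  assume *: "\<not> ?thesis"
  have "card {t \<in> {..<M}. p dvd s + Q * t} \<le> (M + p - 1) div p" if "p \<in> S" for p
  proof -
    have "p > 0" "coprime p Q" using assms that by (auto simp: prime_gt_0_nat)
    then obtain b K where "{t \<in> {..<M}. p dvd s + Q * t} = (\<lambda>i. b + p * i) ` {..<K}"
      "K \<le> (M + p - 1) div p" using linear_form_class_image[of p Q M s] by metis
    then show ?thesis using card_image_le[of "{..<K}" "\<lambda>i. b + p * i"] by simp
  qed
  then have "(\<Sum>p\<in>S. card {t \<in> {..<M}. p dvd s + Q * t}) \<le> (\<Sum>p\<in>S. (M + p - 1) div p)"
    by (rule sum_mono)
  moreover have "{..<M} \<subseteq> (\<Union>p\<in>S. {t \<in> {..<M}. p dvd s + Q * t})" using * by auto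
  then have "M \<le> card (\<Union>p\<in>S. {t \<in> {..<M}. p dvd s + Q * t})"
    using card_mono[of "\<Union>p\<in>S. {t \<in> {..<M}. p dvd s + Q * t}" "{..<M}"] assms(1) by simp
  ultimately show False
    using card_UN_le[OF assms(1), of "\<lambda>p. {t \<in> {..<M}. p dvd s + Q * t}"] lt by linarith
qed

text \<open>An injection of \<open>S - T\<close> into \<open>T - S\<close> never decreases
  \<open>f\<close>. It is used with \<open>T\<close> the smallest primes and \<open>f\<close>
  antitone, so that \<open>T\<close> is the worst case for the union bound.\<close>

lemma sum_exchange_le:
  fixes f :: "nat \<Rightarrow> nat"
  assumes "finite S" "finite T" "card S \<le> card T"
    and le: "\<And>x y. x \<in> S - T \<Longrightarrow> y \<in> T - S \<Longrightarrow> f x \<le> f y"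
  shows "sum f S \<le> sum f T"
proof -
  have "card S = card (S \<inter> T) + card (S - T)" "card T = card (S \<inter> T) + card (T - S)"
    using assms(1,2) by (metis card_Int_Diff, metis card_Int_Diff inf_commute)
  then have c: "card (S - T) \<le> card (T - S)" using assms(3) by linarith
  then obtain g where g: "inj_on g (S - T)" "g ` (S - T) \<subseteq> T - S"
    using assms(1,2) by (meson card_le_inj finite_Diff)
  have "sum f (S - T) \<le> (\<Sum>x\<in>S - T. f (g x))" using le g by (intro sum_mono) blast
  also have "\<dots> = sum f (g ` (S - T))" using g by (simp add: sum.reindex)
  also have "\<dots> \<le> sum f (T - S)" using g assms by (intro sum_mono2) auto
  finally have "sum f (S - T) \<le> sum f (T - S)" .
  moreover have "sum f S = sum f (S \<inter> T) + sum f (S - T)" "sum f T = sum f (S \<inter> T) + sum f (T - S)"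
    using assms(1,2) by (metis sum.Int_Diff, metis sum.Int_Diff inf_commute)
  ultimately show ?thesis by simp
qed

text \<open>After cancelling \<open>S \<inter> T\<close>, both sides are compared with powers of
  \<open>N\<close>.\<close>

lemma prod_exchange_le:
  fixes N :: nat
  assumes "finite S" "finite T" "card T \<le> card S"
    and "\<And>x. x \<in> S - T \<Longrightarrow> N \<le> x" "\<And>y. y \<in> T \<Longrightarrow> y \<le> N"
  shows "\<Prod>T * N ^ (card S - card T) \<le> \<Prod>S"
proof -
  have c: "card S = card (S \<inter> T) + card (S - T)" "card T = card (S \<inter> T) + card (T - S)"
    using assms(1,2) by (metis card_Int_Diff, metis card_Int_Diff inf_commute)
  have "\<Prod>T = \<Prod>(S \<inter> T) * \<Prod>(T - S)" using assms(2) by (metis prod.Int_Diff inf_commute)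
  also have "\<Prod>(T - S) \<le> N ^ card (T - S)"
    using prod_mono[of "T - S" "\<lambda>x. x" "\<lambda>_. N"] assms(5) by simp
  finally have "\<Prod>T * N ^ (card S - card T) \<le> \<Prod>(S \<inter> T) * (N ^ card (T - S) * N ^ (card S - card T))"
    by (simp add: mult_right_mono mult.assoc)
  also have "N ^ card (T - S) * N ^ (card S - card T) = N ^ card (S - T)"
    using c assms(3) by (simp flip: power_add)
  also have "\<dots> \<le> \<Prod>(S - T)" using prod_mono[of "S - T" "\<lambda>_. N" "\<lambda>x. x"] assms(4) by simp
  also have "\<Prod>(S \<inter> T) * \<Prod>(S - T) = \<Prod>S" using assms(1) by (metis prod.Int_Diff)
  finally show ?thesis by simp
qed

section \<open>Extremal sets of primes from 5 on\<close>

lemma prime_below_47: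
  fixes p :: nat
  assumes "prime p" "5 \<le> p" "p < 47"
  shows "p \<in> {5, 7, 11, 13, 17, 19, 23, 29, 31, 37, 41, 43}"
proof -
  have "\<forall>p\<in>set [5..<47]. prime p \<longrightarrow> p \<in> set [5, 7, 11, 13, 17, 19, 23, 29, 31, 37, 41, 43 :: nat]"
    by code_simp
  moreover have "p \<in> set [5..<47]" using assms by (simp only: set_upt atLeastLessThan_iff)
  ultimately have "p \<in> set [5, 7, 11, 13, 17, 19, 23, 29, 31, 37, 41, 43]" using assms(1) by blast
  then show ?thesis by simp
qed

text \<open>The constants are the products of the first 3 to 7 and of the first 12 primes from
  \<open>5\<close> on; every further element contributes at least \<open>43\<close>.\<close>

lemma prime_prod_lower_bounds:
  fixes S :: "nat set"
  assumes "finite S" "\<And>p. p \<in> S \<Longrightarrow> prime p \<and> 5 \<le> p"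
  shows "card S \<ge> 4 \<Longrightarrow> \<Prod>S \<ge> 5005"
    and "card S \<ge> 3 \<Longrightarrow> \<Prod>S \<ge> 385"
    and "card S \<ge> 5 \<Longrightarrow> \<Prod>S \<ge> 85085"
    and "card S \<ge> 6 \<Longrightarrow> \<Prod>S \<ge> 1616615"
    and "card S \<ge> 7 \<Longrightarrow> \<Prod>S \<ge> 37182145"
    and "card S \<ge> 12 \<Longrightarrow> \<Prod>S \<ge> 2180460221945005 * 43 ^ (card S - 12)"
proof -
  have *: "\<Prod>T * N ^ (card S - card T) \<le> \<Prod>S"
    if "card T \<le> card S" "finite T" "\<And>x. x \<in> S - T \<Longrightarrow> N \<le> x" "\<And>y. y \<in> T \<Longrightarrow> y \<le> N" for T N
    using that assms(1) by (intro prod_exchange_le) auto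
  have **: "\<Prod>T \<le> \<Prod>S"
    if "card T \<le> card S" "finite T" "\<And>x. x \<in> S - T \<Longrightarrow> N \<le> x" "\<And>y. y \<in> T \<Longrightarrow> y \<le> N" "N > 0" for T N
  proof -
    have "\<Prod>T * 1 \<le> \<Prod>T * N ^ (card S - card T)" using that(5) by (intro mult_left_mono) auto
    then show ?thesis using *[OF that(1-4)] by linarith
  qed
  have mem: "x \<ge> 47 \<or> x \<in> {5, 7, 11, 13, 17, 19, 23, 29, 31, 37, 41, 43}" if "x \<in> S" for x
    using prime_below_47[of x] assms(2)[OF that] by force
  show "card S \<ge> 3 \<Longrightarrow> \<Prod>S \<ge> 385"
    using **[of "{5,7,11}" 13] mem by force
  show "card S \<ge> 4 \<Longrightarrow> \<Prod>S \<ge> 5005"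
    using **[of "{5,7,11,13}" 17] mem by force
  show "card S \<ge> 5 \<Longrightarrow> \<Prod>S \<ge> 85085"
    using **[of "{5,7,11,13,17}" 19] mem by force
  show "card S \<ge> 6 \<Longrightarrow> \<Prod>S \<ge> 1616615"
    using **[of "{5,7,11,13,17,19}" 23] mem by force
  show "card S \<ge> 7 \<Longrightarrow> \<Prod>S \<ge> 37182145"
    using **[of "{5,7,11,13,17,19,23}" 29] mem by force
  show "card S \<ge> 12 \<Longrightarrow> \<Prod>S \<ge> 2180460221945005 * 43 ^ (card S - 12)"
  proof -
    let ?T = "{5, 7, 11, 13, 17, 19, 23, 29, 31, 37, 41, 43} :: nat set"
    assume "12 \<le> card S"
    moreover have T: "card ?T = 12" "\<Prod>?T = 2180460221945005" by simp_all
    moreover have "43 \<le> x" if "x \<in> S - ?T" for x using mem[of x] that by auto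
    ultimately have "\<Prod>?T * 43 ^ (card S - card ?T) \<le> \<Prod>S" by (intro *) auto
    then show ?thesis unfolding T .
  qed
qed

text \<open>The union bound is largest for the smallest primes, where it is \<open>6\<close>,
  \<open>9\<close>, \<open>29\<close> for \<open>M = 7\<close>, \<open>11\<close>,
  \<open>31\<close>. For \<open>M \<le> 5\<close> every prime rules out at most one term.\<close>

lemma union_sieve_small:
  fixes S :: "nat set"
  assumes "finite S" "\<And>p. p \<in> S \<Longrightarrow> prime p \<and> 5 \<le> p \<and> coprime p Q"
    and M: "card S < M \<and> M \<le> 5 \<or> card S \<le> 5 \<and> M = 7 \<or> card S \<le> 6 \<and> M = 11 \<or> card S \<le> 11 \<and> M = 31"
  shows "\<exists>t<M. \<forall>p\<in>S. \<not> p dvd s + Q * t"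
proof (rule union_sieve)
  let ?f = "\<lambda>p. (M + p - 1) div p"
  have *: "sum ?f S \<le> sum ?f T"
    if "finite T" "card S \<le> card T" "\<And>x y. x \<in> S - T \<Longrightarrow> y \<in> T \<Longrightarrow> y \<le> x" "\<And>y. y \<in> T \<Longrightarrow> 0 < y" for T
  proof (rule sum_exchange_le)
    fix x y assume "x \<in> S - T" "y \<in> T - S"
    then have yx: "0 < y" "y \<le> x" using that by auto
    show "?f x \<le> ?f y"
    proof (cases "M = 0")
      case True
      then show ?thesis using yx by simp
    next
      case False
      have "?f x = (M - 1) div x + 1" "?f y = (M - 1) div y + 1"
        using yx False div_add_self2[of x "M - 1"] div_add_self2[of y "M - 1"] by auto
      then show ?thesis using div_le_mono2[OF yx] by simp
    qed
  qed (use that assms(1) in auto)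
  have mem: "x \<ge> 47 \<or> x \<in> {5, 7, 11, 13, 17, 19, 23, 29, 31, 37, 41, 43}" if "x \<in> S" for x
    using prime_below_47[of x] assms(2)[OF that] by force
  from M show "sum ?f S < M"
  proof (elim disjE conjE)
    assume a: "card S < M" "M \<le> 5"
    have "?f p = 1" if "p \<in> S" for p
    proof -
      have "M + p - 1 = M - 1 + p" "M - 1 < p" "p \<noteq> 0" using a assms(2)[OF that] by linarith+
      then show ?thesis using div_add_self2[of p "M - 1"] by (metis add_0 div_less)
    qed
    then have "sum ?f S = (\<Sum>p\<in>S. 1)" by (intro sum.cong refl)
    also have "\<dots> = card S" by simp
    finally show ?thesis using a(1) by simp
  next
    assume a: "card S \<le> 5" "M = 7"
    have "y \<le> x" if "x \<in> S - {5,7,11,13,17}" "y \<in> {5,7,11,13,17}" for x y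
      using mem[of x] that by auto
    then have "sum ?f S \<le> sum ?f {5,7,11,13,17}" using a by (intro *) auto
    then show ?thesis using a by simp
  next
    assume a: "card S \<le> 6" "M = 11"
    have "y \<le> x" if "x \<in> S - {5,7,11,13,17,19}" "y \<in> {5,7,11,13,17,19}" for x y
      using mem[of x] that by auto
    then have "sum ?f S \<le> sum ?f {5,7,11,13,17,19}" using a by (intro *) auto
    then show ?thesis using a by simp
  next
    assume a: "card S \<le> 11" "M = 31"
    have "y \<le> x" if "x \<in> S - {5,7,11,13,17,19,23,29,31,37,41}" "y \<in> {5,7,11,13,17,19,23,29,31,37,41}" for x y
      using mem[of x] that by auto
    then have "sum ?f S \<le> sum ?f {5,7,11,13,17,19,23,29,31,37,41}" using a by (intro *) auto
    then show ?thesis using a by simp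
  qed
qed (use assms in auto)

text \<open>The product in Legendre's sieve is at least \<open>4 / (card S + 4)\<close>, so by
  \<open>M\<close> the main term is at least \<open>2 ^ card S\<close> and exceeds the
  error.\<close>

lemma legendre_sieve_large:
  fixes S :: "nat set"
  assumes "finite S" "\<And>p. p \<in> S \<Longrightarrow> prime p \<and> 5 \<le> p \<and> coprime p Q"
    and M: "(card S + 4) * 2 ^ card S \<le> 4 * M"
  shows "\<exists>t<M. \<forall>p\<in>S. \<not> p dvd s + Q * t"
proof (rule ccontr)
  assume "\<not> ?thesis"
  then have none: "{t \<in> {..<M}. \<forall>p\<in>S. \<not> p dvd s + Q * t} = {}" by auto
  have "\<bar>real (card {t \<in> {..<M}. \<forall>p\<in>S. \<not> p dvd s + Q * t}) - real M * (\<Prod>p\<in>S. 1 - 1 / real p)\<bar>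
           \<le> 2 ^ card S - 1"
    by (rule legendre_sieve) (use assms(1,2) in auto)
  then have 1: "real M * (\<Prod>p\<in>S. 1 - 1 / real p) \<le> 2 ^ card S - 1"
    unfolding none by (simp add: abs_le_iff)
  \<comment> \<open>The \<open>j\<close>-th smallest element of \<open>S\<close> is at least
    \<open>j + 4\<close>, and the product of \<open>1 - 1 / (j + 4)\<close> for \<open>j\<close>
    from \<open>1\<close> to \<open>k\<close> telescopes to \<open>4 / (k + 4)\<close>. The
    induction removes the maximum.\<close>
  have prod: "(\<Prod>p\<in>S. 1 - 1 / real p) \<ge> 4 / (real (card S) + 4)"
    if "finite S" "\<And>p. p \<in> S \<Longrightarrow> 5 \<le> p" for S :: "nat set"
    using that
  proof (induction "card S" arbitrary: S)
    case 0
    then show ?case by simp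
  next
    case (Suc k)
    define m where "m = Max S"
    have ne: "S \<noteq> {}" using Suc.hyps(2) by auto
    then have m: "m \<in> S" using Suc.prems by (simp add: m_def)
    have "S \<subseteq> {5..m}" using Suc.prems by (auto simp: m_def)
    then have "card S \<le> m - 4" using card_mono[of "{5..m}" S] by simp
    then have mk: "real k + 5 \<le> real m" using Suc.hyps(2) Suc.prems(2)[OF m] by linarith
    have k: "card (S - {m}) = k" using Suc.hyps(2) Suc.prems(1) m by simp
    have "4 / (real (card (S - {m})) + 4) \<le> (\<Prod>p\<in>S - {m}. 1 - 1 / real p)"
      by (rule Suc.hyps(1)) (use k Suc.prems in auto)
    then have "4 / (real k + 4) \<le> (\<Prod>p\<in>S - {m}. 1 - 1 / real p)" unfolding k .
    moreover have "1 - 1 / (real k + 5) \<le> 1 - 1 / real m" using mk by (simp add: frac_le)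
    moreover have "0 \<le> 1 - 1 / real m" using mk by simp
    ultimately have "(1 - 1 / (real k + 5)) * (4 / (real k + 4))
        \<le> (1 - 1 / real m) * (\<Prod>p\<in>S - {m}. 1 - 1 / real p)"
      by (intro mult_mono) simp_all
    also have "\<dots> = (\<Prod>p\<in>S. 1 - 1 / real p)" using Suc.prems(1) m by (simp add: prod.remove)
    also have "(1 - 1 / (real k + 5)) * (4 / (real k + 4)) = 4 / (real (card S) + 4)"
    proof -
      have "1 - 1 / (real k + 5) = (real k + 4) / (real k + 5)" by (simp add: field_simps)
      moreover have "real (card S) + 4 = real k + 5" using Suc.hyps(2) by linarith
      moreover have "u / v * (4 / u) = 4 / v" if "u > 0" for u v :: real using that by simp
      ultimately show ?thesis by (metis add_nonneg_pos of_nat_0_le_iff zero_less_numeral)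
    qed
    finally show ?case .
  qed
  have "4 / (real (card S) + 4) \<le> (\<Prod>p\<in>S. 1 - 1 / real p)"
    by (rule prod) (use assms(1,2) in auto)
  then have "real M * (4 / (real (card S) + 4)) \<le> real M * (\<Prod>p\<in>S. 1 - 1 / real p)"
    by (rule mult_left_mono) simp
  then have "real M * (4 / (real (card S) + 4)) \<le> 2 ^ card S - 1" using 1 by (rule order_trans)
  then have 2: "real M * 4 \<le> (2 ^ card S - 1) * (real (card S) + 4)"
    by (simp add: pos_divide_le_eq)
  have "real ((card S + 4) * 2 ^ card S) \<le> real (4 * M)"
    using M by (simp only: of_nat_le_iff)
  then have 3: "(real (card S) + 4) * 2 ^ card S \<le> 4 * real M" by simp
  have contra: False if "R * 4 \<le> (P - 1) * (c + 4)" "(c + 4) * P \<le> 4 * R" "c \<ge> 0" for R P c :: real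
  proof -
    have "(P - 1) * (c + 4) = (c + 4) * P - (c + 4)" by (simp add: algebra_simps)
    then show False using that by linarith
  qed
  show False using contra[OF 2 3] by simp
qed

text \<open>The factor \<open>36\<close> is the largest value of \<open>e * e\<close> in
  \<open>coprime_in_progression\<close>. From \<open>k\<close> to \<open>k + 1\<close> the left side
  grows by at most \<open>8 * (17 / 16) ^ 3\<close>, which is below \<open>43\<close>.\<close>

lemma legendre_bound_growth:
  "12 \<le> k \<Longrightarrow> 4 * 36 * ((k + 4) * 2 ^ (k - 2)) ^ 3 \<le> 2180460221945005 * 43 ^ (k - 12)" for k :: nat
proof (induction k rule: dec_induct)
  case base
  then show ?case by simp
next
  case (step k)
  have "16 * (k + 5) \<le> 17 * (k + 4)" using step by simp
  then have "(16 * (k + 5)) ^ 3 \<le> (17 * (k + 4)) ^ 3" by (rule power_mono) simp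
  then have "4096 * (k + 5) ^ 3 \<le> 4913 * (k + 4) ^ 3" unfolding power_mult_distrib by simp
  then have "8 * (k + 5) ^ 3 \<le> 43 * (k + 4) ^ 3" by linarith
  then have *: "8 * (k + 5) ^ 3 * (144 * (2 ^ (k - 2)) ^ 3) \<le> 43 * (k + 4) ^ 3 * (144 * (2 ^ (k - 2)) ^ 3)"
    by (rule mult_right_mono) simp
  have pow: "(2::nat) ^ (Suc k - 2) = 2 * 2 ^ (k - 2)" "(43::nat) ^ (Suc k - 12) = 43 * 43 ^ (k - 12)"
    using step by (simp_all add: Suc_diff_le flip: power_Suc)
  have "4 * 36 * ((Suc k + 4) * 2 ^ (Suc k - 2)) ^ 3 = 8 * (k + 5) ^ 3 * (144 * (2 ^ (k - 2)) ^ 3)"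
    unfolding pow power_mult_distrib by (simp add: ac_simps)
  also note *
  also have "43 * (k + 4) ^ 3 * (144 * (2 ^ (k - 2)) ^ 3) = 43 * (4 * 36 * ((k + 4) * 2 ^ (k - 2)) ^ 3)"
    unfolding power_mult_distrib by (simp add: ac_simps)
  also have "\<dots> \<le> 43 * (2180460221945005 * 43 ^ (k - 12))"
    using step.IH by (intro mult_left_mono) auto
  finally show ?case unfolding pow by (simp add: ac_simps)
qed

text \<open>The primes \<open>2\<close> and \<open>3\<close> are removed by passing to a subprogression. For at most \<open>11\<close> further prime
  divisors of \<open>d\<close> the union bound suffices, for more of them Legendre's sieve, since \<open>C\<close> is then
  large compared with their number. The union bound is too weak for \<open>6 dvd d\<close> and small \<open>C\<close>.\<close>

lemma coprime_in_progression:
  fixes C d s Q :: nat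
  assumes d: "d > 0" "coprime Q d" "2 * d \<le> C ^ 3" and C: "C \<ge> 24"
    and six: "6 dvd d \<Longrightarrow> C \<ge> 60 \<or> C \<ge> 48 \<and> d < 30030 \<or> C \<ge> 36 \<and> d < 2310"
  shows "\<exists>t<C div 2. coprime (s + Q * t) d"
proof -
  \<comment> \<open>\<open>e\<close> is \<open>gcd d 6\<close>; the primes \<open>2\<close> and
    \<open>3\<close>, which would exhaust a union bound, are treated apart from the other prime
    divisors of \<open>d\<close>.\<close>
  define e where "e = (if 2 dvd d then 2 else 1) * (if 3 dvd d then 3 else 1 :: nat)"
  define S where "S = prime_factors d - {2, 3}"
  define L where "L = C div 2"
  have e: "e \<in> {1, 2, 3, 6}" by (simp add: e_def)
  have ed: "e dvd d" by (auto simp: e_def intro: divides_mult)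
  have prime5: "p \<ge> 5" if "prime p" "p \<noteq> 2" "p \<noteq> 3" for p :: nat
  proof (rule ccontr)
    assume "\<not> 5 \<le> p"
    then have "p = 0 \<or> p = 1 \<or> p = 4" using that by linarith
    then show False using that(1) by auto
  qed
  have S: "prime p \<and> 5 \<le> p \<and> coprime p Q \<and> coprime p e" if "p \<in> S" for p
  proof -
    have p: "prime p" "p dvd d" "p \<noteq> 2" "p \<noteq> 3" using that by (auto simp: S_def)
    have "coprime p Q" using coprime_divisors[OF p(2) dvd_refl] d(2) by (simp add: coprime_commute)
    moreover have "coprime p 2" "coprime p 3"
      using primes_coprime[of p 2] primes_coprime[of p 3] p by simp_all
    then have "coprime p e" by (simp add: e_def)
    ultimately show ?thesis using p prime5 by simp
  qed
  have fin: "finite S" by (simp add: S_def)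
  have eS: "e * \<Prod>S \<le> d"
  proof -
    have "\<Prod>S dvd \<Prod>(prime_factors d)" by (rule prod_dvd_prod_subset) (auto simp: S_def)
    also have "\<dots> dvd d" 
    proof -
      have "\<Prod>(prime_factors d) dvd (\<Prod>p\<in>prime_factors d. p ^ multiplicity p d)"
        by (intro prod_dvd_prod dvd_power) (auto simp: prime_factors_multiplicity)
      then show ?thesis using prime_factorization_nat[of d] d(1) by simp
    qed
    finally have "\<Prod>S dvd d" .
    moreover have "coprime e (\<Prod>S)" using S by (intro prod_coprime_right) (simp add: coprime_commute)
    ultimately show ?thesis using ed d(1) by (simp add: divides_mult dvd_imp_le)
  qed
  \<comment> \<open>Fixing \<open>t\<close> modulo \<open>e\<close> makes all terms congruent to
    \<open>1\<close> modulo \<open>e\<close>, hence free of common factors \<open>2\<close> and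
    \<open>3\<close> with \<open>d\<close>. The subprogression with difference \<open>Q * e\<close>
    then only has to avoid \<open>S\<close>.\<close>
  have reduce: "\<exists>t<C div 2. coprime (s + Q * t) d"
    if ex: "\<And>s' Q'. (\<And>p. p \<in> S \<Longrightarrow> coprime p Q') \<Longrightarrow> \<exists>t<M. \<forall>p\<in>S. \<not> p dvd s' + Q' * t" and eM: "e * M \<le> L" for M
  proof -
    have "coprime Q e" by (rule coprime_divisors[OF dvd_refl ed d(2)])
    then obtain x where x: "[Q * x = 1] (mod e)" using cong_solve_coprime_nat[of Q e] by auto
    obtain t0 where t0: "t0 < e" "[s + Q * t0 = 1] (mod e)"
    proof -
      \<comment> \<open>\<open>s * (e - 1)\<close> represents \<open>- s\<close> modulo
        \<open>e\<close> over the naturals.\<close>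
      define y where "y = x * (1 + s * (e - 1))"
      have "s * e = s + s * (e - 1)" using e by (cases e) auto
      have "[s + Q * y = s + 1 * (1 + s * (e - 1))] (mod e)"
        unfolding y_def mult.assoc[symmetric] using x by (intro cong_add cong_mult) auto
      also have "s + 1 * (1 + s * (e - 1)) = 1 + s * e" using \<open>s * e = s + s * (e - 1)\<close> by simp
      also have "[\<dots> = 1] (mod e)" unfolding cong_def by (rule mod_mult_self1)
      finally have "[s + Q * y = 1] (mod e)" .
      moreover have "[s + Q * (y mod e) = s + Q * y] (mod e)"
        by (intro cong_add cong_mult) (simp_all add: cong_def)
      ultimately have "[s + Q * (y mod e) = 1] (mod e)" by (metis cong_trans)
      moreover have "y mod e < e" using e by auto
      ultimately show ?thesis using that[of "y mod e"] by blast
    qed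
    obtain t where t: "t < M" "\<forall>p\<in>S. \<not> p dvd (s + Q * t0) + (Q * e) * t"
      using ex[of "Q * e" "s + Q * t0"] S by auto
    define t' where "t' = t0 + e * t"
    have v: "s + Q * t' = (s + Q * t0) + (Q * e) * t" by (simp add: t'_def algebra_simps)
    have "e * (t + 1) \<le> e * M" using t(1) by (intro mult_left_mono) auto
    then have "t' < L" using t0(1) eM unfolding t'_def by simp
    moreover have "coprime (s + Q * t') d"
    proof (rule ccontr)
      assume "\<not> coprime (s + Q * t') d"
      then obtain p where p: "prime p" "p dvd s + Q * t'" "p dvd d"
      proof -
        have "gcd (s + Q * t') d \<noteq> 1" using \<open>\<not> coprime (s + Q * t') d\<close> by (simp only: coprime_iff_gcd_eq_1 not_False_eq_True)
        then obtain p where "prime p" "p dvd gcd (s + Q * t') d" using prime_factor_nat by blast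
        then show ?thesis
          using that[of p] dvd_trans[of p _ "s + Q * t'", OF _ gcd_dvd1] dvd_trans[of p _ d, OF _ gcd_dvd2] by blast
      qed
      show False
      proof (cases "p = 2 \<or> p = 3")
        case True
        then have "p dvd e" using p(3) by (auto simp: e_def)
        have "[s + Q * t' = 1 + 0] (mod e)" unfolding v using t0(2)
          by (intro cong_add) (simp_all add: cong_def)
        then have "[s + Q * t' = 1] (mod p)" using \<open>p dvd e\<close> cong_dvd_modulus_nat by auto
        then have "p dvd 1" using cong_dvd_iff p(2) by blast
        then show False using p(1) by simp
      next
        case False
        then have "p \<in> S" using p d(1) by (auto simp: S_def in_prime_factors_iff)
        then show False using t(2) p(2) v by simp
      qed
    qed
    ultimately show ?thesis by (auto simp: L_def)
  qed
  have CL: "C \<le> 2 * L + 1" by (simp add: L_def)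
  \<comment> \<open>Otherwise \<open>C < 2 * (e * M)\<close>, and
    \<open>C ^ 3 < 2 * e * B \<le> 2 * d \<le> C ^ 3\<close>: many prime divisors of
    \<open>d\<close> force \<open>C\<close> to be large.\<close>
  have cube: "e * M \<le> L" if "B \<le> \<Prod>S" "(2 * (e * M)) ^ 3 \<le> 2 * e * B" "M > 0" for M B
  proof (rule ccontr)
    assume "\<not> e * M \<le> L"
    then have "C < 2 * (e * M)" using CL by linarith
    then have "C ^ 3 < (2 * (e * M)) ^ 3" by (rule power_strict_mono) auto
    also have "\<dots> \<le> 2 * (e * B)" using that(2) by (simp add: mult.assoc)
    also have "\<dots> \<le> 2 * (e * \<Prod>S)" using that(1) by simp
    also have "\<dots> \<le> C ^ 3" using eS d(3) by linarith
    finally show False by simp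
  qed
  note lower = prime_prod_lower_bounds[of S, OF fin]
  have union: "\<exists>t<C div 2. coprime (s + Q * t) d"
    if "card S < M \<and> M \<le> 5 \<or> card S \<le> 5 \<and> M = 7 \<or> card S \<le> 6 \<and> M = 11 \<or> card S \<le> 11 \<and> M = 31"
      "e * M \<le> L" for M
    by (rule reduce[OF _ that(2)], rule union_sieve_small) (use S fin that(1) in auto)
  have e6: "6 dvd d" if "e = 6"
    using that ed by simp
  consider "card S \<ge> 12" | "7 \<le> card S" "card S \<le> 11" | "card S = 6" | "card S = 5" | "card S \<le> 4"
    by linarith
  then show ?thesis
  proof cases
    case 1
    \<comment> \<open>Four times this \<open>M\<close> is exactly what
      \<open>legendre_sieve_large\<close> asks for.\<close>
    define M where "M = (card S + 4) * 2 ^ (card S - 2)"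
    define B where "B = 2180460221945005 * (43::nat) ^ (card S - 12)"
    have "4 * 36 * M ^ 3 \<le> B" unfolding M_def B_def by (rule legendre_bound_growth[OF 1])
    moreover have "4 * (e * e) * M ^ 3 \<le> 4 * 36 * M ^ 3" using e by auto
    ultimately have "4 * (e * e) * M ^ 3 \<le> B" by linarith
    then have "2 * e * (4 * (e * e) * M ^ 3) \<le> 2 * e * B" by (rule mult_left_mono) simp
    then have "e * M \<le> L" using lower(6) S 1
      by (intro cube[of B]) (auto simp: B_def M_def power3_eq_cube algebra_simps)
    have pw: "(2::nat) ^ (card S - 2 + 2) = 4 * 2 ^ (card S - 2)" unfolding power_add by simp
    have c: "card S - 2 + 2 = card S" using 1 by simp
    have "(card S + 4) * 2 ^ card S \<le> 4 * M" using pw unfolding c by (simp add: M_def)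
    with \<open>e * M \<le> L\<close> show ?thesis
      by (intro reduce[of M] legendre_sieve_large) (use S fin in auto)
  next
    case 2
    then show ?thesis using lower(5) S e by (intro union[of 31] cube[of 37182145]) auto
  next
    case 3
    then show ?thesis using lower(4) S e by (intro union[of 11] cube[of 1616615]) auto
  next
    case 4
    then show ?thesis using lower(3) S e by (intro union[of 7] cube[of 85085]) auto
  next
    case 5
    show ?thesis
    \<comment> \<open>Five terms suffice against four primes. If they do not fit, \<open>e\<close>
      is \<open>3\<close> or \<open>6\<close> and \<open>d\<close> is too small for that many
      primes: \<open>6 * 5005 = 30030\<close> and \<open>6 * 385 = 2310\<close> are the thresholds
      in \<open>six\<close>, and \<open>3 * 5005\<close> exceeds half of \<open>29 ^ 3\<close>. Four
      or three terms are then enough.\<close>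
    proof (cases "5 * e \<le> L")
      case True
      then show ?thesis using 5 by (intro union[of 5]) auto
    next
      case False
      then have L: "\<not> 5 * e \<le> C div 2" by (simp add: L_def)
      have "C div 2 \<ge> 12" using C by simp
      then have "e \<noteq> 1" "e \<noteq> 2" using L by auto
      then have "e = 3 \<or> e = 6" using e by auto
      moreover have "C < 30" if "e = 3" using L that by simp
      moreover have "C < 60" if "e = 6" using L that by simp
      ultimately consider "e = 6" "C \<ge> 48" "d < 30030" | "e = 6" "C \<ge> 36" "d < 2310" | "e = 3" "C < 30"
        using six e6 by linarith
      then show ?thesis
      proof cases
        case 1
        then have "card S < 4" using lower(1) S eS by (cases "card S \<ge> 4") auto
        then show ?thesis using 1 by (intro union[of 4]) (auto simp: L_def)
      next
        case 2
        then have "card S < 3" using lower(2) S eS by (cases "card S \<ge> 3") auto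
        then show ?thesis using 2 by (intro union[of 3]) (auto simp: L_def)
      next
        case 3
        then have "C ^ 3 \<le> 29 ^ 3" by (intro power_mono) auto
        then have "card S < 4" using 3 lower(1) S eS d(3) by (cases "card S \<ge> 4") auto
        then show ?thesis using 3 C by (intro union[of 4]) (auto simp: L_def)
      qed
    qed
  qed
qed

section \<open>Pairwise coprime representatives\<close>

text \<open>For all \<open>s, r, q\<close> of suitable parity, \<open>(A u/2, B v/2, C w/2)\<close> satisfies the congruences of
  \<open>block_triple\<close> below; the flags tell which entry is \<open>A/2\<close> modulo \<open>A\<close> instead of \<open>0\<close>.\<close>

definition short_solution ::
    "int \<Rightarrow> int \<Rightarrow> int \<Rightarrow> bool \<Rightarrow> bool \<Rightarrow> bool \<Rightarrow> int \<times> int \<times> int \<Rightarrow> bool" where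
  "short_solution A B C fa fb fc = (\<lambda>(s, r, q).
     let u = B * s + C * r; v = A * s + C * q; w = A * r + B * q in
     even u = (\<not> fa) \<and> even v = (\<not> fb) \<and> even w = (\<not> fc) \<and> 0 < u \<and> 0 < v \<and> 0 < w \<and>
     (let i = A * u div 2; j = B * v div 2; k = C * w div 2; n = A * B * C in
       i < n \<and> j < n \<and> k < n \<and> gcd i j = 1 \<and> gcd i k = 1 \<and> gcd j k = 1))"

text \<open>The parameters were found by a computer search over all \<open>A < B < C\<close> in the ranges checked below.\<close>

definition has_short_solutions :: "int \<Rightarrow> int \<Rightarrow> int \<Rightarrow> bool" where
  "has_short_solutions A B C \<longleftrightarrow>
    even A \<and>
      list_ex (short_solution A B C False False False) [(6,4,2), (4,2,2), (10,6,2), (-2,2,2)] \<and>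
      (A mod 4 \<noteq> 0 \<or>
        list_ex (short_solution A B C True False False) [(5,2,6), (2,1,2), (-1,2,2)]) \<or>
    even B \<and>
      list_ex (short_solution A B C False False False) [(6,2,4), (2,2,2), (4,2,2), (2,2,4)] \<and>
      (B mod 4 \<noteq> 0 \<or>
        list_ex (short_solution A B C False True False) [(3,2,2), (2,2,1), (1,2,4)]) \<or>
    even C \<and>
      list_ex (short_solution A B C False False False) [(2,12,2), (-2,2,6), (-2,6,2), (2,2,2)] \<and>
      (C mod 4 \<noteq> 0 \<or>
        list_ex (short_solution A B C False False True) [(-2,2,3), (-2,3,4), (2,6,1)]) \<or>
    odd A \<and> odd B \<and> odd C \<and>
      list_ex (short_solution A B C False False False)
        [(7,1,3), (7,3,1), (-1,1,9), (1,9,1), (5,3,1), (7,9,1), (7,-1,3), (1,13,3), (1,15,1),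
         (3,1,1), (1,1,3), (-1,3,3)]"

text \<open>Written with \<open>\<or>\<close> instead of \<open>\<longrightarrow>\<close> because \<open>code_simp\<close> evaluates conjunctions and
  disjunctions lazily, but not implications.\<close>

definition check_row :: "int list \<Rightarrow> int \<Rightarrow> int \<Rightarrow> bool" where
  "check_row xs m C \<longleftrightarrow>
     list_all (\<lambda>B. C \<le> B \<or> gcd B C \<noteq> 1 \<or>
        list_all (\<lambda>A. B \<le> A \<or> A * B * C < m \<or> gcd A B \<noteq> 1 \<or> gcd A C \<noteq> 1 \<or>
           has_short_solutions A B C) xs) xs"

lemma check_below_24: "list_all (check_row [2..22] 0) [4..23]"
  by code_simp

text \<open>From \<open>C = 24\<close> on the sieve can only fail if both smaller factors are
  coprime to \<open>6\<close>, so only such integers are listed.\<close>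

lemma check_24_35: "list_all (check_row [5, 7, 11, 13, 17, 19, 23, 25, 29, 31] 0) [24..35]"
  by code_simp

text \<open>\<open>4620\<close>, and \<open>60060\<close> in the next table, are twice
  \<open>2310\<close> and \<open>30030\<close>: below them \<open>2 * d \<le> A * B * C\<close>
  yields the bound on \<open>d\<close> that the sieve needs.\<close>

lemma check_36_47:
  "list_all (check_row [5, 7, 11, 13, 17, 19, 23, 25, 29, 31, 35, 37, 41, 43] 4620) [36..47]"
  by code_simp

lemma check_48_59:
  "list_all (check_row
     [5, 7, 11, 13, 17, 19, 23, 25, 29, 31, 35, 37, 41, 43, 47, 49, 53, 55] 60060) [48..59]"
  by code_simp

text \<open>The second alternative is \<open>A / 2\<close> for \<open>A\<close> divisible by
  \<open>4\<close>. Evenness of \<open>a\<close> ensures that every prime divisor of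
  \<open>A\<close> divides \<open>a\<close>, as \<open>halved_coprime\<close> requires.\<close>

definition halved :: "int \<Rightarrow> int \<Rightarrow> bool" where
  "halved A a \<longleftrightarrow> a = 0 \<or> (even a \<and> A = 2 * a)"

text \<open>At each factor one entry is killed by \<open>2\<close> and agrees with the difference of
  the other two; \<open>halved_cong_minus\<close> makes the order of the difference
  immaterial.\<close>

definition block_triple ::
    "int \<Rightarrow> int \<Rightarrow> int \<Rightarrow> int \<Rightarrow> int \<Rightarrow> int \<Rightarrow> int \<Rightarrow> int \<Rightarrow> int \<Rightarrow> bool" where
  "block_triple A B C a b c x y z \<longleftrightarrow>
     [x = a] (mod A) \<and> [y - z = a] (mod A) \<and>
     [y = b] (mod B) \<and> [x - z = b] (mod B) \<and>
     [z = c] (mod C) \<and> [x - y = c] (mod C)"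

section \<open>Residues killed by two, and rescaling by units\<close>

lemma halved_dvd: "halved A a \<Longrightarrow> A dvd 2 * a"
  by (auto simp: halved_def)

lemma halved_cong_minus:
  assumes "halved A a" "[x - y = a] (mod A)"
  shows "[y - x = a] (mod A)"
proof -
  have "A dvd (x - y - a)" using assms(2) by (simp add: cong_iff_dvd_diff)
  then have "A dvd - (x - y - a) - 2 * a" using halved_dvd[OF assms(1)] by (metis dvd_diff dvd_minus_iff)
  then show ?thesis by (simp add: cong_iff_dvd_diff algebra_simps)
qed

lemma coprime_dvd_right: "coprime x y \<Longrightarrow> z dvd y \<Longrightarrow> coprime x z" for x y z :: int
  by (rule coprime_divisors[OF dvd_refl])

text \<open>Turns coprimality of integers into a unit modulo \<open>A\<close>: either
  \<open>A\<close> divides \<open>x\<close>, or \<open>a\<close> does, and \<open>A = 2 * a\<close>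
  with \<open>a\<close> even has the same prime divisors as \<open>a\<close>.\<close>

lemma halved_coprime:
  assumes "halved A a" "[x = a] (mod A)" "coprime x y"
  shows "coprime y A"
proof -
  have dvd: "A dvd x - a" using assms(2) by (simp add: cong_iff_dvd_diff)
  show ?thesis
  proof (cases "a = 0")
    case True
    then show ?thesis using dvd assms(3) coprime_divisors[of A x y y] by (simp add: coprime_commute)
  next
    case False
    then have a: "even a" "A = 2 * a" using assms(1) by (auto simp: halved_def)
    then have "a dvd x - a" using dvd by (metis dvd_mult_right)
    then have "a dvd x" by (metis diff_add_cancel dvd_add dvd_refl)
    then have "coprime y a" using assms(3) coprime_divisors[of a x y y] by (simp add: coprime_commute)
    moreover from this have "coprime y 2"
      using a(1) coprime_dvd_right by blast
    ultimately show ?thesis unfolding a(2) by simp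
  qed
qed

lemma halved_not_unit:
  assumes "halved A a" "[x = a] (mod A)" "A > 1"
  shows "x \<noteq> 1"
proof
  assume "x = 1"
  then have "coprime A A" using halved_coprime[OF assms(1,2), of A] by simp
  then show False using assms(3) by simp
qed

text \<open>If \<open>a\<close> is nonzero, then \<open>A = 2 * a\<close> is even, so
  \<open>u\<close> is odd and \<open>2 * a\<close> divides \<open>(u - 1) * a\<close>.\<close>

lemma halved_mult_cong:
  assumes "halved A a" "coprime u A"
  shows "[u * a = a] (mod A)"
proof (cases "a = 0")
  case False
  then have a: "A = 2 * a" using assms(1) by (auto simp: halved_def)
  then have "odd u" using assms(2) by simp
  then have "even (u - 1)" by simp
  then have "2 * a dvd (u - 1) * a" by (rule mult_dvd_mono) simp
  then show ?thesis unfolding a by (simp add: cong_iff_dvd_diff algebra_simps)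
qed simp

text \<open>Units modulo \<open>A\<close> fix \<open>a\<close>, so a unit that matches one entry of
  the triples matches the other two as well.\<close>

lemma halved_transfer:
  assumes "halved A a" "coprime u A"
    and "[x = a] (mod A)" "[y - z = a] (mod A)" "[i = a] (mod A)" "[j - k = a] (mod A)"
    and "[u * y = j] (mod A)"
  shows "[u * x = i] (mod A)" "[u * z = k] (mod A)"
proof -
  have ua: "[u * a = a] (mod A)" by (rule halved_mult_cong[OF assms(1,2)])
  have "[u * x = u * a] (mod A)" using assms(3) by (intro cong_mult) auto
  also note ua
  also have "[a = i] (mod A)" using assms(5) by (rule cong_sym)
  finally show "[u * x = i] (mod A)" .
  have "[u * (y - z) = u * a] (mod A)" using assms(4) by (intro cong_mult) auto
  also note ua
  also have "[a = j - k] (mod A)" using assms(6) by (rule cong_sym)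
  finally have "[u * y - u * (y - z) = j - (j - k)] (mod A)" using assms(7) by (rule cong_diff[rotated])
  then show "[u * z = k] (mod A)" by (simp add: algebra_simps)
qed

lemma coprime_mult_cong:
  fixes A B :: int
  assumes "coprime A B" "[x = y] (mod A)" "[x = y] (mod B)"
  shows "[x = y] (mod (A * B))"
  using assms by (simp add: cong_iff_dvd_diff divides_mult)

lemma unit_quotient:
  fixes A x y :: int
  assumes "coprime x A" "coprime y A"
  shows "\<exists>u. coprime u A \<and> [u * x = y] (mod A)"
proof -
  obtain w where w: "[x * w = 1] (mod A)" using cong_solve_coprime_int[OF assms(1)] by blast
  have "[(y * w) * x = y * 1] (mod A)"
    using cong_scalar_left[OF w, of y] by (simp add: ac_simps)
  moreover from this have "coprime ((y * w) * x) A"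
    using assms(2) by (metis cong_imp_coprime cong_sym mult.right_neutral)
  ultimately show ?thesis by (intro exI[of _ "y * w"]) simp
qed

lemma coprime_if_cong: "[u = v] (mod A) \<Longrightarrow> coprime v A \<Longrightarrow> coprime u A" for u v A :: int
  by (metis cong_imp_coprime cong_sym)

lemma chinese_remainder_3:
  fixes A B C :: int
  assumes "coprime A B" "coprime A C" "coprime B C"
  shows "\<exists>x. [x = p] (mod A) \<and> [x = q] (mod B) \<and> [x = r] (mod C)"
proof -
  obtain y where y: "[y = p] (mod A)" "[y = q] (mod B)"
    using binary_chinese_remainder_int[OF assms(1)] by blast
  obtain x where x: "[x = y] (mod (A * B))" "[x = r] (mod C)"
    using binary_chinese_remainder_int[of "A * B" C] assms by auto
  have "[x = y] (mod A)" "[x = y] (mod B)"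
    using x(1) by (auto intro: cong_dvd_modulus)
  then show ?thesis using x(2) y by (blast intro: cong_trans)
qed

text \<open>Modulo each factor a unit carries one entry that is coprime to the factor to its
  counterpart. The Chinese remainder theorem glues the three units, and
  \<open>halved_transfer\<close> takes care of the remaining entries.\<close>

lemma block_triple_scale:
  assumes cop: "coprime A B" "coprime A C" "coprime B C"
    and h: "halved A a" "halved B b" "halved C c"
    and t: "block_triple A B C a b c x y z" "block_triple A B C a b c i j k"
    and xyz: "coprime y A" "coprime x B" "coprime x C"
    and ijk: "coprime i j" "coprime i k" "coprime j k"
  shows "\<exists>u. coprime u (A * B * C) \<and> [u * x = i] (mod (A * B * C)) \<and>
           [u * y = j] (mod (A * B * C)) \<and> [u * z = k] (mod (A * B * C))"
proof -
  note t = t[unfolded block_triple_def]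
  have "coprime j A" using halved_coprime[OF h(1)] t(2) ijk(1) by blast
  then obtain ua where ua: "coprime ua A" "[ua * y = j] (mod A)" using unit_quotient[OF xyz(1)] by blast
  have "coprime i B" using halved_coprime[OF h(2)] t(2) ijk(1) by (metis coprime_commute)
  then obtain ub where ub: "coprime ub B" "[ub * x = i] (mod B)" using unit_quotient[OF xyz(2)] by blast
  have "coprime i C" using halved_coprime[OF h(3)] t(2) ijk(2) by (metis coprime_commute)
  then obtain uc where uc: "coprime uc C" "[uc * x = i] (mod C)" using unit_quotient[OF xyz(3)] by blast
  obtain u where u: "[u = ua] (mod A)" "[u = ub] (mod B)" "[u = uc] (mod C)"
    using chinese_remainder_3[OF cop] by blast
  have cu: "coprime u A" "coprime u B" "coprime u C"
    using u ua(1) ub(1) uc(1) by (blast intro: coprime_if_cong)+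
  have "[u * y = ua * y] (mod A)" "[u * x = ub * x] (mod B)" "[u * x = uc * x] (mod C)"
    using u by (intro cong_mult; simp)+
  then have *: "[u * y = j] (mod A)" "[u * x = i] (mod B)" "[u * x = i] (mod C)"
    using ua(2) ub(2) uc(2) by (blast intro: cong_trans)+
  have A: "[u * x = i] (mod A)" "[u * z = k] (mod A)"
    using halved_transfer[OF h(1) cu(1) _ _ _ _ *(1)] t by blast+
  have B: "[u * y = j] (mod B)" "[u * z = k] (mod B)"
    using halved_transfer[OF h(2) cu(2) _ _ _ _ *(2)] t by blast+
  have C: "[u * z = k] (mod C)" "[u * y = j] (mod C)"
    using halved_transfer[OF h(3) cu(3) _ _ _ _ *(3)] t by blast+
  have "coprime (A * B) C" using cop by simp
  then show ?thesis using * A B C cu cop(1)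
    by (intro exI[of _ u]) (simp add: coprime_mult_cong)
qed

definition good_triple :: "int \<Rightarrow> int \<Rightarrow> int \<Rightarrow> int \<Rightarrow> int \<Rightarrow> int \<Rightarrow> bool" where
  "good_triple A B C a b c \<longleftrightarrow> (\<exists>i j k.
     1 < i \<and> i < A * B * C \<and> 1 < j \<and> j < A * B * C \<and> 1 < k \<and> k < A * B * C \<and>
     coprime i j \<and> coprime i k \<and> coprime j k \<and> block_triple A B C a b c i j k)"

text \<open>Exchanging two entries reverses the difference in the third congruence, which
  \<open>halved\<close> permits.\<close>

lemma good_triple_swap12:
  assumes "good_triple A B C a b c" "halved C c"
  shows "good_triple B A C b a c"
proof -
  obtain i j k where *: "1 < i \<and> i < A * B * C \<and> 1 < j \<and> j < A * B * C \<and> 1 < k \<and> k < A * B * C \<and>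
     coprime i j \<and> coprime i k \<and> coprime j k" "block_triple A B C a b c i j k"
    using assms(1) by (auto simp: good_triple_def)
  have "block_triple B A C b a c j i k"
    using *(2) halved_cong_minus[OF assms(2)] by (auto simp: block_triple_def)
  then show ?thesis unfolding good_triple_def using *(1)
    by (intro exI[of _ j] exI[of _ i] exI[of _ k]) (auto simp: coprime_commute ac_simps)
qed

lemma good_triple_swap23:
  assumes "good_triple A B C a b c" "halved A a"
  shows "good_triple A C B a c b"
proof -
  obtain i j k where *: "1 < i \<and> i < A * B * C \<and> 1 < j \<and> j < A * B * C \<and> 1 < k \<and> k < A * B * C \<and>
     coprime i j \<and> coprime i k \<and> coprime j k" "block_triple A B C a b c i j k"
    using assms(1) by (auto simp: good_triple_def)
  have "block_triple A C B a c b i k j"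
    using *(2) halved_cong_minus[OF assms(2)] by (auto simp: block_triple_def)
  then show ?thesis unfolding good_triple_def using *(1)
    by (intro exI[of _ i] exI[of _ k] exI[of _ j]) (auto simp: coprime_commute ac_simps)
qed

section \<open>Triples from the sieve, for a large factor \<open>C\<close>\<close>

text \<open>The triple is \<open>(i, i - d, D)\<close> with \<open>i = s + Q * t\<close>. As
  \<open>D\<close> divides \<open>d\<close>, all coprimality conditions follow from
  \<open>coprime i d\<close>, and the congruences for \<open>d\<close> are those that make the
  differences of the entries correct.\<close>

lemma good_triple_aux:
  fixes A B C :: int
  assumes gt: "A > 1" "B > 1" "A < C" "B < C" "C \<ge> 24"
    and cop: "coprime A B" "coprime A C" "coprime B C"
    and h: "halved A a" "halved B b" "halved C c"
    and D: "D = (if c = 0 then C else c)"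
    and d: "[d = - D] (mod A)" "[d = D] (mod B)" "[d = D] (mod C)" "0 < d" "2 * d \<le> A * B * C"
    and six: "coprime A 6 \<Longrightarrow> coprime B 6 \<Longrightarrow>
      C \<ge> 60 \<or> C \<ge> 48 \<and> A * B * C < 60060 \<or> C \<ge> 36 \<and> A * B * C < 4620"
  shows "good_triple A B C a b c"
proof -
  define Q where "Q = A * B"
  have Q: "Q > 0" using gt by (simp add: Q_def)
  have D1: "D > 1" "D dvd C" "[D = c] (mod C)"
  proof -
    show "D > 1" using h(3) gt D by (cases "c = 0") (auto simp: halved_def)
    show "D dvd C" using h(3) D by (cases "c = 0") (auto simp: halved_def)
    show "[D = c] (mod C)" using D by (cases "c = 0") (auto simp: cong_0_iff)
  qed
  have primesD: "coprime i C" if "coprime i D" for i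
  proof (cases "c = 0")
    case False
    then have "coprime i c" "even c" "C = 2 * c" using that h(3) D by (auto simp: halved_def)
    moreover from this have "coprime i 2" using coprime_dvd_right by blast
    ultimately show ?thesis by simp
  qed (use that D in simp)
  have Dd: "D dvd d" using d(3) D1(2) cong_dvd_modulus[OF d(3) D1(2)] by (simp add: cong_dvd_iff)
  have copD: "coprime A D" "coprime B D"
    using coprime_dvd_right[OF cop(2) D1(2)] coprime_dvd_right[OF cop(3) D1(2)] by auto
  have "coprime d A" by (rule coprime_if_cong[OF d(1)]) (use copD in \<open>simp add: coprime_commute\<close>)
  moreover have "coprime d B" by (rule coprime_if_cong[OF d(2)]) (use copD in \<open>simp add: coprime_commute\<close>)
  ultimately have Qd: "coprime Q d" "coprime A d" "coprime B d" by (simp_all add: Q_def coprime_commute)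
  obtain s0 where s0: "[s0 = a] (mod A)" "[s0 = D + b] (mod B)"
    using binary_chinese_remainder_int[OF cop(1)] by blast
  \<comment> \<open>The representative of \<open>s0\<close> modulo \<open>Q\<close> between
    \<open>d + 1\<close> and \<open>d + Q\<close>, so that \<open>j = i - d\<close> becomes
    positive.\<close>
  define s where "s = d + 1 + (s0 - d - 1) mod Q"
  have s: "d < s" "s \<le> d + Q" 
    using pos_mod_bound[OF Q, of "s0 - d - 1"] pos_mod_sign[OF Q, of "s0 - d - 1"]
    unfolding s_def by linarith+
  have "[s = d + 1 + (s0 - d - 1)] (mod Q)" unfolding s_def
    by (intro cong_add) (auto simp: cong_def)
  then have sQ: "[s = s0] (mod Q)" by simp
  have n3: "A * B * C \<le> C * C * C" using gt by (intro mult_mono) auto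
  have "\<exists>t<nat C div 2. coprime (nat s + nat Q * t) (nat d)"
  proof (rule coprime_in_progression)
    show "nat d > 0" using d(4) by simp
    show "coprime (nat Q) (nat d)" using Qd(1) Q d(4) by (simp add: coprime_nat_abs_left_iff flip: coprime_int_iff)
    have "2 * d \<le> C ^ 3" using d(5) n3 by (simp add: power3_eq_cube)
    then have "nat (2 * d) \<le> nat (C ^ 3)" by (rule nat_mono)
    then show "2 * nat d \<le> nat C ^ 3" using gt d(4) by (simp add: nat_mult_distrib nat_power_eq)
    show "24 \<le> nat C" using gt by simp
    assume "6 dvd nat d"
    then have "6 dvd d" using d(4) by (metis int_dvd_int_iff int_nat_eq less_imp_le of_nat_numeral)
    \<comment> \<open>\<open>A\<close> and \<open>B\<close> are coprime to \<open>d\<close>, hence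
      to its divisor \<open>6\<close>.\<close>
    then have "coprime A 6" "coprime B 6" using Qd coprime_dvd_right by blast+
    from six[OF this] d(5)
    show "60 \<le> nat C \<or> 48 \<le> nat C \<and> nat d < 30030 \<or> 36 \<le> nat C \<and> nat d < 2310"
      using d(4) gt by auto
  qed
  then obtain t where t: "t < nat C div 2" "coprime (nat s + nat Q * t) (nat d)" by blast
  define i where "i = s + Q * int t"
  have "int (nat s + nat Q * t) = i" using s Q d(4) by (simp add: i_def)
  then have id: "coprime i d" using t(2) d(4) by (metis coprime_int_iff int_nat_eq less_imp_le)
  have iQ: "[i = s0] (mod Q)"
    using sQ unfolding i_def by (metis cong_mult_self_left cong_add add.right_neutral)
  have iA: "[i = a] (mod A)" using iQ s0(1) unfolding Q_def by (meson cong_modulus_mult cong_trans)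
  have iB: "[i = D + b] (mod B)"
    using iQ s0(2) unfolding Q_def by (metis cong_modulus_mult cong_trans mult.commute)
  have "2 * (x + 1) \<le> N" if "x < N div 2" for x N :: nat
    using that by (simp add: less_eq_div_iff_mult_less_eq flip: Suc_le_eq)
  from this[OF t(1)] have "2 * (t + 1) \<le> nat C" .
  then have "int (2 * (t + 1)) \<le> int (nat C)" by (simp only: of_nat_le_iff)
  then have "2 * (int t + 1) \<le> C" using gt by simp
  then have "Q * (2 * (int t + 1)) \<le> Q * C" using Q by (intro mult_left_mono) auto
  then have "2 * (Q * int t + Q) \<le> Q * C" by (simp add: algebra_simps)
  moreover have "x + u \<le> N" if "2 * (u + v) \<le> N" "x \<le> e + v" "2 * e \<le> N" for x u v e N :: int
    using that by simp
  \<comment> \<open>One half of \<open>A * B * C\<close> bounds \<open>d\<close>, the other half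
    bounds \<open>Q * t + Q\<close>; this is why the sieve works with \<open>C div 2\<close>
    terms.\<close>
  ultimately have "i \<le> A * B * C" using s(2) d(5) unfolding i_def Q_def by blast
  moreover have "i \<noteq> A * B * C"
  proof
    assume "i = A * B * C"
    then have "D dvd i" using D1(2) by simp
    then have "coprime D D" using id Dd coprime_divisors[of D i D d] by simp
    then show False using D1(1) by simp
  qed
  moreover have "0 \<le> Q * int t" using Q by simp
  ultimately have i: "i < A * B * C" "d < i" using s(1) by (simp_all add: i_def)
  define j where "j = i - d"
  have j: "0 < j" "j < A * B * C" using i d(4) by (auto simp: j_def)
  have "[j = D + b - D] (mod B)" unfolding j_def by (intro cong_diff iB d(2))
  then have jB: "[j = b] (mod B)" by simp
  have "[j - D = a - (- D) - D] (mod A)" unfolding j_def by (intro cong_diff iA d(1)) auto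
  then have jkA: "[j - D = a] (mod A)" by simp
  have "[i - D = D + b - D] (mod B)" by (intro cong_diff iB) auto
  then have ikB: "[i - D = b] (mod B)" by simp
  have ijC: "[i - j = c] (mod C)" unfolding j_def using d(3) D1(3) by (auto intro: cong_trans)
  have iD: "coprime i D" by (rule coprime_dvd_right[OF id Dd])
  have "gcd (i - d) d = 1" using id by (simp only: gcd_diff1 coprime_iff_gcd_eq_1)
  then have "coprime j d" by (simp only: j_def coprime_iff_gcd_eq_1)
  then have jD: "coprime j D" using Dd by (rule coprime_dvd_right)
  have ij: "coprime i j"
  proof (rule coprimeI)
    fix p assume p: "p dvd i" "p dvd j"
    then have "p dvd i - j" by (rule dvd_diff)
    then have "p dvd d" by (simp add: j_def)
    with id p(1) show "is_unit p" by (rule coprime_common_divisor)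
  qed
  have "D < A * B * C"
  proof -
    have "D \<le> C" using D1 gt by (simp add: zdvd_imp_le)
    moreover have "1 * C < (A * B) * C" using gt by (intro mult_strict_right_mono less_1_mult) auto
    ultimately show ?thesis by simp
  qed
  moreover have "j \<noteq> 1" using halved_not_unit[OF h(2) jB] gt by simp
  ultimately show ?thesis unfolding good_triple_def block_triple_def
    using i j d(4) D1 iD jD ij iA jkA jB ikB ijC
    by (intro exI[of _ i] exI[of _ j] exI[of _ D]) auto
qed

text \<open>If \<open>d\<close> exceeds half of \<open>n\<close>, it is replaced by
  \<open>n - d\<close>, which interchanges the roles of \<open>A\<close> and \<open>B\<close>.
  Modulo \<open>C\<close> the sign of \<open>D\<close> is irrelevant because \<open>C\<close>
  divides \<open>2 * D\<close>.\<close>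

lemma good_triple_large:
  fixes A B C :: int
  assumes gt: "A > 1" "B > 1" "A < C" "B < C" "C \<ge> 24"
    and cop: "coprime A B" "coprime A C" "coprime B C"
    and h: "halved A a" "halved B b" "halved C c"
    and six: "coprime A 6 \<Longrightarrow> coprime B 6 \<Longrightarrow>
      C \<ge> 60 \<or> C \<ge> 48 \<and> A * B * C < 60060 \<or> C \<ge> 36 \<and> A * B * C < 4620"
  shows "good_triple A B C a b c"
proof -
  define D where "D = (if c = 0 then C else c)"
  define n where "n = A * B * C"
  have n: "n > 0" using gt by (simp add: n_def)
  obtain d0 where d0: "[d0 = - D] (mod A)" "[d0 = D] (mod B)" "[d0 = D] (mod C)"
    using chinese_remainder_3[OF cop] by blast
  define d where "d = d0 mod n"
  have "[d = d0] (mod n)" by (simp add: d_def cong_def)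
  then have "[d = d0] (mod A)" "[d = d0] (mod B)" "[d = d0] (mod C)"
    by (auto intro: cong_dvd_modulus simp: n_def)
  then have d: "[d = - D] (mod A)" "[d = D] (mod B)" "[d = D] (mod C)"
    using d0 by (blast intro: cong_trans)+
  have DC: "D dvd C" "C dvd 2 * D" using h(3) by (auto simp: D_def halved_def)
  have "d \<noteq> 0"
  proof
    assume "d = 0"
    then have "B dvd D" using d(2) by (simp add: cong_iff_dvd_diff)
    then have "coprime B B" using coprime_dvd_right[OF cop(3)] dvd_trans[OF _ DC(1)] by blast
    then show False using gt by simp
  qed
  then have dn: "0 < d" "d < n" using n by (auto simp: d_def order_le_neq_trans)
  show ?thesis
  proof (cases "2 * d \<le> n")
    case True
    then show ?thesis
      by (intro good_triple_aux[OF gt cop h D_def d dn(1) _ six]) (auto simp: n_def)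
  next
    case False
    have "[n = 0] (mod A)" "[n = 0] (mod B)" "[n = 0] (mod C)" by (auto simp: n_def cong_0_iff)
    then have "[n - d = 0 - (- D)] (mod A)" "[n - d = 0 - D] (mod B)" "[n - d = 0 - D] (mod C)"
      using d by (blast intro: cong_diff)+
    moreover have "[- D = D] (mod C)" using DC(2) by (simp add: cong_iff_dvd_diff)
    ultimately have d': "[n - d = - D] (mod B)" "[n - d = D] (mod A)" "[n - d = D] (mod C)"
      by (auto intro: cong_trans)
    have "good_triple B A C b a c"
      by (rule good_triple_aux[OF gt(2,1,4,3,5) _ cop(3,2) h(2,1,3) D_def d'])
        (use dn False cop six in \<open>auto simp: n_def coprime_commute ac_simps\<close>)
    then show ?thesis using good_triple_swap12 h by blast
  qed
qed

section \<open>Triples from the tables, for a small factor \<open>C\<close>\<close>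

text \<open>The doubled entries are the sums of two of \<open>A * B * s\<close>,
  \<open>A * C * r\<close> and \<open>B * C * q\<close>, so the difference of two entries agrees
  with the third one modulo its factor. The parity of \<open>u\<close> decides between the residues
  \<open>0\<close> and \<open>A / 2\<close>.\<close>

lemma short_solution_good_triple:
  assumes s: "short_solution A B C fa fb fc srq"
    and gt: "A > 1" "B > 1" "C > 1"
    and h: "if fa then even a \<and> A = 2 * a else a = 0" "if fb then even b \<and> B = 2 * b else b = 0"
      "if fc then even c \<and> C = 2 * c else c = 0"
  shows "good_triple A B C a b c"
proof -
  obtain s r q where srq: "srq = (s, r, q)" by (cases srq)
  define u v w where "u = B * s + C * r" and "v = A * s + C * q" and "w = A * r + B * q"
  define i j k where "i = A * u div 2" and "j = B * v div 2" and "k = C * w div 2"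
  have par: "even u = (\<not> fa)" "even v = (\<not> fb)" "even w = (\<not> fc)" and pos: "0 < u" "0 < v" "0 < w"
    and lt: "i < A * B * C" "j < A * B * C" "k < A * B * C"
    and cop: "gcd i j = 1" "gcd i k = 1" "gcd j k = 1"
    using s unfolding srq short_solution_def Let_def i_def j_def k_def u_def v_def w_def by auto
  have half: "2 * (X * y div 2) = X * y \<and> [X * y div 2 = x] (mod X) \<and> 1 < X * y div 2"
    if "even y = (\<not> f)" "if f then even x \<and> X = 2 * x else x = 0" "X > 1" "y > 0"
    for f and X x y :: int
  proof (cases f)
    case True
    then have x: "even x" "X = 2 * x" and "odd y" using that by auto
    then obtain m where m: "y = 2 * m + 1" by (auto elim: oddE)
    have "X * y div 2 = x * y" using x by simp
    moreover have "[x * y = x] (mod X)" unfolding x m by (simp add: cong_iff_dvd_diff algebra_simps)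
    moreover have "1 < x * y"
    proof -
      have "x > 0" using x(2) that(3) by simp
      moreover have "x \<noteq> 1" using x(1) by auto
      ultimately have "x \<ge> 2" by linarith
      then show ?thesis using mult_mono[of 2 x 1 y] that(4) by simp
    qed
    ultimately show ?thesis using x by simp
  next
    case False
    then have "x = 0" "even y" using that by auto
    then obtain m where m: "y = 2 * m" by auto
    have "X * y div 2 = X * m" using m by simp
    moreover have "1 < X * m" using m that(3,4) mult_mono[of 2 X 1 m] by simp
    ultimately show ?thesis using m \<open>x = 0\<close> by (simp add: cong_iff_dvd_diff)
  qed
  have i: "2 * i = A * u" "[i = a] (mod A)" "1 < i" using half[OF par(1) h(1) gt(1) pos(1)] by (auto simp: i_def)
  have j: "2 * j = B * v" "[j = b] (mod B)" "1 < j" using half[OF par(2) h(2) gt(2) pos(2)] by (auto simp: j_def)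
  have k: "2 * k = C * w" "[k = c] (mod C)" "1 < k" using half[OF par(3) h(3) gt(3) pos(3)] by (auto simp: k_def)
  have eq: "j - k = i - A * (C * r)" "i - k = j - B * (C * q)" "i - j = k - C * (B * q)"
    using i(1) j(1) k(1) unfolding u_def v_def w_def by (simp_all add: algebra_simps)
  have shift: "[x - X * y = x'] (mod X)" if "[x = x'] (mod X)" for x x' X y :: int
    using cong_diff[OF that, of "X * y" 0] by (simp add: cong_0_iff)
  have "[j - k = a] (mod A)" "[i - k = b] (mod B)" "[i - j = c] (mod C)"
    unfolding eq by (rule shift, fact)+
  then show ?thesis unfolding good_triple_def block_triple_def
    using i j k lt cop[THEN coprime_iff_gcd_eq_1[THEN iffD2]]
    by (intro exI[of _ i] exI[of _ j] exI[of _ k] conjI)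
qed

text \<open>At most one of the coprime factors is even, and an odd factor only admits the residue
  \<open>0\<close>. Hence at most one flag is set, and its factor is then divisible by
  \<open>4\<close>.\<close>

lemma has_short_solutions_good_triple:
  assumes s: "has_short_solutions A B C"
    and gt: "A > 1" "B > 1" "C > 1"
    and cop: "coprime A B" "coprime A C" "coprime B C"
    and h: "halved A a" "halved B b" "halved C c"
  shows "good_triple A B C a b c"
proof -
  have odd0: "x = 0" if "halved X x" "odd X" for X x using that by (auto simp: halved_def)
  have mod4: "X mod 4 = 0" if "halved X x" "x \<noteq> 0" for X x
    using that by (auto simp: halved_def elim!: evenE)
  have nz: "even x \<and> X = 2 * x" if "halved X x" "x \<noteq> 0" for X x using that by (auto simp: halved_def)
  have par: "odd X \<or> odd Y" if "coprime X Y" for X Y :: int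
    using that coprime_common_divisor[of X Y 2] by auto
  have ex: "good_triple A B C a b c"
    if l: "list_ex (short_solution A B C fa fb fc) xs"
      and "fa = (a \<noteq> 0)" "fb = (b \<noteq> 0)" "fc = (c \<noteq> 0)" for fa fb fc xs
  proof -
    obtain srq where "short_solution A B C fa fb fc srq" using l by (auto simp: list_ex_iff)
    then show ?thesis
      by (rule short_solution_good_triple[OF _ gt]) (use nz[OF h(1)] nz[OF h(2)] nz[OF h(3)] that in auto)
  qed
  from s[unfolded has_short_solutions_def] show ?thesis
  proof (elim disjE, goal_cases)
    case 1
    have e: "even A" using 1 by (rule conjunct1)
    have z: "b = 0" "c = 0" using odd0[OF h(2)] odd0[OF h(3)] par[OF cop(1)] par[OF cop(2)] e by auto
    show ?case
    proof (cases "a = 0")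
      case True
      then show ?thesis using ex[OF 1[THEN conjunct2, THEN conjunct1]] z by simp
    next
      case False
      then have m4: "A mod 4 = 0" by (rule mod4[OF h(1)])
      have "list_ex (short_solution A B C True False False) [(5,2,6), (2,1,2), (-1,2,2)]"
        by (rule disjE[OF 1[THEN conjunct2, THEN conjunct2]], erule notE, rule m4, assumption)
      then show ?thesis by (rule ex) (use z False in simp_all)
    qed
  next
    case 2
    have e: "even B" using 2 by (rule conjunct1)
    have z: "a = 0" "c = 0" using odd0[OF h(1)] odd0[OF h(3)] par[OF cop(1)] par[OF cop(3)] e by auto
    show ?case
    proof (cases "b = 0")
      case True
      then show ?thesis using ex[OF 2[THEN conjunct2, THEN conjunct1]] z by simp
    next
      case False
      then have m4: "B mod 4 = 0" by (rule mod4[OF h(2)])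
      have "list_ex (short_solution A B C False True False) [(3,2,2), (2,2,1), (1,2,4)]"
        by (rule disjE[OF 2[THEN conjunct2, THEN conjunct2]], erule notE, rule m4, assumption)
      then show ?thesis by (rule ex) (use z False in simp_all)
    qed
  next
    case 3
    have e: "even C" using 3 by (rule conjunct1)
    have z: "a = 0" "b = 0" using odd0[OF h(1)] odd0[OF h(2)] par[OF cop(2)] par[OF cop(3)] e by auto
    show ?case
    proof (cases "c = 0")
      case True
      then show ?thesis using ex[OF 3[THEN conjunct2, THEN conjunct1]] z by simp
    next
      case False
      then have m4: "C mod 4 = 0" by (rule mod4[OF h(3)])
      have "list_ex (short_solution A B C False False True) [(-2,2,3), (-2,3,4), (2,6,1)]"
        by (rule disjE[OF 3[THEN conjunct2, THEN conjunct2]], erule notE, rule m4, assumption)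
      then show ?thesis by (rule ex) (use z False in simp_all)
    qed
  next
    case 4
    have "odd A" "odd B" "odd C"
      using 4 by (blast dest: conjunct1 conjunct2)+
    then have "a = 0" "b = 0" "c = 0" using odd0 h by auto
    then show ?case using ex[OF 4[THEN conjunct2, THEN conjunct2, THEN conjunct2]] by simp
  qed
qed

lemma coprime_6_below_59:
  fixes x :: int
  assumes "coprime x 6" "1 < x" "x < 59"
  shows "x \<in> set [5, 7, 11, 13, 17, 19, 23, 25, 29, 31, 35, 37, 41, 43, 47, 49, 53, 55]"
proof -
  have all: "list_all (\<lambda>x. gcd x 6 \<noteq> 1 \<or>
      x \<in> set [5, 7, 11, 13, 17, 19, 23, 25, 29, 31, 35, 37, 41, 43, 47, 49, 53, 55]) [2..58::int]"
    by code_simp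
  have x: "x \<in> set [2..58]" unfolding set_upto using assms by simp
  have "gcd x 6 = 1" using assms(1) by (simp only: coprime_iff_gcd_eq_1)
  with bspec[OF all[unfolded list_all_iff] x] show ?thesis by argo
qed

text \<open>The sieve leaves open \<open>C < 24\<close>, and \<open>C < 60\<close> with
  \<open>A\<close> and \<open>B\<close> coprime to \<open>6\<close>, from \<open>C = 36\<close> on
  only for products above the thresholds. The tables cover these cases.\<close>

lemma good_triple_sorted:
  assumes gt: "1 < A" "A < B" "B < C"
    and cop: "coprime A B" "coprime A C" "coprime B C"
    and h: "halved A a" "halved B b" "halved C c"
  shows "good_triple A B C a b c"
proof -
  have row: "has_short_solutions A B C" if "check_row xs m C" "A \<in> set xs" "B \<in> set xs" "m \<le> A * B * C" for xs m
  proof -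
    have g: "gcd B C = 1" "gcd A B = 1" "gcd A C = 1" using cop by (simp_all only: coprime_iff_gcd_eq_1)
    have n: "\<not> C \<le> B" "\<not> B \<le> A" "\<not> A * B * C < m" using gt that(4) by auto
    have "\<forall>B\<in>set xs. C \<le> B \<or> gcd B C \<noteq> 1 \<or> (\<forall>A\<in>set xs. B \<le> A \<or> A * B * C < m \<or>
        gcd A B \<noteq> 1 \<or> gcd A C \<noteq> 1 \<or> has_short_solutions A B C)"
      using that(1) unfolding check_row_def list_all_iff .
    from bspec[OF this that(3)] n(1) g(1) have "\<forall>A\<in>set xs. B \<le> A \<or> A * B * C < m \<or>
        gcd A B \<noteq> 1 \<or> gcd A C \<noteq> 1 \<or> has_short_solutions A B C" by argo
    from bspec[OF this that(2)] n(2,3) g(2,3) show ?thesis by argo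
  qed
  show ?thesis
  proof (cases "C < 24")
    case True
    have "C \<in> set [4..23]" "A \<in> set [2..22]" "B \<in> set [2..22]"
      unfolding set_upto using gt True by auto
    moreover have "0 \<le> A * B * C" using gt by simp
    ultimately have "has_short_solutions A B C"
      using check_below_24 row unfolding list_all_iff by blast
    then show ?thesis using has_short_solutions_good_triple gt cop h by simp
  next
    case ge24: False
    show ?thesis
    proof (cases "coprime A 6 \<and> coprime B 6 \<and>
        \<not> (C \<ge> 60 \<or> C \<ge> 48 \<and> A * B * C < 60060 \<or> C \<ge> 36 \<and> A * B * C < 4620)")
      case False
      then show ?thesis using ge24 gt cop h by (intro good_triple_large) auto
    next
      case True
      then have C: "C < 60" "C \<ge> 48 \<longrightarrow> 60060 \<le> A * B * C" "C \<ge> 36 \<longrightarrow> 4620 \<le> A * B * C" by auto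
      have mem: "A \<in> set [5, 7, 11, 13, 17, 19, 23, 25, 29, 31, 35, 37, 41, 43, 47, 49, 53, 55]"
        "B \<in> set [5, 7, 11, 13, 17, 19, 23, 25, 29, 31, 35, 37, 41, 43, 47, 49, 53, 55]"
        using coprime_6_below_59 True C(1) gt by simp_all
      have pos: "0 \<le> A * B * C" using gt by simp
      consider "C < 36" | "36 \<le> C" "C < 48" | "48 \<le> C" by linarith
      then have "has_short_solutions A B C"
      proof cases
        case 1
        have "A < 34" "B < 35" using 1 gt by auto
        then have "A \<in> set [5, 7, 11, 13, 17, 19, 23, 25, 29, 31]" "B \<in> set [5, 7, 11, 13, 17, 19, 23, 25, 29, 31]"
          using mem by auto
        moreover have "C \<in> set [24..35]" unfolding set_upto using 1 ge24 by simp
        ultimately show ?thesis using check_24_35 row pos unfolding list_all_iff by blast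
      next
        case 2
        have "A < 46" "B < 47" using 2 gt by auto
        then have "A \<in> set [5, 7, 11, 13, 17, 19, 23, 25, 29, 31, 35, 37, 41, 43]"
          "B \<in> set [5, 7, 11, 13, 17, 19, 23, 25, 29, 31, 35, 37, 41, 43]"
          using mem by auto
        moreover have "C \<in> set [36..47]" unfolding set_upto using 2 by simp
        ultimately show ?thesis using check_36_47 row C(3) 2(1) unfolding list_all_iff by blast
      next
        case 3
        have "C \<in> set [48..59]" unfolding set_upto using 3 C(1) by simp
        then show ?thesis using check_48_59 row mem C(2) 3 unfolding list_all_iff by blast
      qed
      then show ?thesis using has_short_solutions_good_triple gt cop h by simp
    qed
  qed
qed

theorem good_triple_exists:
  assumes gt: "A > 1" "B > 1" "C > 1"
    and cop: "coprime A B" "coprime A C" "coprime B C"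
    and h: "halved A a" "halved B b" "halved C c"
  shows "good_triple A B C a b c"
proof -
  have ne: "A \<noteq> B" "A \<noteq> C" "B \<noteq> C" using gt cop by auto
  note cop' = cop cop[THEN coprime_commute[THEN iffD1]]
  consider "A < B" "B < C" | "A < C" "C < B" | "B < A" "A < C" | "B < C" "C < A" | "C < A" "A < B" | "C < B" "B < A"
    using ne by linarith
  then show ?thesis
  proof cases
    case 1
    then show ?thesis using good_triple_sorted gt cop' h by blast
  next
    case 2
    then have "good_triple A C B a c b" using good_triple_sorted gt cop' h by blast
    then show ?thesis using good_triple_swap23 h by blast
  next
    case 3
    then have "good_triple B A C b a c" using good_triple_sorted gt cop' h by blast
    then show ?thesis using good_triple_swap12 h by blast
  next
    case 4
    then have "good_triple B C A b c a" using good_triple_sorted gt cop' h by blast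
    then show ?thesis using good_triple_swap23 good_triple_swap12 h by blast
  next
    case 5
    then have "good_triple C A B c a b" using good_triple_sorted gt cop' h by blast
    then show ?thesis using good_triple_swap23 good_triple_swap12 h by blast
  next
    case 6
    then have "good_triple C B A c b a" using good_triple_sorted gt cop' h by blast
    then show ?thesis using good_triple_swap23 good_triple_swap12 h by blast
  qed
qed

section \<open>The Klein four-group case\<close>

text \<open>The shape of a Klein triple modulo a prime power. All conditions pass to products of
  coprime moduli, so prime powers with the same special entry can be merged. The parity clause
  excludes the residue \<open>q / 2\<close> when that is odd.\<close>

definition block :: "int \<Rightarrow> int \<Rightarrow> int \<Rightarrow> int \<Rightarrow> bool" where
  "block q x y z \<longleftrightarrow>
     q dvd 2 * x \<and> (even q \<longrightarrow> even x) \<and> q dvd y - z - x \<and> coprime y q \<and> coprime z q"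

lemma block_1: "block 1 x y z" by (simp add: block_def)

lemma block_mult: "coprime p q \<Longrightarrow> block p x y z \<Longrightarrow> block q x y z \<Longrightarrow> block (p * q) x y z"
  by (auto simp: block_def divides_mult)

text \<open>If \<open>A\<close> does not divide \<open>x\<close>, then \<open>A = 2 * a\<close> and
  \<open>x\<close> is an odd multiple of \<open>a\<close>, hence congruent to \<open>a\<close>;
  evenness of \<open>x\<close> makes \<open>a\<close> even.\<close>

lemma block_halved:
  assumes "block A x y z"
  obtains a where "halved A a" "[x = a] (mod A)" "[y - z = a] (mod A)"
proof (cases "A dvd x")
  case True
  then have "A dvd y - z" using assms by (metis block_def diff_add_cancel dvd_add)
  then show ?thesis using True that[of 0] by (simp add: halved_def cong_0_iff)
next
  case False
  have d: "A dvd 2 * x" and ev: "even A \<longrightarrow> even x" using assms by (auto simp: block_def)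
  have "even A"
  proof (rule ccontr)
    assume "odd A"
    then have "coprime A 2" by simp
    then show False using d False coprime_dvd_mult_right_iff by blast
  qed
  then obtain a where a: "A = 2 * a" by blast
  then have "a dvd x" using d by simp
  then obtain m where m: "x = a * m" by blast
  have "odd m" using False unfolding a m by (auto elim!: evenE)
  then obtain l where l: "m = 2 * l + 1" by (auto elim: oddE)
  have "even a" using ev \<open>even A\<close> \<open>odd m\<close> m by simp
  moreover have xa: "[x = a] (mod A)" unfolding m l a by (simp add: cong_iff_dvd_diff algebra_simps)
  moreover have "[y - z = x] (mod A)" using assms by (simp add: block_def cong_iff_dvd_diff)
  ultimately show ?thesis using that[of a] a by (auto simp: halved_def intro: cong_trans)
qed

text \<open>The relations say that \<open>t \<mapsto> l t + x\<close> and \<open>t \<mapsto> m t + y\<close> act on \<open>{0, x, y, z}\<close> as two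
  of the three fixed-point-free involutions.\<close>

definition klein :: "int \<Rightarrow> int \<Rightarrow> int \<Rightarrow> int \<Rightarrow> int \<Rightarrow> int \<Rightarrow> bool" where
  "klein n l m x y z \<longleftrightarrow>
     n dvd l * x + x \<and> n dvd l * y + x - z \<and> n dvd l * z + x - y \<and>
     n dvd m * y + y \<and> n dvd m * x + y - z \<and> n dvd m * z + y - x"

lemma klein_swap: "klein n l m x y z \<longleftrightarrow> klein n m l y x z"
  by (auto simp: klein_def)

text \<open>The composite of the two involutions is the third one,
  \<open>t \<mapsto> l * m * t + z\<close>. Together with \<open>klein_swap\<close>, any entry can
  be brought to the front.\<close>

lemma klein_rotate:
  assumes "klein n l m x y z"
  shows "klein n (l * m) l z x y"
proof -
  have *: "n dvd l * x + x" "n dvd l * y + x - z" "n dvd l * z + x - y"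
     "n dvd m * y + y" "n dvd m * x + y - z" "n dvd m * z + y - x"
    using assms by (auto simp: klein_def)
  have "n dvd l * (m * z + y - x) + (l * x + x) - (l * y + x - z)"
    by (rule dvd_diff[OF dvd_add[OF dvd_mult[OF *(6)] *(1)] *(2)])
  moreover have "n dvd l * (m * x + y - z) - (l * y + x - z) + (l * z + x - y)"
    by (rule dvd_add[OF dvd_diff[OF dvd_mult[OF *(5)] *(2)] *(3)])
  moreover have "n dvd l * (m * y + y) - (l * y + x - z)"
    by (rule dvd_diff[OF dvd_mult[OF *(4)] *(2)])
  ultimately have "n dvd l * m * z + z" "n dvd l * m * x + z - y" "n dvd l * m * y + z - x"
    by (simp_all add: algebra_simps)
  then show ?thesis using * unfolding klein_def by blast
qed

lemma klein_dvd: "q dvd n \<Longrightarrow> klein n l m x y z \<Longrightarrow> klein q l m x y z"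
  by (auto simp: klein_def intro: dvd_trans)

text \<open>In the application \<open>q\<close> is a power of the prime \<open>p\<close>. As
  \<open>y\<close> is a unit, \<open>m = - 1\<close> and \<open>z = y - x\<close> modulo
  \<open>q\<close>. Then \<open>z\<close> and \<open>x - y\<close> are units too, and the relations
  for \<open>l\<close> give \<open>2 * x * (x - y) = 0\<close>.\<close>

lemma klein_block_aux:
  fixes q p :: int
  assumes k: "klein q l m x y z"
    and q: "p dvd q" "\<And>t. \<not> p dvd t \<Longrightarrow> coprime t q" "even q \<Longrightarrow> p = 2"
    and p: "p dvd x" "\<not> p dvd y"
  shows "block q x y z"
proof -
  have *: "q dvd l * x + x" "q dvd l * y + x - z" "q dvd m * y + y" "q dvd m * x + y - z"
    using k by (auto simp: klein_def)
  have y: "coprime y q" by (rule q(2)[OF p(2)])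
  have "q dvd y * (m + 1)" using *(3) by (simp add: algebra_simps)
  then have m: "q dvd m + 1" using y coprime_dvd_mult_right_iff[of q y "m + 1"] by (simp add: coprime_commute)
  have "q dvd (m * x + y - z) - x * (m + 1)" by (rule dvd_diff[OF *(4) dvd_mult[OF m]])
  then have zy: "q dvd y - z - x" by (simp add: algebra_simps)
  then have "p dvd y - z - x" using q(1) by (rule dvd_trans[rotated])
  then have "p dvd y - z" using p(1) by (metis diff_add_cancel dvd_add)
  then have "\<not> p dvd z" using p(2) by (metis diff_add_cancel dvd_add)
  then have z: "coprime z q" by (rule q(2))
  have "q dvd x * (l * y + x - z) - y * (l * x + x) - x * (y - z - x)"
    by (rule dvd_diff[OF dvd_diff[OF dvd_mult[OF *(2)] dvd_mult[OF *(1)]] dvd_mult[OF zy]])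
  then have "q dvd (2 * x) * (x - y)" by (simp add: algebra_simps)
  moreover have "\<not> p dvd x - y" using p by (metis diff_diff_eq2 add_diff_cancel_left' dvd_diff)
  then have "coprime (x - y) q" by (rule q(2))
  ultimately have "q dvd 2 * x" using coprime_dvd_mult_left_iff[of q "x - y" "2 * x"]
    by (simp add: coprime_commute)
  then show ?thesis using zy y z p(1) q(3) by (auto simp: block_def)
qed

text \<open>If \<open>p\<close> divides neither \<open>x\<close> nor \<open>y\<close>, both
  multipliers are \<open>- 1\<close> modulo \<open>q\<close>, so \<open>z\<close> equals
  \<open>x - y\<close> as well as \<open>y - x\<close> and is the special entry.\<close>

lemma klein_block:
  fixes q p :: int
  assumes k: "klein q l m x y z"
    and q: "p dvd q" "\<And>t. \<not> p dvd t \<Longrightarrow> coprime t q" "even q \<Longrightarrow> p = 2"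
    and p: "\<not> (p dvd x \<and> p dvd y)"
  shows "block q x y z \<or> block q y x z \<or> block q z x y"
proof -
  consider "p dvd x" "\<not> p dvd y" | "p dvd y" "\<not> p dvd x" | "\<not> p dvd x" "\<not> p dvd y" using p by blast
  then show ?thesis
  proof cases
    case 1
    then show ?thesis using klein_block_aux[OF k q] by blast
  next
    case 2
    then show ?thesis using klein_block_aux[OF klein_swap[THEN iffD1, OF k] q] by blast
  next
    case 3
    have *: "q dvd x * (l + 1)" "q dvd l * y + x - z" "q dvd y * (m + 1)" "q dvd m * x + y - z"
      using k by (auto simp: klein_def algebra_simps)
    have c: "coprime x q" "coprime y q" using q(2) 3 by auto
    have lm: "q dvd l + 1" "q dvd m + 1"
      using c *(1,3) coprime_dvd_mult_right_iff[of q x "l + 1"] coprime_dvd_mult_right_iff[of q y "m + 1"]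
      by (simp_all add: coprime_commute)
    have "q dvd (l * y + x - z) - y * (l + 1)" "q dvd (m * x + y - z) - x * (m + 1)"
      by (rule dvd_diff[OF *(2) dvd_mult[OF lm(1)]], rule dvd_diff[OF *(4) dvd_mult[OF lm(2)]])
    then have z: "q dvd x - y - z" "q dvd y - x - z" by (simp_all add: algebra_simps)
    then have "q dvd (x - y - z) + (y - x - z)" by (rule dvd_add)
    also have "(x - y - z) + (y - x - z) = - (2 * z)" by simp
    finally have "q dvd 2 * z" by (simp only: dvd_minus_iff)
    moreover have "even z" if "even q"
    proof -
      have "odd x" "odd y" using 3 q(3)[OF that] by auto
      moreover have "even (x - y - z)" using z(1) that by (rule dvd_trans[rotated])
      ultimately show ?thesis by simp
    qed
    ultimately show ?thesis using z(1) c by (auto simp: block_def)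
  qed
qed

text \<open>Each prime power goes to the first predicate that accepts it; multiplicativity carries
  the predicates over to the three products.\<close>

lemma prime_power_split:
  fixes P :: "nat \<Rightarrow> bool"
  assumes n: "n > 0"
    and PQR: "\<And>p. p \<in> prime_factors n \<Longrightarrow>
        P (p ^ multiplicity p n) \<or> Q (p ^ multiplicity p n) \<or> R (p ^ multiplicity p n)"
    and one: "P 1" "Q 1" "R 1"
    and mult: "\<And>a b. coprime a b \<Longrightarrow> P a \<Longrightarrow> P b \<Longrightarrow> P (a * b)"
      "\<And>a b. coprime a b \<Longrightarrow> Q a \<Longrightarrow> Q b \<Longrightarrow> Q (a * b)"
      "\<And>a b. coprime a b \<Longrightarrow> R a \<Longrightarrow> R b \<Longrightarrow> R (a * b)"
  shows "\<exists>a b c. n = a * b * c \<and> coprime a b \<and> coprime a c \<and> coprime b c \<and> P a \<and> Q b \<and> R c"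
proof -
  let ?q = "\<lambda>p. p ^ multiplicity p n"
  define S T U where "S = {p \<in> prime_factors n. P (?q p)}"
    and "T = {p \<in> prime_factors n - S. Q (?q p)}" and "U = prime_factors n - S - T"
  have sub: "S \<subseteq> prime_factors n" "T \<subseteq> prime_factors n" "U \<subseteq> prime_factors n"
    by (auto simp: S_def T_def U_def)
  have fin: "finite S" "finite T" "finite U" using sub by (auto intro: finite_subset)
  have cop: "coprime (prod ?q X) (prod ?q Y)"
    if "X \<inter> Y = {}" "X \<subseteq> prime_factors n" "Y \<subseteq> prime_factors n" for X Y
  proof (intro prod_coprime_left prod_coprime_right)
    fix p r assume "p \<in> X" "r \<in> Y"
    then have "prime p" "prime r" "p \<noteq> r" using that by auto
    then have "coprime p r" by (rule primes_coprime)
    then show "coprime (?q p) (?q r)" by simp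
  qed
  have closed: "W (prod ?q X)"
    if "finite X" "X \<subseteq> prime_factors n" "\<And>p. p \<in> X \<Longrightarrow> W (?q p)" "W 1"
      "\<And>a b. coprime a b \<Longrightarrow> W a \<Longrightarrow> W b \<Longrightarrow> W (a * b)" for X W
    using that(1-3)
  proof (induction X rule: finite_induct)
    case empty
    then show ?case using that(4) by simp
  next
    case (insert p X)
    have "coprime (prod ?q {p}) (prod ?q X)" using insert by (intro cop) auto
    then show ?case using insert that(5) by simp
  qed
  have "n = prod ?q (prime_factors n)" using n by (simp add: prime_factorization_nat)
  also have "prime_factors n = S \<union> T \<union> U" by (auto simp: S_def T_def U_def)
  also have "prod ?q (S \<union> T \<union> U) = prod ?q S * prod ?q T * prod ?q U"
    using fin by (subst prod.union_disjoint; auto simp: S_def T_def U_def)+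
  finally have "n = prod ?q S * prod ?q T * prod ?q U" .
  moreover have "S \<inter> T = {}" "S \<inter> U = {}" "T \<inter> U = {}" by (auto simp: S_def T_def U_def)
  moreover have "P (prod ?q S)" by (rule closed[OF fin(1) sub(1) _ one(1) mult(1)]) (simp add: S_def)
  moreover have "Q (prod ?q T)" by (rule closed[OF fin(2) sub(2) _ one(2) mult(2)]) (simp add: T_def)
  moreover have "R (prod ?q U)"
    by (rule closed[OF fin(3) sub(3) _ one(3) mult(3)]) (use PQR in \<open>auto simp: S_def T_def U_def\<close>)
  ultimately show ?thesis using cop[OF _ sub(1,2)] cop[OF _ sub(1,3)] cop[OF _ sub(2,3)] by blast
qed

section \<open>Normal forms of Klein triples up to affine equivalence\<close>

text \<open>The three families of the classification, in terms of the exponents of the reflections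
  other than \<open>b\<close>.\<close>

definition standard :: "nat \<Rightarrow> int \<Rightarrow> int \<Rightarrow> int \<Rightarrow> bool" where
  "standard n p q r \<longleftrightarrow>
     (\<exists>i. 2 \<le> i \<and> i \<le> int n - 1 \<and> gcd (2 * i - 1) (int n) = 1 \<and>
        [2 * i * (i - 1) = 0] (mod int n) \<and> p = 1 \<and> q = i \<and> r = 1 - i) \<or>
     (\<exists>k. 1 \<le> k \<and> k \<le> int n - 2 \<and> gcd k (int n) = 1 \<and>
        [1 + k + k^2 + k^3 = 0] (mod int n) \<and> p = 1 \<and> q = k + 1 \<and> r = k^2 + k + 1) \<or>
     (n \<ge> 5 \<and>
        (1 < p \<and> p < int n \<and> 1 < q \<and> q < int n \<and> 1 < r \<and> r < int n \<and>
           coprime p q \<and> coprime p r \<and> coprime q r) \<and>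
        (\<forall>x \<in> {p, q, r}. gcd x (int n) > 1) \<and>
        (\<exists>l m. [l^2 = 1] (mod int n) \<and> [m^2 = 1] (mod int n) \<and>
           \<not> [l = 1] (mod int n) \<and> \<not> [m = 1] (mod int n) \<and> \<not> [l * m = 1] (mod int n) \<and>
           [r = q * l + p] (mod int n) \<and> [r = p * m + q] (mod int n) \<and>
           [p * (l + 1) = 0] (mod int n) \<and> [q * (m + 1) = 0] (mod int n)))"

text \<open>The orbits of the affine group of the integers modulo \<open>n\<close>, which is how
  automorphisms act on sets of reflections.\<close>

definition similar :: "int \<Rightarrow> int set \<Rightarrow> int set \<Rightarrow> bool" where
  "similar n X Y \<longleftrightarrow> (\<exists>u v. coprime u n \<and> (\<lambda>x. (u * x + v) mod n) ` X = (\<lambda>y. y mod n) ` Y)"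

text \<open>Applying the first involution twice shows that \<open>l^2 - 1\<close> annihilates
  \<open>x\<close> and \<open>y\<close>, hence their gcd, which is a unit modulo
  \<open>n\<close>.\<close>

lemma klein_square:
  assumes k: "klein n l m x y z" and g: "gcd (gcd x y) n = 1"
  shows "n dvd l^2 - 1"
proof -
  have *: "n dvd l * x + x" "n dvd l * y + x - z" "n dvd l * z + x - y"
    using k by (auto simp: klein_def)
  have "n dvd l * (l * x + x) - (l * x + x)" by (rule dvd_diff[OF dvd_mult[OF *(1)] *(1)])
  then have x: "n dvd (l^2 - 1) * x" by (simp add: algebra_simps power2_eq_square)
  have "n dvd l * (l * y + x - z) + (l * z + x - y) - (l * x + x)"
    by (rule dvd_diff[OF dvd_add[OF dvd_mult[OF *(2)] *(3)] *(1)])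
  then have y: "n dvd (l^2 - 1) * y" by (simp add: algebra_simps power2_eq_square)
  have "n dvd gcd ((l^2 - 1) * x) ((l^2 - 1) * y)" using x y by simp
  then have "n dvd (l^2 - 1) * gcd x y" by (simp add: gcd_mult_left)
  moreover have "gcd n (gcd x y) = 1" using g by (simp only: gcd.commute)
  then have "coprime n (gcd x y)" by (simp only: coprime_iff_gcd_eq_1)
  ultimately show ?thesis using coprime_dvd_mult_left_iff by blast
qed

lemma similar_scale:
  assumes "coprime u n" "[u * x = p] (mod n)" "[u * y = q] (mod n)" "[u * z = r] (mod n)"
  shows "similar n {0, x, y, z} {0, p, q, r}"
proof -
  have "(\<lambda>t. (u * t + 0) mod n) ` {0, x, y, z} = (\<lambda>y. y mod n) ` {0, p, q, r}"
    using assms(2-4) by (simp add: cong_def)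
  then show ?thesis unfolding similar_def using assms(1) by blast
qed

text \<open>Scaling by the inverse of \<open>x\<close> leads to the first family. Here
  \<open>l = - 1\<close> and \<open>z = x - y\<close>, so the set becomes
  \<open>{0, 1, i, 1 - i}\<close>, and \<open>m = 1 - 2 * i\<close>. That \<open>m\<close> is a unit
  is the gcd condition, and its relation at \<open>y\<close> is
  \<open>2 * i * (i - 1) = 0\<close>.\<close>

lemma klein_unit_standard:
  fixes n :: nat
  assumes k: "klein (int n) l m x y z" and m: "int n dvd m^2 - 1"
    and x: "coprime x (int n)" and ne: "\<not> int n dvd y" "\<not> int n dvd y - x" and n: "n \<ge> 3"
  shows "\<exists>p q r. standard n p q r \<and> similar (int n) {0, x, y, z} {0, p, q, r}"
proof -
  let ?n = "int n"
  have *: "?n dvd l * x + x" "?n dvd l * y + x - z" "?n dvd m * y + y" "?n dvd m * x + y - z"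
    using k by (auto simp: klein_def)
  obtain u where u: "[x * u = 1] (mod ?n)" using cong_solve_coprime_int[OF x] by blast
  then have u': "?n dvd u * x - 1" by (simp add: cong_iff_dvd_diff mult.commute)
  have cu: "coprime u ?n" using u
    by (metis coprime_iff_invertible_int mult.commute)
  define i where "i = u * y mod ?n"
  have "[i = u * y] (mod ?n)" by (simp add: i_def cong_def)
  then have i: "?n dvd u * y - i" by (metis cong_iff_dvd_diff cong_sym)
  have ib: "0 \<le> i" "i < ?n" using n by (simp_all add: i_def)
  have "?n dvd x * (l + 1)" using *(1) by (simp add: algebra_simps)
  then have l: "?n dvd l + 1" using x by (simp add: coprime_dvd_mult_right_iff coprime_commute)
  have "?n dvd (l * y + x - z) - y * (l + 1)" by (rule dvd_diff[OF *(2) dvd_mult[OF l]])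
  then have z: "?n dvd x - y - z" by (simp add: algebra_simps)
  have "?n dvd (u * x - 1) - (u * y - i) - u * (x - y - z)"
    by (rule dvd_diff[OF dvd_diff[OF u' i] dvd_mult[OF z]])
  then have uz: "?n dvd u * z - (1 - i)" by (simp add: algebra_simps)
  have "?n dvd u * (m * x + y - z) - m * (u * x - 1) - (u * y - i) + (u * z - (1 - i))"
    by (rule dvd_add[OF dvd_diff[OF dvd_diff[OF dvd_mult[OF *(4)] dvd_mult[OF u']] i] uz])
  then have mi: "?n dvd m - (1 - 2 * i)" by (simp add: algebra_simps)
  have "?n dvd u * (m * y + y) - (m + 1) * (u * y - i)"
    by (rule dvd_diff[OF dvd_mult[OF *(3)] dvd_mult[OF i]])
  then have "?n dvd (m + 1) * i" by (simp add: algebra_simps)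
  then have "?n dvd i * (m - (1 - 2 * i)) - (m + 1) * i" using mi by (intro dvd_diff[OF dvd_mult])
  then have "?n dvd 2 * i * (i - 1)" by (simp add: algebra_simps)
  moreover have "gcd (2 * i - 1) ?n = 1"
  proof -
    have "[m * m = 1] (mod ?n)" using m by (simp add: cong_iff_dvd_diff power2_eq_square)
    then have "coprime m ?n" using coprime_iff_invertible_int by blast
    moreover have "[1 - 2 * i = m] (mod ?n)" using mi by (metis cong_iff_dvd_diff cong_sym)
    ultimately have "coprime (1 - 2 * i) ?n" using coprime_if_cong by blast
    then have "coprime (- (1 - 2 * i)) ?n" by (simp only: coprime_minus_left_iff)
    then show ?thesis by (simp only: minus_diff_eq coprime_iff_gcd_eq_1)
  qed
  moreover have "i \<noteq> 0"
  proof
    assume "i = 0"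
    then have "?n dvd u * y" using i by simp
    then show False using ne(1) cu by (simp add: coprime_dvd_mult_right_iff coprime_commute)
  qed
  moreover have "i \<noteq> 1"
  proof
    assume "i = 1"
    have "?n dvd (u * y - i) - (u * x - 1)" by (rule dvd_diff[OF i u'])
    then have "?n dvd u * (y - x)" using \<open>i = 1\<close> by (simp add: algebra_simps)
    then show False using ne(2) cu by (simp add: coprime_dvd_mult_right_iff coprime_commute)
  qed
  ultimately have "standard n 1 i (1 - i)" unfolding standard_def using ib by (simp add: cong_0_iff)
  moreover have "similar ?n {0, x, y, z} {0, 1, i, 1 - i}"
    by (rule similar_scale[OF cu]) (use u' i uz in \<open>simp_all add: cong_iff_dvd_diff\<close>)
  ultimately show ?thesis by blast
qed

text \<open>The prime powers of \<open>n\<close> are grouped by their special entry.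
  \<open>good_triple_exists\<close> realises the resulting residues by pairwise coprime integers,
  and \<open>block_triple_scale\<close> leads there from \<open>x\<close>, \<open>y\<close>,
  \<open>z\<close> by a unit.\<close>

lemma klein_nonunit_standard:
  fixes n :: nat
  assumes k: "klein (int n) l m x y z" and sq: "int n dvd l^2 - 1" "int n dvd m^2 - 1"
    and g: "gcd (gcd x y) (int n) = 1"
    and nu: "\<not> coprime x (int n)" "\<not> coprime y (int n)" "\<not> coprime z (int n)" and n: "n \<ge> 3"
  shows "\<exists>p q r. standard n p q r \<and> similar (int n) {0, x, y, z} {0, p, q, r}"
proof -
  have "\<exists>A B C. n = A * B * C \<and> coprime A B \<and> coprime A C \<and> coprime B C \<and>
      block (int A) x y z \<and> block (int B) y x z \<and> block (int C) z x y"
  proof (rule prime_power_split)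
    show "n > 0" using n by simp
    fix p assume "p \<in> prime_factors n"
    then have p: "prime p" "multiplicity p n > 0" by (auto simp: prime_factors_multiplicity)
    define e where "e = multiplicity p n"
    have "p ^ e dvd n" by (simp add: e_def multiplicity_dvd)
    then have qn: "int (p ^ e) dvd int n" by (simp only: int_dvd_int_iff)
    have pp: "prime (int p)" using p(1) by simp
    have pq: "int p dvd int (p ^ e)" using p(2) by (simp add: e_def dvd_power)
    show "block (int (p ^ multiplicity p n)) x y z \<or> block (int (p ^ multiplicity p n)) y x z \<or>
        block (int (p ^ multiplicity p n)) z x y"
      unfolding e_def[symmetric]
    proof (rule klein_block[OF klein_dvd[OF qn k] pq])
      fix t assume "\<not> int p dvd t"
      then have "coprime (int p) t" using pp by (simp add: prime_imp_coprime)
      then show "coprime t (int (p ^ e))" by (simp add: coprime_commute)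
    next
      assume "even (int (p ^ e))"
      then have "2 dvd p" by simp
      then show "int p = 2" using p(1) two_is_prime_nat by (metis of_nat_numeral primes_dvd_imp_eq)
    next
      show "\<not> (int p dvd x \<and> int p dvd y)"
      proof
        assume "int p dvd x \<and> int p dvd y"
        moreover have "int p dvd int n" using pq qn by (rule dvd_trans)
        ultimately have "int p dvd gcd (gcd x y) (int n)" by simp
        then show False using g pp by (simp add: prime_int_iff)
      qed
    qed
  qed (simp_all add: block_1 block_mult)
  then obtain A' B' C' where ABC': "n = A' * B' * C'" "coprime A' B'" "coprime A' C'" "coprime B' C'"
      "block (int A') x y z" "block (int B') y x z" "block (int C') z x y" by blast
  define A B C where "A = int A'" and "B = int B'" and "C = int C'"
  have N: "int n = A * B * C" by (simp add: A_def B_def C_def ABC'(1))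
  have cop: "coprime A B" "coprime A C" "coprime B C" using ABC' by (simp_all add: A_def B_def C_def)
  have bl: "block A x y z" "block B y x z" "block C z x y" using ABC' by (simp_all add: A_def B_def C_def)
  have c: "coprime y A" "coprime z A" "coprime x B" "coprime z B" "coprime x C" "coprime y C"
    using bl by (auto simp: block_def)
  \<comment> \<open>If a factor were \<open>1\<close>, its special entry would be coprime to both
    other factors and thus to \<open>n\<close>.\<close>
  have "A \<noteq> 1" "B \<noteq> 1" "C \<noteq> 1" using nu c unfolding N by auto
  moreover have "A' * B' * C' > 0" using ABC'(1) n by linarith
  then have "A > 0" "B > 0" "C > 0" by (simp_all add: A_def B_def C_def)
  ultimately have gt: "A > 1" "B > 1" "C > 1" by linarith+
  obtain a where a: "halved A a" "[x = a] (mod A)" "[y - z = a] (mod A)" using block_halved[OF bl(1)] by blast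
  obtain b where b: "halved B b" "[y = b] (mod B)" "[x - z = b] (mod B)" using block_halved[OF bl(2)] by blast
  obtain c' where c': "halved C c'" "[z = c'] (mod C)" "[x - y = c'] (mod C)" using block_halved[OF bl(3)] by blast
  have t: "block_triple A B C a b c' x y z" using a b c' by (simp add: block_triple_def)
  obtain i j k' where ijk: "1 < i \<and> i < int n \<and> 1 < j \<and> j < int n \<and> 1 < k' \<and> k' < int n"
      "coprime i j" "coprime i k'" "coprime j k'" "block_triple A B C a b c' i j k'"
    using good_triple_exists[OF gt cop a(1) b(1) c'(1)] unfolding good_triple_def N by blast
  obtain u where u: "coprime u (int n)" "[u * x = i] (mod int n)" "[u * y = j] (mod int n)" "[u * z = k'] (mod int n)"
    using block_triple_scale[OF cop a(1) b(1) c'(1) t ijk(5) c(1,3,5) ijk(2-4)] unfolding N by blast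
  have ud: "int n dvd u * x - i" "int n dvd u * y - j" "int n dvd u * z - k'"
    using u by (simp_all add: cong_iff_dvd_diff)
  have *: "int n dvd l * x + x" "int n dvd l * y + x - z" "int n dvd m * y + y" "int n dvd m * x + y - z"
    using k by (auto simp: klein_def)
  have nonunit: "gcd t (int n) > 1" if "[u * s = t] (mod int n)" "\<not> coprime s (int n)" for s t
  proof -
    have "\<not> coprime t (int n)"
    proof
      assume "coprime t (int n)"
      then have "coprime (u * s) (int n)" using coprime_if_cong[OF that(1)] by blast
      then show False using that(2) by simp
    qed
    then have "gcd t (int n) \<noteq> 1" by (simp only: coprime_iff_gcd_eq_1 not_False_eq_True)
    moreover have "gcd t (int n) > 0" using n by simp
    ultimately show ?thesis by linarith
  qed
  have two: "\<not> (X dvd 2 \<and> Y dvd 2)" if "coprime X Y" "X > 1" "Y > 1" for X Y :: int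
  proof
    assume "X dvd 2 \<and> Y dvd 2"
    then have "X = 2" "Y = 2" using that zdvd_imp_le[of X 2] zdvd_imp_le[of Y 2] by auto
    then show False using that(1) by simp
  qed
  \<comment> \<open>If \<open>h\<close> were \<open>1\<close> modulo \<open>n\<close>, then
    \<open>2 * w = 0\<close>. As \<open>w\<close> is a unit modulo two coprime factors greater than
    \<open>1\<close>, both would have to divide \<open>2\<close>.\<close>
  have minus: "\<not> int n dvd h - 1"
    if h: "int n dvd h * w + w" and cw: "coprime w X" "coprime w Y" and XY: "coprime X Y" "X > 1" "Y > 1"
      "X dvd int n" "Y dvd int n" for h w X Y
  proof
    assume "int n dvd h - 1"
    then have "int n dvd (h * w + w) - w * (h - 1)" by (rule dvd_diff[OF h dvd_mult])
    then have "int n dvd 2 * w" by (simp add: algebra_simps)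
    then have "X dvd 2 * w" "Y dvd 2 * w" using XY(4,5) by (blast intro: dvd_trans)+
    then have "X dvd 2" "Y dvd 2" using cw by (simp_all add: coprime_dvd_mult_left_iff coprime_commute)
    then show False using two XY by blast
  qed
  have dv: "A dvd int n" "B dvd int n" "C dvd int n" unfolding N by auto
  have "int n dvd (l * m) * z + z" using klein_rotate[OF k] by (simp add: klein_def)
  then have "\<not> int n dvd l - 1" "\<not> int n dvd m - 1" "\<not> int n dvd l * m - 1"
    using minus[OF *(1) c(3,5) cop(3) gt(2,3) dv(2,3)] minus[OF *(3) c(1,6) cop(2) gt(1,3) dv(1,3)]
      minus[OF _ c(2,4) cop(1) gt(1,2) dv(1,2)] by blast+
  moreover have "int n dvd k' - (j * l + i)"
  proof -
    have "int n dvd (u * x - i) + l * (u * y - j) - (u * z - k') - u * (l * y + x - z)"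
      by (rule dvd_diff[OF dvd_diff[OF dvd_add[OF ud(1) dvd_mult[OF ud(2)]] ud(3)] dvd_mult[OF *(2)]])
    then show ?thesis by (simp add: algebra_simps)
  qed
  moreover have "int n dvd k' - (i * m + j)"
  proof -
    have "int n dvd (u * y - j) + m * (u * x - i) - (u * z - k') - u * (m * x + y - z)"
      by (rule dvd_diff[OF dvd_diff[OF dvd_add[OF ud(2) dvd_mult[OF ud(1)]] ud(3)] dvd_mult[OF *(4)]])
    then show ?thesis by (simp add: algebra_simps)
  qed
  moreover have "int n dvd i * (l + 1)"
  proof -
    have "int n dvd u * (l * x + x) - (l + 1) * (u * x - i)"
      by (rule dvd_diff[OF dvd_mult[OF *(1)] dvd_mult[OF ud(1)]])
    then show ?thesis by (simp add: algebra_simps)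
  qed
  moreover have "int n dvd j * (m + 1)"
  proof -
    have "int n dvd u * (m * y + y) - (m + 1) * (u * y - j)"
      by (rule dvd_diff[OF dvd_mult[OF *(3)] dvd_mult[OF ud(2)]])
    then show ?thesis by (simp add: algebra_simps)
  qed
  moreover have "n \<ge> 5"
  proof -
    have "2 * 2 * 2 \<le> A * B * C" using gt by (intro mult_mono) auto
    then show ?thesis using N by simp
  qed
  moreover have "\<forall>t\<in>{i, j, k'}. gcd t (int n) > 1" using nonunit u(2-4) nu by blast
  ultimately have "standard n i j k'" unfolding standard_def
    using ijk sq by (intro disjI2 conjI exI[of _ l] exI[of _ m]) (simp_all add: cong_iff_dvd_diff)
  moreover have "similar (int n) {0, x, y, z} {0, i, j, k'}" by (rule similar_scale[OF u])
  ultimately show ?thesis by blast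
qed

section \<open>Transitive affine stabilizers of four points\<close>

lemma card4_list:
  assumes "card Y = 4" "distinct [p, q, r, s]" "set [p, q, r, s] \<subseteq> Y"
  shows "Y = {p, q, r, s}"
proof -
  have "finite Y" using assms(1) card.infinite by fastforce
  moreover have "card {p, q, r, s} = 4" using assms(2) by simp
  ultimately show ?thesis using assms(1,3) card_subset_eq[of Y "{p, q, r, s}"] by simp
qed

lemma card4_obtain:
  assumes "card Y = 4" "distinct [p, q, r]" "set [p, q, r] \<subseteq> Y"
  obtains s where "distinct [p, q, r, s]" "Y = {p, q, r, s}"
proof -
  have "\<not> Y \<subseteq> {p, q, r}"
  proof
    assume "Y \<subseteq> {p, q, r}"
    then have "card Y \<le> card {p, q, r}" by (intro card_mono) auto
    then show False using assms(1) card_insert_le_m1[of 3 "{q, r}" p] by (simp add: card_insert_if split: if_splits)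
  qed
  then obtain s where "s \<in> Y" "s \<notin> {p, q, r}" by blast
  then have "distinct [p, q, r, s]" "set [p, q, r, s] \<subseteq> Y" using assms by auto
  then show ?thesis using that card4_list[OF assms(1)] by blast
qed

text \<open>A fixed-point-free permutation \<open>h\<close> of four points is a 4-cycle or a double
  transposition. In the latter case some \<open>k\<close> in \<open>P\<close> moves \<open>x\<close>
  into the other orbit of \<open>h\<close>; commuting with \<open>h\<close>, it is either the second
  involution or a 4-cycle. Commutation is assumed only if \<open>h\<close> swaps two points, where
  \<open>affine_four_points\<close> can supply it.\<close>

lemma four_cycle_or_klein:
  assumes Y: "card Y = 4" "x \<in> Y"
    and h: "h ` Y = Y" "inj_on h Y" "\<And>y. y \<in> Y \<Longrightarrow> h y \<noteq> y"
    and g: "\<And>y. y \<in> Y \<Longrightarrow> \<exists>g\<in>P. g x = y"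
      "\<And>g. g \<in> P \<Longrightarrow> g ` Y = Y \<and> inj_on g Y"
      "\<And>g y. h (h x) = x \<Longrightarrow> g \<in> P \<Longrightarrow> y \<in> Y \<Longrightarrow> g (h y) = h (g y)"
    and hP: "h \<in> P"
  shows "(\<exists>f\<in>P. distinct [x, f x, f (f x), f (f (f x))] \<and> f (f (f (f x))) = x) \<or>
    (\<exists>f\<in>P. \<exists>g\<in>P. \<exists>p q r. distinct [x, p, q, r] \<and> f x = p \<and> f p = x \<and> f q = r \<and> f r = q \<and>
        g x = q \<and> g q = x \<and> g p = r \<and> g r = p)"
proof -
  have hin: "h y \<in> Y" if "y \<in> Y" for y using h(1) that by blast
  have hne: "h y \<noteq> h z" if "y \<in> Y" "z \<in> Y" "y \<noteq> z" for y z using h(2) that by (auto dest: inj_onD)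
  show ?thesis
  proof (cases "h (h x) = x")
    case False
    define p q where "p = h x" and "q = h p"
    have pY: "p \<in> Y" and qY: "q \<in> Y" using hin Y(2) by (simp_all add: p_def q_def)
    have "p \<noteq> x" "q \<noteq> p" "q \<noteq> x"
      using h(3)[OF Y(2)] h(3)[OF pY] False by (simp_all add: p_def q_def)
    then obtain s where s: "distinct [x, p, q, s]" "Y = {x, p, q, s}"
      using card4_obtain[OF Y(1), of x p q] pY qY Y(2) by auto
    have sY: "s \<in> Y" using s(2) by blast
    have sne: "s \<noteq> x" "s \<noteq> p" "s \<noteq> q" "q \<noteq> x" using s(1) by auto
    have mem: "z = x \<or> z = p \<or> z = q \<or> z = s" if "z \<in> Y" for z using that s(2) by blast
    have hs: "h s \<noteq> p" "h s \<noteq> q" "h s \<noteq> s" "h s \<noteq> h q"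
      using hne[OF sY Y(2)] hne[OF sY pY] hne[OF sY qY] h(3)[OF sY] sne by (simp_all flip: p_def q_def)
    have hq: "h q \<noteq> p" "h q \<noteq> q"
      using hne[OF qY Y(2)] h(3)[OF qY] sne by (simp_all flip: p_def)
    have hsx: "h s = x" using mem[OF hin[OF sY]] hs by blast
    have "h q = s" using mem[OF hin[OF qY]] hq hs(4) hsx by metis
    then have "distinct [x, h x, h (h x), h (h (h x))] \<and> h (h (h (h x))) = x"
      unfolding p_def[symmetric] q_def[symmetric] using s(1) hsx by simp
    then show ?thesis using hP by blast
  next
    case True
    define p where "p = h x"
    have hp: "h p = x" using True by (simp add: p_def)
    have pY: "p \<in> Y" and px: "p \<noteq> x" using hin[OF Y(2)] h(3)[OF Y(2)] by (simp_all add: p_def)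
    obtain y where y: "y \<in> Y" "y \<noteq> x" "y \<noteq> p"
    proof -
      have "\<not> Y \<subseteq> {x, p}"
      proof
        assume "Y \<subseteq> {x, p}"
        then have "card Y \<le> card {x, p}" by (intro card_mono) auto
        then show False using Y(1) by (simp add: card_insert_if split: if_splits)
      qed
      then show ?thesis using that by blast
    qed
    define r where "r = h y"
    have rY: "r \<in> Y" using hin[OF y(1)] by (simp add: r_def)
    have r: "r \<noteq> y" "r \<noteq> x" "r \<noteq> p"
      using h(3)[OF y(1)] hne[OF y(1) pY y(3)] hne[OF y(1) Y(2) y(2)] hp by (simp_all add: r_def p_def)
    have d: "distinct [x, p, y, r]" using px y r by auto
    have Yeq: "Y = {x, p, y, r}" by (rule card4_list[OF Y(1) d]) (use pY y rY Y(2) in auto)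
    have mem: "z = x \<or> z = p \<or> z = y \<or> z = r" if "z \<in> Y" for z using that Yeq by blast
    have "h r \<noteq> r" "h r \<noteq> p" "h r \<noteq> x"
      using h(3)[OF rY] hne[OF rY Y(2) r(2)] hne[OF rY pY r(3)] hp by (simp_all flip: p_def)
    then have hr: "h r = y" using mem[OF hin[OF rY]] by blast
    obtain k where k: "k \<in> P" "k x = y" using g(1) y(1) by blast
    have kp: "k p = r" using g(3)[OF True k(1) Y(2)] k(2) by (simp add: p_def r_def)
    have kin: "k ` Y = Y" "inj_on k Y" using g(2) k(1) by auto
    have "k y \<in> Y" using kin y(1) by blast
    moreover have "k y \<noteq> y" using inj_onD[OF kin(2) _ y(1) Y(2)] k(2) y(2) by metis
    moreover have "k y \<noteq> r" using inj_onD[OF kin(2) _ y(1) pY] kp y(3) by metis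
    ultimately consider "k y = x" | "k y = p" using mem by blast
    then show ?thesis
    proof cases
      case 1
      have "k r = p" using g(3)[OF True k(1) y(1)] 1 by (simp add: p_def r_def)
      then have "distinct [x, p, y, r] \<and> h x = p \<and> h p = x \<and> h y = r \<and> h r = y \<and>
          k x = y \<and> k y = x \<and> k p = r \<and> k r = p"
        using d hp hr k(2) kp 1 by (simp add: p_def r_def)
      then show ?thesis using hP k(1) by blast
    next
      case 2
      have "k r = x" using g(3)[OF True k(1) y(1)] 2 hp by (simp add: r_def)
      then have "distinct [x, k x, k (k x), k (k (k x))] \<and> k (k (k (k x))) = x"
        using k(2) 2 kp d by auto
      then show ?thesis using k(1) by blast
    qed
  qed
qed

definition affine :: "int \<Rightarrow> int \<Rightarrow> int \<Rightarrow> int \<Rightarrow> int" where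
  "affine n s t x = (s * x + t) mod n"

definition affine_stabilizer :: "int \<Rightarrow> int set \<Rightarrow> (int \<Rightarrow> int) set" where
  "affine_stabilizer n Y = {f. (\<exists>s t. coprime s n \<and> f = affine n s t) \<and> f ` Y = Y}"

lemma affine_dvd: "n dvd affine n s t x - (s * x + t)"
  by (simp add: affine_def mod_eq_dvd_iff[symmetric])

lemma eq_if_dvd_diff:
  fixes x y n :: int
  assumes "n dvd x - y" "0 \<le> x" "x < n" "0 \<le> y" "y < n"
  shows "x = y"
  using assms by (metis mod_eq_dvd_iff mod_pos_pos_trivial)

lemma affine_inj:
  assumes "coprime s n" "Y \<subseteq> {0..<n}"
  shows "inj_on (affine n s t) Y"
proof (rule inj_onI)
  fix x y assume xy: "x \<in> Y" "y \<in> Y" "affine n s t x = affine n s t y"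
  then have "n dvd (s * x + t) - (s * y + t)" by (simp add: affine_def mod_eq_dvd_iff)
  then have "n dvd s * (x - y)" by (simp add: algebra_simps)
  then have "n dvd x - y" using assms(1) by (simp add: coprime_dvd_mult_right_iff coprime_commute)
  then show "x = y" using xy assms(2) by (intro eq_if_dvd_diff) auto
qed

text \<open>A fixed-point-free \<open>h\<close> is found in two ways: if all stabilizer elements
  commute on \<open>Y\<close>, transitivity spreads a fixed point to all of \<open>Y\<close>, so any
  \<open>h\<close> that moves \<open>x\<close> will do; otherwise a commutator is a nonzero
  translation.\<close>

lemma affine_four_points:
  fixes n :: int
  assumes n: "n > 0" and Y: "Y \<subseteq> {0..<n}" "card Y = 4" "x \<in> Y"
    and transitive: "\<forall>x\<in>Y. \<forall>y\<in>Y. \<exists>f\<in>affine_stabilizer n Y. f x = y"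
  shows "(\<exists>f\<in>affine_stabilizer n Y. distinct [x, f x, f (f x), f (f (f x))] \<and> f (f (f (f x))) = x) \<or>
    (\<exists>f\<in>affine_stabilizer n Y. \<exists>g\<in>affine_stabilizer n Y. \<exists>p q r.
        distinct [x, p, q, r] \<and> f x = p \<and> f p = x \<and> f q = r \<and> f r = q \<and>
        g x = q \<and> g q = x \<and> g p = r \<and> g r = p)"
proof -
  let ?P = "affine_stabilizer n Y"
  note tr = transitive[rule_format]
  have im: "f ` Y = Y" "inj_on f Y" if "f \<in> ?P" for f
    using that affine_inj[OF _ Y(1)] by (auto simp: affine_stabilizer_def)
  have fin: "finite Y" using Y(1) finite_subset by blast
  have comp: "n dvd f (g y) - (s * s' * y + s * t' + t)"
    if "f = affine n s t" "g = affine n s' t'" for f g s t s' t' y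
    using dvd_add[OF affine_dvd[of n s t "g y"] dvd_mult[OF affine_dvd[of n s' t' y], of s]] that
    by (simp add: algebra_simps)
  show ?thesis
  proof (cases "\<forall>f\<in>?P. \<forall>g\<in>?P. \<forall>y\<in>Y. f (g y) = g (f y)")
    case True
    obtain y where y: "y \<in> Y" "y \<noteq> x"
    proof -
      have "\<not> Y \<subseteq> {x}" using Y(2) card_mono[of "{x}" Y] by auto
      then show ?thesis using that by blast
    qed
    obtain h where h: "h \<in> ?P" "h x = y" using tr[OF Y(3) y(1)] by blast
    have "h z \<noteq> z" if z: "z \<in> Y" for z
    proof
      assume "h z = z"
      obtain f where f: "f \<in> ?P" "f z = x" using tr[OF z Y(3)] by blast
      have "h x = f (h z)" using True h(1) f z by metis
      then show False using \<open>h z = z\<close> f(2) h(2) y(2) by simp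
    qed
    then show ?thesis using im[OF h(1)] im True h(1) tr[OF Y(3)] by (intro four_cycle_or_klein[OF Y(2,3)]) auto
  next
    case False
    then obtain f g y where fg: "f \<in> ?P" "g \<in> ?P" "y \<in> Y" "f (g y) \<noteq> g (f y)" by blast
    obtain s t where s: "f = affine n s t" using fg(1) by (auto simp: affine_stabilizer_def)
    obtain s' t' where s': "g = affine n s' t'" using fg(2) by (auto simp: affine_stabilizer_def)
    \<comment> \<open>The multipliers of \<open>f\<close> and \<open>g\<close> commute, so the two
      composites differ by a translation \<open>h\<close>, and \<open>c\<close> is the difference of
      their constant terms.\<close>
    define c where "c = s * t' + t - (s' * t + t')"
    define h where "h = affine n 1 c"
    have hg: "f (g z) = h (g (f z))" for z
    proof (rule eq_if_dvd_diff)
      have "n dvd (f (g z) - (s * s' * z + s * t' + t)) - (g (f z) - (s' * s * z + s' * t + t'))"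
        by (rule dvd_diff[OF comp[OF s s', of z] comp[OF s' s, of z]])
      then have "n dvd (f (g z) - (s * s' * z + s * t' + t)) - (g (f z) - (s' * s * z + s' * t + t'))
          - (h (g (f z)) - (1 * g (f z) + c))"
        unfolding h_def by (rule dvd_diff[OF _ affine_dvd])
      then show "n dvd f (g z) - h (g (f z))" by (simp add: c_def algebra_simps)
    qed (use n in \<open>auto simp: s s' h_def affine_def\<close>)
    have him: "h ` Y = Y"
    proof -
      have "h ` Y = h ` g ` f ` Y" using im fg by simp
      also have "\<dots> = (\<lambda>z. f (g z)) ` Y" by (auto simp: hg image_iff)
      also have "\<dots> = f ` g ` Y" by auto
      finally show ?thesis using im fg by simp
    qed
    have hP: "h \<in> ?P" 
      unfolding affine_stabilizer_def using him
      by (intro CollectI conjI exI[of _ 1] exI[of _ c]) (simp_all add: h_def)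
    have nc: "\<not> n dvd c"
    proof
      assume "n dvd c"
      have gf: "g (f y) \<in> Y" using im fg by blast
      have "n dvd h (g (f y)) - (1 * g (f y) + c) + c" unfolding h_def
        by (rule dvd_add[OF affine_dvd \<open>n dvd c\<close>])
      then have d: "n dvd h (g (f y)) - g (f y)" by (simp add: algebra_simps)
      have "h (g (f y)) \<in> Y" using gf him by blast
      then have "h (g (f y)) = g (f y)"
        using subsetD[OF Y(1)] gf by (intro eq_if_dvd_diff[OF d]) (simp_all add: subset_iff)
      then show False using hg[of y] fg(4) by simp
    qed
    have hz: "h z \<noteq> z" if "z \<in> Y" for z
    proof
      assume "h z = z"
      then have "n dvd z - (1 * z + c)" using affine_dvd[of n 1 c z] by (simp add: h_def)
      then show False using nc by simp
    qed
    \<comment> \<open>If the translation has order two, then \<open>2 * c = 0\<close> with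
      \<open>c\<close> nonzero, so \<open>n\<close> is even and every unit \<open>a\<close> is odd.
      Hence \<open>a * c = c\<close>, and \<open>h\<close> commutes with every affine
      permutation.\<close>
    have com: "k (h z) = h (k z)" if hh: "h (h x) = x" and k: "k \<in> ?P" for k z
    proof -
      obtain a b where a: "coprime a n" "k = affine n a b" using k by (auto simp: affine_stabilizer_def)
      have "n dvd (h (h x) - (1 * h x + c)) + (h x - (1 * x + c))"
        unfolding h_def by (rule dvd_add[OF affine_dvd affine_dvd])
      then have "n dvd - (2 * c)" using hh by (simp add: algebra_simps)
      then have c2: "n dvd 2 * c" by (simp only: dvd_minus_iff)
      have "even n"
      proof (rule ccontr)
        assume "odd n"
        then have "coprime n 2" by simp
        then show False using c2 nc coprime_dvd_mult_right_iff by blast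
      qed
      then have "odd a" using coprime_common_divisor[OF a(1), of 2] by auto
      then have "even (a - 1)" by simp
      then obtain e where e: "a - 1 = 2 * e" by (elim evenE)
      have ac: "n dvd (a - 1) * c" unfolding e using dvd_mult[OF c2, of e] by (simp add: ac_simps)
      have "n dvd (k (h z) - (a * h z + b)) + a * (h z - (1 * z + c)) + (a - 1) * c"
        unfolding h_def a(2) by (rule dvd_add[OF dvd_add[OF affine_dvd dvd_mult[OF affine_dvd]] ac])
      moreover have "n dvd (h (k z) - (1 * k z + c)) + (k z - (a * z + b))"
        unfolding h_def a(2) by (rule dvd_add[OF affine_dvd affine_dvd])
      ultimately have "n dvd ((k (h z) - (a * h z + b)) + a * (h z - (1 * z + c)) + (a - 1) * c)
          - ((h (k z) - (1 * k z + c)) + (k z - (a * z + b)))"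
        by (rule dvd_diff)
      then have "n dvd k (h z) - h (k z)" by (simp add: algebra_simps)
      then show ?thesis using n by (intro eq_if_dvd_diff) (auto simp: a(2) h_def affine_def)
    qed
    show ?thesis
      by (rule four_cycle_or_klein[OF Y(2,3) him im(2)[OF hP] hz tr[OF Y(3)] _ _ hP])
        (assumption, assumption, use im in blast, rule com)
  qed
qed

section \<open>From a transitive stabilizer to a normal form\<close>

lemma similar_translate:
  assumes "similar n ((\<lambda>x. x - x0) ` X) Z"
  shows "similar n X Z"
proof -
  obtain u v where uv: "coprime u n"
    "(\<lambda>x. (u * x + v) mod n) ` (\<lambda>x. x - x0) ` X = (\<lambda>y. y mod n) ` Z"
    using assms by (auto simp: similar_def)
  have "(\<lambda>x. (u * x + (v - u * x0)) mod n) ` X = (\<lambda>x. (u * x + v) mod n) ` (\<lambda>x. x - x0) ` X"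
    by (simp add: image_image algebra_simps)
  then show ?thesis using uv unfolding similar_def by metis
qed

lemma multiple_not_coprime: "\<not> coprime k n" if "n dvd k" "n \<ge> 3" for k n :: int
proof
  assume "coprime k n"
  then have "is_unit n" using that(1) by (meson coprime_common_divisor dvd_refl)
  then show False using that(2) by simp
qed

text \<open>The differences from \<open>x0\<close> are \<open>c\<close>, \<open>(1 + s) * c\<close>
  and \<open>(1 + s + s^2) * c\<close>, so \<open>gen\<close> makes \<open>c\<close> a unit, and
  scaling it to \<open>1\<close> gives the second family. The return of the cycle to
  \<open>x0\<close> is the cubic condition.\<close>

lemma four_cycle_similar_standard:
  fixes n :: nat
  assumes n: "n \<ge> 3" and s: "coprime s (int n)"
    and d: "int n dvd x1 - (s * x0 + t)" "int n dvd x2 - (s * x1 + t)" "int n dvd x3 - (s * x2 + t)"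
      "int n dvd x0 - (s * x3 + t)"
    and ne: "\<not> int n dvd x2 - x0"
    and gen: "\<And>e. e dvd int n \<Longrightarrow> e dvd x1 - x0 \<Longrightarrow> e dvd x2 - x0 \<Longrightarrow> e dvd x3 - x0 \<Longrightarrow> is_unit e"
  shows "\<exists>p q r. standard n p q r \<and> similar (int n) {x0, x1, x2, x3} {0, p, q, r}"
proof -
  let ?n = "int n"
  define c where "c = x1 - x0"
  define k where "k = s mod ?n"
  have sk: "?n dvd s - k" by (simp add: k_def)
  have "?n dvd (x2 - (s * x1 + t)) - (x1 - (s * x0 + t))" by (rule dvd_diff[OF d(2,1)])
  then have x2: "?n dvd (x2 - x0) - (1 + s) * c" by (simp add: c_def algebra_simps)
  have "?n dvd (x3 - (s * x2 + t)) - (x1 - (s * x0 + t)) + s * ((x2 - x0) - (1 + s) * c)"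
    by (rule dvd_add[OF dvd_diff[OF d(3,1)] dvd_mult[OF x2]])
  then have x3: "?n dvd (x3 - x0) - (1 + s + s^2) * c" by (simp add: c_def algebra_simps power2_eq_square)
  have "?n dvd (x1 - (s * x0 + t)) - (x0 - (s * x3 + t)) - s * ((x3 - x0) - (1 + s + s^2) * c)"
    by (rule dvd_diff[OF dvd_diff[OF d(1,4)] dvd_mult[OF x3]])
  then have x4: "?n dvd c * (1 + s + s^2 + s^3)"
    by (simp add: c_def algebra_simps power2_eq_square power3_eq_cube)
  have "is_unit (gcd c ?n)"
  proof (rule gen)
    have "gcd c ?n dvd ((x2 - x0) - (1 + s) * c) + (1 + s) * c" "gcd c ?n dvd ((x3 - x0) - (1 + s + s^2) * c) + (1 + s + s^2) * c"
      using dvd_trans[OF gcd_dvd2 x2] dvd_trans[OF gcd_dvd2 x3] by (meson dvd_add dvd_mult gcd_dvd1)+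
    then show "gcd c ?n dvd x2 - x0" "gcd c ?n dvd x3 - x0" by simp_all
  qed (simp_all add: c_def)
  then have "gcd c ?n = 1" by simp
  then have c: "coprime c ?n" by (simp only: coprime_iff_gcd_eq_1)
  have s0: "?n dvd 1 + s + s^2 + s^3" using x4 c by (simp add: coprime_dvd_mult_right_iff coprime_commute)
  have k2: "?n dvd s^2 - k^2" "?n dvd s^3 - k^3"
  proof -
    have "s^2 - k^2 = (s + k) * (s - k)" "s^3 - k^3 = (s^2 + s * k + k^2) * (s - k)"
      by (simp_all add: algebra_simps power2_eq_square power3_eq_cube)
    then show "?n dvd s^2 - k^2" "?n dvd s^3 - k^3" using sk by simp_all
  qed
  have "?n dvd (1 + s + s^2 + s^3) - (s - k) - (s^2 - k^2) - (s^3 - k^3)"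
    by (rule dvd_diff[OF dvd_diff[OF dvd_diff[OF s0 sk] k2(1)] k2(2)])
  then have k0: "?n dvd 1 + k + k^2 + k^3" by (simp add: algebra_simps)
  have ck: "coprime k ?n" by (rule coprime_if_cong[OF _ s]) (simp add: k_def cong_def)
  have kb: "0 \<le> k" "k < ?n" using n by (simp_all add: k_def)
  have "k \<noteq> 0" using ck multiple_not_coprime[of ?n k] n by auto
  moreover have "k \<noteq> ?n - 1"
  proof
    assume k1: "k = ?n - 1"
    have "?n dvd (s - k) + ?n" using sk by simp
    then have "?n dvd 1 + s" by (simp add: k1 algebra_simps)
    then have "?n dvd ((x2 - x0) - (1 + s) * c) + (1 + s) * c" by (rule dvd_add[OF x2 dvd_mult2])
    then show False using ne by simp
  qed
  moreover have "gcd k ?n = 1" using ck by (simp only: coprime_iff_gcd_eq_1)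
  ultimately have "standard n 1 (k + 1) (k^2 + k + 1)"
    unfolding standard_def using kb k0 by (intro disjI2 disjI1 exI[of _ k]) (simp add: cong_0_iff)
  moreover have "similar ?n {x0, x1, x2, x3} {0, 1, k + 1, k^2 + k + 1}"
  proof -
    obtain u where u: "[c * u = 1] (mod ?n)" using cong_solve_coprime_int[OF c] by blast
    then have uc: "?n dvd u * c - 1" by (simp add: cong_iff_dvd_diff mult.commute)
    have cu: "coprime u ?n" using u by (metis coprime_iff_invertible_int mult.commute)
    have "?n dvd u * ((x2 - x0) - (1 + s) * c) + (1 + s) * (u * c - 1) + (s - k)"
      by (rule dvd_add[OF dvd_add[OF dvd_mult[OF x2] dvd_mult[OF uc]] sk])
    then have "[u * (x2 - x0) = k + 1] (mod ?n)" by (simp add: cong_iff_dvd_diff algebra_simps)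
    moreover have "?n dvd u * ((x3 - x0) - (1 + s + s^2) * c) + (1 + s + s^2) * (u * c - 1) + (s - k) + (s^2 - k^2)"
      by (rule dvd_add[OF dvd_add[OF dvd_add[OF dvd_mult[OF x3] dvd_mult[OF uc]] sk] k2(1)])
    then have "[u * (x3 - x0) = k^2 + k + 1] (mod ?n)" by (simp add: cong_iff_dvd_diff algebra_simps)
    moreover have "[u * (x1 - x0) = 1] (mod ?n)" using uc by (simp add: cong_iff_dvd_diff c_def)
    ultimately have "similar ?n {0, x1 - x0, x2 - x0, x3 - x0} {0, 1, k + 1, k^2 + k + 1}"
      by (intro similar_scale[OF cu])
    moreover have "(\<lambda>t. t - x0) ` {x0, x1, x2, x3} = {0, x1 - x0, x2 - x0, x3 - x0}" by simp
    ultimately show ?thesis using similar_translate by metis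
  qed
  ultimately show ?thesis by blast
qed

text \<open>Translating \<open>x0\<close> to \<open>0\<close> turns the relations into
  \<open>klein\<close>. If one of the three differences is a unit, \<open>klein_swap\<close> or
  \<open>klein_rotate\<close> brings it to the front.\<close>

lemma klein_similar_standard:
  fixes n :: nat
  assumes n: "n \<ge> 3"
    and f: "int n dvd p - (l * x0 + t)" "int n dvd x0 - (l * p + t)" "int n dvd r - (l * q + t)"
      "int n dvd q - (l * r + t)"
    and g: "int n dvd q - (m * x0 + t')" "int n dvd x0 - (m * q + t')" "int n dvd r - (m * p + t')"
      "int n dvd p - (m * r + t')"
    and ne: "\<not> int n dvd p - x0" "\<not> int n dvd q - x0" "\<not> int n dvd q - p" "\<not> int n dvd p - q" "\<not> int n dvd p - r"
    and gen: "\<And>e. e dvd int n \<Longrightarrow> e dvd p - x0 \<Longrightarrow> e dvd q - x0 \<Longrightarrow> e dvd r - x0 \<Longrightarrow> is_unit e"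
  shows "\<exists>a b c. standard n a b c \<and> similar (int n) {x0, p, q, r} {0, a, b, c}"
proof -
  let ?n = "int n"
  define x y z where "x = p - x0" and "y = q - x0" and "z = r - x0"
  have "?n dvd l * x + x" using dvd_diff[OF f(1,2)] by (simp add: x_def algebra_simps)
  moreover have ly: "?n dvd l * y + x - z" using dvd_diff[OF f(1,3)] by (simp add: x_def y_def z_def algebra_simps)
  moreover have "?n dvd l * z + x - y" using dvd_diff[OF f(1,4)] by (simp add: x_def y_def z_def algebra_simps)
  moreover have "?n dvd m * y + y" using dvd_diff[OF g(1,2)] by (simp add: y_def algebra_simps)
  moreover have "?n dvd m * x + y - z" using dvd_diff[OF g(1,3)] by (simp add: x_def y_def z_def algebra_simps)
  moreover have "?n dvd m * z + y - x" using dvd_diff[OF g(1,4)] by (simp add: x_def y_def z_def algebra_simps)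
  ultimately have k: "klein ?n l m x y z" by (simp add: klein_def)
  have k': "klein ?n m l y x z" using k klein_swap by blast
  have G: "gcd (gcd x y) ?n = 1"
  proof -
    let ?e = "gcd (gcd x y) ?n"
    have e: "?e dvd x" "?e dvd y" "?e dvd ?n" by (meson gcd_dvd1 gcd_dvd2 dvd_trans)+
    have "?e dvd l * y + x - (l * y + x - z)"
      by (rule dvd_diff[OF dvd_add[OF dvd_mult[OF e(2)] e(1)] dvd_trans[OF e(3) ly]])
    then have "?e dvd z" by simp
    then have "is_unit ?e" using gen[OF e(3)] e(1,2) unfolding x_def y_def z_def by blast
    then show ?thesis by simp
  qed
  have G': "gcd (gcd y x) ?n = 1" using G by (simp only: gcd.commute[of y x])
  have sq: "?n dvd l^2 - 1" "?n dvd m^2 - 1"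
    by (rule klein_square[OF k G], rule klein_square[OF k' G'])
  have ne': "\<not> ?n dvd x" "\<not> ?n dvd y" "\<not> ?n dvd y - x" "\<not> ?n dvd x - y" "\<not> ?n dvd x - z"
    using ne by (simp_all add: x_def y_def z_def)
  have "\<exists>a b c. standard n a b c \<and> similar ?n {0, x, y, z} {0, a, b, c}"
  proof -
    consider "coprime x ?n" | "coprime y ?n" | "coprime z ?n" | "\<not> coprime x ?n" "\<not> coprime y ?n" "\<not> coprime z ?n"
      by blast
    then show ?thesis
    proof cases
      case 1
      then show ?thesis using klein_unit_standard[OF k sq(2) _ ne'(2,3) n] by blast
    next
      case 2
      have "{0, y, x, z} = {0, x, y, z}" by auto
      then show ?thesis using klein_unit_standard[OF k' sq(1) 2 ne'(1,4) n] by simp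
    next
      case 3
      have "{0, z, x, y} = {0, x, y, z}" by auto
      then show ?thesis using klein_unit_standard[OF klein_rotate[OF k] sq(1) 3 ne'(1,5) n] by simp
    next
      case 4
      then show ?thesis using klein_nonunit_standard[OF k sq G _ _ _ n] by blast
    qed
  qed
  moreover have "(\<lambda>t. t - x0) ` {x0, p, q, r} = {0, x, y, z}" by (simp add: x_def y_def z_def)
  ultimately show ?thesis using similar_translate by metis
qed

text \<open>The assumption \<open>gen\<close> is the arithmetic form of generation, provided by
  \<open>generators_reflections_unit\<close>.\<close>

theorem transitive_similar_standard:
  fixes n :: nat
  assumes n: "n \<ge> 3" and Y: "Y \<subseteq> {0..<int n}" "card Y = 4"
    and tr: "\<forall>x\<in>Y. \<forall>y\<in>Y. \<exists>f\<in>affine_stabilizer (int n) Y. f x = y"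
    and gen: "\<And>e. e dvd int n \<Longrightarrow> (\<And>x y. x \<in> Y \<Longrightarrow> y \<in> Y \<Longrightarrow> e dvd x - y) \<Longrightarrow> is_unit e"
  shows "\<exists>p q r. standard n p q r \<and> similar (int n) Y {0, p, q, r}"
proof -
  let ?n = "int n" and ?P = "affine_stabilizer (int n) Y"
  obtain x0 where x0: "x0 \<in> Y" using Y(2) by fastforce
  have diff: "\<not> ?n dvd x - y" if "x \<in> Y" "y \<in> Y" "x \<noteq> y" for x y
    using eq_if_dvd_diff[of ?n x y] subsetD[OF Y(1)] that by (auto simp: subset_iff)
  have gen0: "is_unit e" if "Y = {x0, p, q, r}" "e dvd ?n" "e dvd p - x0" "e dvd q - x0" "e dvd r - x0" for e p q r
  proof (rule gen[OF that(2)])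
    fix x y assume "x \<in> Y" "y \<in> Y"
    then have "e dvd x - x0" "e dvd y - x0" using that by auto
    then have "e dvd (x - x0) - (y - x0)" by (rule dvd_diff)
    then show "e dvd x - y" by simp
  qed
  have inY: "f x \<in> Y" if "f \<in> ?P" "x \<in> Y" for f x using that by (auto simp: affine_stabilizer_def)
  have dv: "?n dvd y - (s * x + t)" if "affine ?n s t x = y" for s t x y using affine_dvd[of ?n s t x] that by simp
  have n0: "?n > 0" using n by simp
  from affine_four_points[OF n0 Y x0 tr] show ?thesis
  proof (elim disjE bexE exE conjE)
    fix f assume f: "f \<in> ?P" "distinct [x0, f x0, f (f x0), f (f (f x0))]" "f (f (f (f x0))) = x0"
    obtain s t where s: "coprime s ?n" "f = affine ?n s t" using f(1) by (auto simp: affine_stabilizer_def)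
    have mem: "f x0 \<in> Y" "f (f x0) \<in> Y" "f (f (f x0)) \<in> Y" using inY[OF f(1)] x0 by auto
    have Yeq: "Y = {x0, f x0, f (f x0), f (f (f x0))}"
      by (rule card4_list[OF Y(2) f(2)]) (use mem x0 in simp)
    have "\<not> ?n dvd f (f x0) - x0" using diff[OF mem(2) x0] f(2) by auto
    then have "\<exists>p q r. standard n p q r \<and> similar ?n {x0, f x0, f (f x0), f (f (f x0))} {0, p, q, r}"
      by (rule four_cycle_similar_standard[OF n s(1) dv dv dv dv, rotated 4])
        (use gen0[OF Yeq] f(3) s(2) in auto)
    then show ?thesis using Yeq by simp
  next
    fix f g p q r
    assume fg: "f \<in> ?P" "g \<in> ?P" and d: "distinct [x0, p, q, r]"
      and fe: "f x0 = p" "f p = x0" "f q = r" "f r = q" and ge: "g x0 = q" "g q = x0" "g p = r" "g r = p"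
    obtain l t where l: "f = affine ?n l t" using fg(1) by (auto simp: affine_stabilizer_def)
    obtain m t' where m: "g = affine ?n m t'" using fg(2) by (auto simp: affine_stabilizer_def)
    have mem: "p \<in> Y" "q \<in> Y" "r \<in> Y" using inY fg x0 fe ge by metis+
    have Yeq: "Y = {x0, p, q, r}" by (rule card4_list[OF Y(2) d]) (use mem x0 in simp)
    have ne: "\<not> ?n dvd p - x0" "\<not> ?n dvd q - x0" "\<not> ?n dvd q - p" "\<not> ?n dvd p - q" "\<not> ?n dvd p - r"
      using diff mem x0 d by auto
    have "\<exists>a b c. standard n a b c \<and> similar ?n {x0, p, q, r} {0, a, b, c}"
      by (rule klein_similar_standard[OF n fe[unfolded l, THEN dv] ge[unfolded m, THEN dv] ne gen0[OF Yeq]])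
    then show ?thesis using Yeq by simp
  qed
qed

section \<open>The converse: normal forms have transitive stabilizers\<close>

text \<open>Stated up to congruence since normal forms such as \<open>1 - i\<close> are not reduced
  modulo \<open>n\<close>. Mapping \<open>S\<close> into itself is enough for a stabilizer when
  \<open>S\<close> is finite, as the maps are injective modulo \<open>n\<close>.\<close>

definition affine_move :: "int \<Rightarrow> int set \<Rightarrow> int \<Rightarrow> int \<Rightarrow> bool" where
  "affine_move n S v w \<longleftrightarrow> (\<exists>s t. coprime s n \<and> [s * v + t = w] (mod n) \<and>
     (\<forall>y\<in>S. \<exists>y'\<in>S. [s * y + t = y'] (mod n)))"

lemma affine_move_trans:
  assumes "affine_move n S u v" "affine_move n S v w"
  shows "affine_move n S u w"
proof -
  obtain s t where s: "coprime s n" "[s * u + t = v] (mod n)" "\<forall>y\<in>S. \<exists>y'\<in>S. [s * y + t = y'] (mod n)"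
    using assms(1) by (auto simp: affine_move_def)
  obtain s' t' where s': "coprime s' n" "[s' * v + t' = w] (mod n)" "\<forall>y\<in>S. \<exists>y'\<in>S. [s' * y + t' = y'] (mod n)"
    using assms(2) by (auto simp: affine_move_def)
  have comp: "[s' * s * x + (s' * t + t') = z] (mod n)"
    if "[s * x + t = y] (mod n)" "[s' * y + t' = z] (mod n)" for x y z
  proof -
    have "[s' * (s * x + t) + t' = s' * y + t'] (mod n)" using that(1) by (intro cong_add cong_mult) auto
    then have "[s' * (s * x + t) + t' = z] (mod n)" using that(2) by (rule cong_trans)
    then show ?thesis by (simp add: algebra_simps)
  qed
  have "\<exists>y'\<in>S. [s' * s * y + (s' * t + t') = y'] (mod n)" if "y \<in> S" for y
    using s(3) s'(3) comp that by meson
  then show ?thesis unfolding affine_move_def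
    using s(1) s'(1) comp[OF s(2) s'(2)] by (intro exI[of _ "s' * s"] exI[of _ "s' * t + t'"]) auto
qed

text \<open>Each of \<open>x\<close>, \<open>y\<close>, \<open>z\<close> is exchanged with
  \<open>0\<close> by one of the three involutions, so all moves can pass through
  \<open>0\<close>.\<close>

lemma klein_affine_move:
  assumes k: "klein n l m x y z" and c: "coprime l n" "coprime m n" and vw: "v \<in> {0, x, y, z}" "w \<in> {0, x, y, z}"
  shows "affine_move n {0, x, y, z} v w"
proof -
  let ?S = "{0, x, y, z}"
  have *: "affine_move n ?S 0 x \<and> affine_move n ?S x 0"
    if "klein n l m x y z" "coprime l n" "?S = {0, x, y, z}" for l m x y z
  proof -
    have st: "\<forall>t\<in>?S. \<exists>t'\<in>?S. [l * t + x = t'] (mod n)"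
      unfolding that(3) using that(1) by (auto simp: klein_def cong_iff_dvd_diff)
    moreover have "[l * 0 + x = x] (mod n)" "[l * x + x = 0] (mod n)"
      using that(1) by (simp_all add: klein_def cong_0_iff)
    ultimately show ?thesis using that(2) unfolding affine_move_def by blast
  qed
  have x: "affine_move n ?S 0 x \<and> affine_move n ?S x 0" by (rule *[OF k c(1)]) simp
  have y: "affine_move n ?S 0 y \<and> affine_move n ?S y 0"
    by (rule *[OF klein_swap[THEN iffD1, OF k] c(2)]) auto
  have z: "affine_move n ?S 0 z \<and> affine_move n ?S z 0"
    by (rule *[OF klein_rotate[OF k]]) (use c in auto)
  have "affine_move n ?S v 0" "affine_move n ?S 0 w"
    using vw x y z affine_move_trans[of n ?S 0 x 0] by auto
  then show ?thesis by (rule affine_move_trans)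
qed

lemma standard_affine_move:
  assumes s: "standard n p q r" and vw: "v \<in> {0, p, q, r}" "w \<in> {0, p, q, r}"
  shows "affine_move (int n) {0, p, q, r} v w"
  using s unfolding standard_def
proof (elim disjE exE conjE)
  fix i assume i: "gcd (2 * i - 1) (int n) = 1" "[2 * i * (i - 1) = 0] (mod int n)"
    and e: "p = 1" "q = i" "r = 1 - i"
  have i2: "int n dvd 2 * i * (i - 1)" using i(2) by (simp add: cong_0_iff)
  \<comment> \<open>These are the multipliers that \<open>klein_unit_standard\<close> derives for
    the first family.\<close>
  have "klein (int n) (- 1) (1 - 2 * i) 1 i (1 - i)"
    unfolding klein_def using dvd_mult[OF i2, of "- 1"] i2 by (simp add: algebra_simps)
  moreover have "coprime (2 * i - 1) (int n)" using i(1) by (simp only: coprime_iff_gcd_eq_1)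
  then have "coprime (- (2 * i - 1)) (int n)" by (simp only: coprime_minus_left_iff)
  then have "coprime (1 - 2 * i) (int n)" by simp
  ultimately show ?thesis using klein_affine_move vw unfolding e by simp
next
  fix k assume k: "gcd k (int n) = 1" "[1 + k + k^2 + k^3 = 0] (mod int n)"
    and e: "p = 1" "q = k + 1" "r = k^2 + k + 1"
  let ?S = "{0, p, q, r}"
  have ck: "coprime k (int n)" using k(1) by (simp only: coprime_iff_gcd_eq_1)
  have kd: "int n dvd 1 + k + k^2 + k^3" using k(2) by (simp add: cong_0_iff)
  have maps: "[k * 0 + 1 = p] (mod int n)" "[k * p + 1 = q] (mod int n)" "[k * q + 1 = r] (mod int n)"
    "[k * r + 1 = 0] (mod int n)"
    using kd by (simp_all add: e algebra_simps power2_eq_square power3_eq_cube cong_0_iff)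
  then have "\<forall>t\<in>?S. \<exists>t'\<in>?S. [k * t + 1 = t'] (mod int n)" by blast
  then have m: "affine_move (int n) ?S 0 p" "affine_move (int n) ?S p q" "affine_move (int n) ?S q r"
      "affine_move (int n) ?S r 0"
    using maps ck unfolding affine_move_def by blast+
  note tr = affine_move_trans[where n = "int n" and S = ?S]
  have "affine_move (int n) ?S v 0" using vw(1) m tr by blast
  moreover have "affine_move (int n) ?S 0 w" using vw(2) m tr by blast
  ultimately show ?thesis by (rule tr)
next
  fix l m
  assume lm: "[l^2 = 1] (mod int n)" "[m^2 = 1] (mod int n)" "[r = q * l + p] (mod int n)" "[r = p * m + q] (mod int n)"
    "[p * (l + 1) = 0] (mod int n)" "[q * (m + 1) = 0] (mod int n)"
  have d: "int n dvd l^2 - 1" "int n dvd m^2 - 1" "int n dvd r - (q * l + p)" "int n dvd r - (p * m + q)"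
    "int n dvd p * (l + 1)" "int n dvd q * (m + 1)"
    using lm by (simp_all add: cong_iff_dvd_diff)
  \<comment> \<open>The third family does not list the images of \<open>r\<close>; they follow from
    those of \<open>p\<close> and \<open>q\<close> because the multipliers square to
    \<open>1\<close>.\<close>
  have "int n dvd l * r + p - q"
  proof -
    have "int n dvd l * (r - (q * l + p)) + p * (l + 1) + q * (l^2 - 1)"
      by (rule dvd_add[OF dvd_add[OF dvd_mult[OF d(3)] d(5)] dvd_mult[OF d(1)]])
    then show ?thesis by (simp add: algebra_simps power2_eq_square)
  qed
  moreover have "int n dvd m * r + q - p"
  proof -
    have "int n dvd m * (r - (p * m + q)) + q * (m + 1) + p * (m^2 - 1)"
      by (rule dvd_add[OF dvd_add[OF dvd_mult[OF d(4)] d(6)] dvd_mult[OF d(2)]])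
    then show ?thesis by (simp add: algebra_simps power2_eq_square)
  qed
  moreover have "int n dvd l * q + p - r" "int n dvd m * p + q - r"
  proof -
    have "int n dvd - (r - (q * l + p))" "int n dvd - (r - (p * m + q))" using d(3,4) by (simp_all only: dvd_minus_iff)
    then show "int n dvd l * q + p - r" "int n dvd m * p + q - r" by (simp_all add: algebra_simps)
  qed
  ultimately have "klein (int n) l m p q r" using d(5,6) by (simp add: klein_def algebra_simps)
  moreover have "coprime l (int n)" "coprime m (int n)"
    using lm(1,2) unfolding power2_eq_square by (metis coprime_iff_invertible_int)+
  ultimately show ?thesis using klein_affine_move vw by blast
qed

section \<open>Automorphisms of the dihedral group\<close>

locale dihedral = dihedral_pair +
  assumes gen: "generate G {a, b} = carrier G" and ord: "order G = 2 * n" and n3: "n \<ge> 3"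
begin

abbreviation "ref x \<equiv> nf (True, x)"
abbreviation "rot x \<equiv> nf (False, x)"

lemma carrier_nf: "carrier G = nf ` (UNIV \<times> {0..<int n})"
  using generate_nf gen by simp

lemma nf_cases: "x \<in> carrier G \<Longrightarrow> (\<And>e i. x = nf (e, i) \<Longrightarrow> P) \<Longrightarrow> P"
  unfolding carrier_nf by auto

lemma finite_carrier: "finite (carrier G)"
  unfolding carrier_nf by simp

text \<open>The \<open>2 * n\<close> reduced normal forms exhaust a group of order
  \<open>2 * n\<close>, so they are distinct.\<close>

lemma nf_eq_iff: "nf (e, i) = nf (f, j) \<longleftrightarrow> e = f \<and> [i = j] (mod int n)"
proof
  assume *: "nf (e, i) = nf (f, j)"
  have "inj_on nf (UNIV \<times> {0..<int n})"
    by (rule eq_card_imp_inj_on)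
      (use ord carrier_nf in \<open>simp_all add: order_def card_cartesian_product\<close>)
  moreover have "nf (e, i mod int n) = nf (f, j mod int n)"
    using * nf_cong[of i "i mod int n" e] nf_cong[of j "j mod int n" f] by (simp add: cong_def)
  ultimately have "(e, i mod int n) = (f, j mod int n)" using n by (auto dest!: inj_onD)
  then show "e = f \<and> [i = j] (mod int n)" by (simp add: cong_def)
qed (use nf_cong in auto)

lemma ref_eq: "ref i = b \<otimes> a [^] i" by (simp add: dihedral_nf_def)

lemma inv_ref: "inv (ref x) = ref x"
  by (rule inv_equality) (simp_all add: nf_mult nf_gens(3))

lemma rot_pow: "rot u [^] (k::nat) = rot (u * int k)"
  by (induction k) (simp_all add: nf_mult nf_gens(3) algebra_simps)

lemma rot_int_pow: "a [^] (i::int) = rot i" by (simp add: dihedral_nf_def)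

lemma hom_nf:
  assumes h: "h \<in> hom G G" and "h a = rot u"
  shows "h (rot i) = rot (u * i)" "h b = nf (e, v) \<Longrightarrow> h (ref i) = nf (e, v + u * i)"
proof -
  interpret h: group_hom G G h using h by unfold_locales
  have "h (a [^] i) = (h a) [^] i" by (rule h.hom_int_pow) simp
  also have "\<dots> = (a [^] u) [^] i" using assms(2) by (simp add: rot_int_pow)
  also have "\<dots> = a [^] (u * i)" by (simp add: int_pow_pow)
  finally show rot: "h (rot i) = rot (u * i)" by (simp add: rot_int_pow)
  assume "h b = nf (e, v)"
  moreover have "ref i = b \<otimes> rot i" by (simp add: ref_eq rot_int_pow)
  ultimately have "h (ref i) = nf (e, v) \<otimes> rot (u * i)" using rot by simp
  then show "h (ref i) = nf (e, v + u * i)" by (simp add: nf_mult)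
qed

text \<open>\<open>rot u\<close> and \<open>ref v\<close> again satisfy the dihedral relations, so
  the assignment extends to an endomorphism; as \<open>u\<close> is a unit, it is injective on
  normal forms.\<close>

lemma affine_auto:
  assumes u: "coprime u (int n)"
  shows "\<exists>\<sigma>\<in>auto G. \<forall>x. \<sigma> (ref x) = ref (u * x + v)"
proof -
  have "dihedral_relations G n (rot u) (ref v)"
  proof -
    have "rot u [^] n = \<one>" unfolding rot_pow nf_gens(3)[symmetric] nf_eq_iff by (simp add: cong_0_iff)
    moreover have "ref v [^] (2::nat) = \<one>" by (simp add: numeral_2_eq_2 nf_mult nf_gens(3))
    moreover have "ref v \<otimes> rot u \<otimes> ref v = inv (rot u)"
      by (rule inv_equality[symmetric]) (simp_all add: nf_mult nf_gens(3))
    ultimately show ?thesis by (simp add: dihedral_relations_def)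
  qed
  then obtain h where h: "h \<in> hom G G" "h a = rot u" "h b = ref v"
    using dihedral_order_universal[OF is_group rels gen n ord is_group] by blast
  note hnf = hom_nf(1)[OF h(1,2)] hom_nf(2)[OF h]
  have "inj_on h (carrier G)"
  proof (rule inj_onI)
    fix x y assume "x \<in> carrier G" "y \<in> carrier G" and eq: "h x = h y"
    then obtain e i f j where xy: "x = nf (e, i)" "y = nf (f, j)" by (metis nf_cases)
    have "e = f \<and> [u * i = u * j] (mod int n)"
      using eq unfolding xy by (cases e; cases f) (simp_all add: hnf nf_eq_iff cong_add_lcancel)
    then show "x = y" unfolding xy nf_eq_iff using u by (simp add: cong_mult_lcancel)
  qed
  moreover have "h ` carrier G \<subseteq> carrier G" using h(1) by (auto simp: hom_def)
  ultimately have bij: "bij_betw h (carrier G) (carrier G)"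
    using finite_carrier by (simp add: bij_betw_def endo_inj_surj)
  \<comment> \<open>Members of \<open>auto G\<close> are extensional functions on the
    carrier.\<close>
  define \<sigma> where "\<sigma> = restrict h (carrier G)"
  have "\<sigma> \<in> hom G G" using h(1) by (auto simp: \<sigma>_def hom_def)
  moreover have "\<sigma> \<in> Bij (carrier G)" using bij by (simp add: \<sigma>_def Bij_def bij_betw_restrict_eq)
  ultimately have "\<sigma> \<in> auto G" by (simp add: auto_def)
  moreover have "\<sigma> (ref x) = ref (u * x + v)" for x by (simp add: \<sigma>_def hnf add.commute)
  ultimately show ?thesis by blast
qed

text \<open>The image of \<open>a\<close> is no reflection, since \<open>n \<ge> 3\<close> excludes
  \<open>a \<otimes> a = \<one>\<close>. Surjectivity then forces \<open>b\<close> to a reflection,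
  and a preimage of \<open>a\<close> inverts \<open>u\<close>.\<close>

lemma auto_affine:
  assumes \<sigma>: "\<sigma> \<in> auto G"
  obtains u v where "coprime u (int n)" "\<And>x. \<sigma> (ref x) = ref (u * x + v)"
proof -
  have h: "\<sigma> \<in> hom G G" and bij: "bij_betw \<sigma> (carrier G) (carrier G)"
    using \<sigma> by (auto simp: auto_def Bij_def)
  interpret h: group_hom G G \<sigma> using h by unfold_locales
  have inj: "inj_on \<sigma> (carrier G)" using bij by (simp add: bij_betw_def)
  have surj: "\<exists>g\<in>carrier G. \<sigma> g = x" if "x \<in> carrier G" for x
    using bij that by (metis bij_betw_imp_surj_on imageE)
  obtain e u where u: "\<sigma> a = nf (e, u)" using nf_cases[of "\<sigma> a"] by auto
  have "\<not> e"
  proof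
    assume e
    then have "\<sigma> a \<otimes> \<sigma> a = \<one>" using u by (simp add: nf_mult nf_gens(3))
    then have "\<sigma> (a \<otimes> a) = \<sigma> \<one>" by simp
    then have "a \<otimes> a = \<one>" by (rule inj_onD[OF inj]) simp_all
    then have "rot (1 + 1) = rot 0" using nf_mult[of False 1 False 1] by (simp add: nf_gens)
    then have "[2 = 0] (mod int n)" by (simp add: nf_eq_iff)
    then have "int n dvd 2" by (simp add: cong_0_iff)
    then show False using n3 zdvd_imp_le[of "int n" 2] by simp
  qed
  then have u: "\<sigma> a = rot u" using u by simp
  obtain f v where v: "\<sigma> b = nf (f, v)" using nf_cases[of "\<sigma> b"] by auto
  note snf = hom_nf(1)[OF h u] hom_nf(2)[OF h u v]
  have f
  proof (rule ccontr)
    assume "\<not> f"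
    obtain g where g: "g \<in> carrier G" "\<sigma> g = b" using surj by auto
    obtain e i where "g = nf (e, i)" using g(1) by (rule nf_cases)
    then have "\<exists>j. \<sigma> g = rot j" using snf[of i] \<open>\<not> f\<close> by (cases e) auto
    then have "\<exists>j. b = rot j" using g(2) by simp
    then show False using nf_gens(2) nf_eq_iff by metis
  qed
  then have sref: "\<sigma> (ref x) = ref (u * x + v)" for x using snf(2)[of x] by (simp add: add.commute)
  obtain g where g: "g \<in> carrier G" "\<sigma> g = a" using surj by auto
  obtain e i where gi: "g = nf (e, i)" using g(1) by (rule nf_cases)
  have "\<sigma> g = rot 1" using g(2) by (simp add: nf_gens)
  then have "[u * i = 1] (mod int n)" using sref[of i] snf(1)[of i] unfolding gi
    by (cases e) (simp_all add: nf_eq_iff)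
  then have "coprime u (int n)" using coprime_iff_invertible_int by blast
  then show ?thesis using that sref by blast
qed

section \<open>Edges of the Cayley graph in terms of automorphisms\<close>

lemma valency_card:
  assumes C: "C \<subseteq> carrier G" "\<And>c. c \<in> C \<Longrightarrow> inv c \<in> C"
  shows "has_valency (cayley_graph G C) (card C)"
proof -
  have "card {w \<in> carrier G. {v, w} \<in> snd (cayley_graph G C)} = card C" if v: "v \<in> carrier G" for v
  proof -
    have edge: "{v, w} \<in> snd (cayley_graph G C) \<longleftrightarrow> w \<otimes> inv v \<in> C" if w: "w \<in> carrier G" for w
    proof -
      have "{v, w} \<in> snd (cayley_graph G C) \<longleftrightarrow> v \<otimes> inv w \<in> C \<or> w \<otimes> inv v \<in> C"
        using v w by (auto simp: cayley_graph_def doubleton_eq_iff)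
      moreover have "inv (v \<otimes> inv w) = w \<otimes> inv v" using v w by (simp add: inv_mult_group)
      ultimately show ?thesis using C(2)[of "v \<otimes> inv w"] by auto
    qed
    have "{w \<in> carrier G. {v, w} \<in> snd (cayley_graph G C)} = (\<lambda>c. c \<otimes> v) ` C"
    proof (intro equalityI subsetI)
      fix w assume "w \<in> {w \<in> carrier G. {v, w} \<in> snd (cayley_graph G C)}"
      then have w: "w \<in> carrier G" "w \<otimes> inv v \<in> C" using edge by auto
      have "w = (w \<otimes> inv v) \<otimes> v" using v w by (simp add: m_assoc)
      then show "w \<in> (\<lambda>c. c \<otimes> v) ` C" using w(2) by blast
    next
      fix w assume "w \<in> (\<lambda>c. c \<otimes> v) ` C"
      then obtain c where c: "c \<in> C" "w = c \<otimes> v" by blast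
      then have "c \<in> carrier G" "w \<in> carrier G" using C(1) v by auto
      moreover from this have "w \<otimes> inv v = c" using c(2) v by (simp add: m_assoc)
      ultimately show "w \<in> {w \<in> carrier G. {v, w} \<in> snd (cayley_graph G C)}" using edge c(1) by simp
    qed
    moreover have "inj_on (\<lambda>c. c \<otimes> v) C" using C(1) v by (auto simp: inj_on_def subset_iff)
    ultimately show ?thesis by (simp add: card_image)
  qed
  then show ?thesis by (simp add: has_valency_def cayley_graph_def)
qed

text \<open>A map from the edge \<open>{c, \<one>}\<close> to \<open>{d, \<one>}\<close> is an
  automorphism followed by a right translation by \<open>g\<close>. As the automorphism fixes
  \<open>\<one>\<close>, \<open>g\<close> is \<open>\<one>\<close> or \<open>d\<close>, the latter
  if the edge is reversed.\<close>

lemma normal_edge_transitiveD: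
  assumes "normal_edge_transitive G C" "C \<subseteq> carrier G" "c \<in> C" "d \<in> C"
  shows "\<exists>\<sigma>\<in>auto_stabilizer G C. \<sigma> c = d \<or> \<sigma> c = inv d"
proof -
  have cd: "c \<in> carrier G" "d \<in> carrier G" using assms by auto
  have edge: "{x, \<one>} \<in> snd (cayley_graph G C)" if "x \<in> C" for x
    using that assms(2) unfolding cayley_graph_def snd_conv mem_Collect_eq
    by (intro exI[of _ x] exI[of _ \<one>]) auto
  obtain \<phi> where \<phi>: "\<phi> \<in> cayley_normalizer G C" "\<phi> ` {c, \<one>} = {d, \<one>}"
    using assms(1)[unfolded normal_edge_transitive_def, rule_format, OF edge edge, OF assms(3,4)] by blast
  obtain g \<sigma> where g: "g \<in> carrier G" and s: "\<sigma> \<in> auto_stabilizer G C"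
    and eq: "\<phi> = (\<lambda>h \<in> carrier G. \<sigma> h \<otimes> g)"
    using \<phi>(1) unfolding cayley_normalizer_eq by blast
  have "\<sigma> \<in> hom G G" using s by (auto simp: auto_stabilizer_def auto_def)
  then interpret h: group_hom G G \<sigma> by unfold_locales
  have "{\<sigma> c \<otimes> g, g} = {d, \<one>}" using \<phi>(2) cd g by (simp add: eq)
  then have "\<sigma> c \<otimes> g = d \<and> g = \<one> \<or> \<sigma> c \<otimes> g = \<one> \<and> g = d" by (auto simp: doubleton_eq_iff)
  then have "\<sigma> c = d \<or> \<sigma> c = inv d" using cd inv_equality[of "\<sigma> c" d] by auto
  then show ?thesis using s by blast
qed

text \<open>An automorphism that matches the quotients of two edges also matches the edges after a
  right translation, here by \<open>k\<close>.\<close>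

lemma normal_edge_transitiveI:
  assumes C: "C \<subseteq> carrier G" and tr: "\<And>c d. c \<in> C \<Longrightarrow> d \<in> C \<Longrightarrow> \<exists>\<sigma>\<in>auto_stabilizer G C. \<sigma> c = d"
  shows "normal_edge_transitive G C"
  unfolding normal_edge_transitive_def
proof (intro ballI)
  fix e f assume "e \<in> snd (cayley_graph G C)" "f \<in> snd (cayley_graph G C)"
  then obtain g h g' h' where e: "e = {g, h}" "g \<in> carrier G" "h \<in> carrier G" "g \<otimes> inv h \<in> C"
    and f: "f = {g', h'}" "g' \<in> carrier G" "h' \<in> carrier G" "g' \<otimes> inv h' \<in> C"
    by (auto simp: cayley_graph_def)
  obtain \<sigma> where s: "\<sigma> \<in> auto_stabilizer G C" "\<sigma> (g \<otimes> inv h) = g' \<otimes> inv h'" using tr e(4) f(4) by blast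
  have "\<sigma> \<in> hom G G" using s by (auto simp: auto_stabilizer_def auto_def)
  then interpret h: group_hom G G \<sigma> by unfold_locales
  define k where "k = inv (\<sigma> h) \<otimes> h'"
  have k: "k \<in> carrier G" using e f by (simp add: k_def)
  have "\<sigma> h \<otimes> k = h'" using e f by (simp add: k_def m_assoc[symmetric])
  moreover have "\<sigma> g \<otimes> k = g'"
  proof -
    have "\<sigma> g \<otimes> k = \<sigma> (g \<otimes> inv h) \<otimes> h'" using e f by (simp add: k_def m_assoc)
    also have "\<dots> = g'" unfolding s(2) using f by (simp add: m_assoc)
    finally show ?thesis .
  qed
  ultimately have "(\<lambda>x \<in> carrier G. \<sigma> x \<otimes> k) ` e = f" using e f by simp
  moreover have "(\<lambda>x \<in> carrier G. \<sigma> x \<otimes> k) \<in> cayley_normalizer G C"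
    unfolding cayley_normalizer_eq using k s(1) by blast
  ultimately show "\<exists>\<phi>\<in>cayley_normalizer G C. \<phi> ` e = f" by blast
qed

end

context dihedral
begin

section \<open>Reduction of the graph property to affine maps\<close>

lemma generators_not_rotations:
  assumes "generate G C = carrier G"
  shows "\<exists>x. ref x \<in> C \<or> \<not> C \<subseteq> carrier G"
proof (rule ccontr)
  assume *: "\<not> ?thesis"
  have "C \<subseteq> range rot"
  proof
    fix c assume c: "c \<in> C"
    then have "c \<in> carrier G" using * by auto
    then obtain e i where "c = nf (e, i)" by (rule nf_cases)
    then show "c \<in> range rot" using * c by (cases e) auto
  qed
  moreover have "subgroup (range rot) G"
  proof (rule subgroupI)
    fix x y assume "x \<in> range rot" "y \<in> range rot"
    then show "x \<otimes> y \<in> range rot" by (auto simp: nf_mult)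
  next
    fix x assume "x \<in> range rot"
    then obtain i where i: "x = rot i" by blast
    have "inv x = rot (- i)" unfolding i by (rule inv_equality) (simp_all add: nf_mult nf_gens(3))
    then show "inv x \<in> range rot" by simp
  qed auto
  ultimately have "carrier G \<subseteq> range rot" using assms generate_subgroup_incl by metis
  then have "ref 0 \<in> range rot" using nf_closed by blast
  then show False using nf_eq_iff by auto
qed

text \<open>The rotations by multiples of \<open>e\<close> and the reflections with exponent
  congruent to \<open>x0\<close> modulo \<open>e\<close> form a subgroup \<open>H\<close> that
  contains all generators. It contains \<open>rot 1\<close> only if \<open>e\<close> is a
  unit.\<close>

lemma generators_reflections_unit:
  assumes "generate G (ref ` Y) = carrier G" and e: "e dvd int n" "\<And>x y. x \<in> Y \<Longrightarrow> y \<in> Y \<Longrightarrow> e dvd x - y"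
    and x0: "x0 \<in> Y"
  shows "is_unit e"
proof -
  define H where "H = rot ` {i. e dvd i} \<union> ref ` {i. e dvd i - x0}"
  have rotI: "rot i \<in> H" if "e dvd i" for i using that by (simp add: H_def)
  have refI: "ref i \<in> H" if "e dvd i - x0" for i using that by (simp add: H_def)
  have "subgroup H G"
  proof (rule subgroupI)
    fix x y assume "x \<in> H" "y \<in> H"
    then consider (1) i j where "x = rot i" "y = rot j" "e dvd i" "e dvd j"
      | (2) i j where "x = rot i" "y = ref j" "e dvd i" "e dvd j - x0"
      | (3) i j where "x = ref i" "y = rot j" "e dvd i - x0" "e dvd j"
      | (4) i j where "x = ref i" "y = ref j" "e dvd i - x0" "e dvd j - x0"
      by (auto simp: H_def)
    then show "x \<otimes> y \<in> H"
    proof cases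
      case 1
      have "x \<otimes> y = rot (i + j)" using 1 by (simp add: nf_mult)
      then show ?thesis using 1 rotI[of "i + j"] by simp
    next
      case 2
      have "x \<otimes> y = ref (- i + j)" using 2 by (simp add: nf_mult)
      moreover have "e dvd (j - x0) - i" by (rule dvd_diff[OF 2(4,3)])
      then have "e dvd (- i + j) - x0" by (simp add: algebra_simps)
      ultimately show ?thesis using refI by simp
    next
      case 3
      have "x \<otimes> y = ref (i + j)" using 3 by (simp add: nf_mult)
      moreover have "e dvd (i - x0) + j" by (rule dvd_add[OF 3(3,4)])
      then have "e dvd (i + j) - x0" by (simp add: algebra_simps)
      ultimately show ?thesis using refI by simp
    next
      case 4
      have "x \<otimes> y = rot (- i + j)" using 4 by (simp add: nf_mult)
      moreover have "e dvd (j - x0) - (i - x0)" by (rule dvd_diff[OF 4(4,3)])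
      then have "e dvd - i + j" by (simp add: algebra_simps)
      ultimately show ?thesis using rotI by simp
    qed
  next
    fix x assume "x \<in> H"
    then consider (1) i where "x = rot i" "e dvd i" | (2) i where "x = ref i" "e dvd i - x0"
      by (auto simp: H_def)
    then show "inv x \<in> H"
    proof cases
      case 1
      have "inv x = rot (- i)" unfolding 1(1) by (rule inv_equality) (simp_all add: nf_mult nf_gens(3))
      then show ?thesis using 1 rotI[of "- i"] by simp
    next
      case 2
      then show ?thesis using inv_ref refI by simp
    qed
  next
    show "H \<subseteq> carrier G" by (auto simp: H_def)
    show "H \<noteq> {}" using rotI[of 0] by auto
  qed
  moreover have "ref ` Y \<subseteq> H" using refI e(2) x0 by auto
  ultimately have "carrier G \<subseteq> H" using assms(1) generate_subgroup_incl by metis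
  then have "rot 1 \<in> H" using nf_closed by blast
  then obtain i where i: "e dvd i" "rot 1 = rot i" unfolding H_def using nf_eq_iff by fastforce
  then have "int n dvd 1 - i" by (simp add: nf_eq_iff cong_iff_dvd_diff)
  then have "e dvd 1 - i" by (rule dvd_trans[OF e(1)])
  then have "e dvd (1 - i) + i" using i(1) by (rule dvd_add)
  then show ?thesis by simp
qed

lemma normal_edge_transitive_imp_standard:
  assumes C: "inverse_closed_generating_set G C" "card C = 4" and net: "normal_edge_transitive G C"
  shows "\<exists>\<sigma>\<in>auto G. \<exists>p q r. standard n p q r \<and> \<sigma> ` C = ref ` {0, p, q, r}"
proof -
  have CG: "C \<subseteq> carrier G" and genC: "generate G C = carrier G"
    using C(1) by (auto simp: inverse_closed_generating_set_def)
  obtain x0 where x0: "ref x0 \<in> C" using generators_not_rotations[OF genC] CG by blast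
  \<comment> \<open>Automorphisms send reflections to reflections, and these are their own inverses,
    so one reflection in \<open>C\<close> makes all of \<open>C\<close> reflections.\<close>
  have refl: "\<exists>x. d = ref x" if d: "d \<in> C" for d
  proof -
    obtain \<sigma> where s: "\<sigma> \<in> auto_stabilizer G C" "\<sigma> (ref x0) = d \<or> \<sigma> (ref x0) = inv d"
      using normal_edge_transitiveD[OF net CG x0 d] by blast
    then have "\<sigma> \<in> auto G" by (simp add: auto_stabilizer_def)
    then obtain u v where "\<And>x. \<sigma> (ref x) = ref (u * x + v)" using auto_affine by metis
    then have "d = ref (u * x0 + v) \<or> inv d = ref (u * x0 + v)" using s(2) by metis
    moreover have "d \<in> carrier G" using d CG by blast
    ultimately show ?thesis using inv_ref inv_inv by metis
  qed
  define Y where "Y = {x \<in> {0..<int n}. ref x \<in> C}"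
  have rmod: "ref (x mod int n) = ref x" for x by (rule nf_cong) (simp add: cong_def)
  have n0: "int n > 0" using n3 by simp
  have Ymod: "x mod int n \<in> Y" if "ref x \<in> C" for x using that n0 by (simp add: Y_def rmod)
  have CY: "C = ref ` Y"
  proof (intro equalityI subsetI)
    fix d assume "d \<in> C"
    then obtain x where x: "d = ref x" "ref x \<in> C" using refl by blast
    then show "d \<in> ref ` Y" using Ymod[OF x(2)] rmod[of x] by (metis imageI)
  qed (auto simp: Y_def)
  have Ysub: "Y \<subseteq> {0..<int n}" by (auto simp: Y_def)
  have injY: "inj_on ref Y"
    using Ysub by (auto simp: inj_on_def nf_eq_iff cong_def subset_iff)
  have cardY: "card Y = 4" using C(2) card_image[OF injY] CY by simp
  have finY: "finite Y" using Ysub finite_subset by blast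
  \<comment> \<open>Self-inverse elements remove the alternative \<open>inv d\<close>, so
    transitivity on edges becomes transitivity on exponents.\<close>
  have tr: "\<forall>x\<in>Y. \<forall>y\<in>Y. \<exists>f\<in>affine_stabilizer (int n) Y. f x = y"
  proof (intro ballI)
    fix x y assume xy: "x \<in> Y" "y \<in> Y"
    then have "ref x \<in> C" "ref y \<in> C" using CY by auto
    then obtain \<sigma> where s: "\<sigma> \<in> auto_stabilizer G C" "\<sigma> (ref x) = ref y"
      using normal_edge_transitiveD[OF net CG] inv_ref by metis
    then have "\<sigma> \<in> auto G" and sC: "\<sigma> ` C = C" by (simp_all add: auto_stabilizer_def)
    then obtain u v where u: "coprime u (int n)" and uv: "\<And>x. \<sigma> (ref x) = ref (u * x + v)"
      using auto_affine by metis
    let ?f = "affine (int n) u v"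
    have "?f z \<in> Y" if "z \<in> Y" for z
    proof -
      have "\<sigma> (ref z) \<in> C" using that CY sC by blast
      then show ?thesis using Ymod uv by (simp add: affine_def)
    qed
    then have "?f ` Y \<subseteq> Y" by blast
    then have "?f ` Y = Y" using endo_inj_surj[OF finY _ affine_inj[OF u Ysub]] by blast
    then have "?f \<in> affine_stabilizer (int n) Y" using u unfolding affine_stabilizer_def by blast
    moreover have "?f x = y"
    proof -
      have "[u * x + v = y] (mod int n)" using s(2) uv by (simp add: nf_eq_iff)
      then show ?thesis using subsetD[OF Ysub xy(2)] by (simp add: affine_def cong_def)
    qed
    ultimately show "\<exists>f\<in>affine_stabilizer (int n) Y. f x = y" by blast
  qed
  obtain y0 where y0: "y0 \<in> Y" using cardY by fastforce
  have "\<exists>p q r. standard n p q r \<and> similar (int n) Y {0, p, q, r}"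
  proof (rule transitive_similar_standard[OF n3 Ysub cardY tr])
    fix e assume "e dvd int n" "\<And>x y. x \<in> Y \<Longrightarrow> y \<in> Y \<Longrightarrow> e dvd x - y"
    then show "is_unit e" using generators_reflections_unit[of Y e y0] genC CY y0 by blast
  qed
  then obtain p q r where s: "standard n p q r" and sim: "similar (int n) Y {0, p, q, r}" by blast
  from sim obtain u v where u: "coprime u (int n)"
    and im: "(\<lambda>x. (u * x + v) mod int n) ` Y = (\<lambda>y. y mod int n) ` {0, p, q, r}"
    unfolding similar_def by (elim exE conjE)
  obtain \<sigma> where \<sigma>: "\<sigma> \<in> auto G" "\<And>x. \<sigma> (ref x) = ref (u * x + v)" using affine_auto[OF u] by metis
  have "\<sigma> ` C = (\<lambda>x. ref ((u * x + v) mod int n)) ` Y" unfolding CY image_image by (simp add: \<sigma>(2) rmod)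
  also have "\<dots> = ref ` (\<lambda>x. (u * x + v) mod int n) ` Y" by (simp only: image_image)
  also have "\<dots> = ref ` (\<lambda>y. y mod int n) ` {0, p, q, r}" by (simp only: im)
  also have "\<dots> = (\<lambda>y. ref (y mod int n)) ` {0, p, q, r}" by (simp only: image_image)
  also have "\<dots> = ref ` {0, p, q, r}" by (simp only: rmod)
  finally show ?thesis using \<sigma>(1) s by blast
qed

lemma standard_imp_normal_edge_transitive:
  assumes CG: "C \<subseteq> carrier G" and \<sigma>: "\<sigma> \<in> auto G" and s: "standard n p q r" and im: "\<sigma> ` C = ref ` {0, p, q, r}"
  shows "normal_edge_transitive G C"
proof (rule normal_edge_transitiveI[OF CG])
  fix c d assume cd: "c \<in> C" "d \<in> C"
  let ?S = "{0, p, q, r}" and ?B = "BijGroup (carrier G)"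
  interpret S: subgroup "auto G" ?B by (rule subgroup_auto)
  interpret B: group ?B by (rule group_BijGroup)
  have "\<sigma> c \<in> ref ` ?S" "\<sigma> d \<in> ref ` ?S" unfolding im[symmetric]
    by (rule imageI[OF cd(1)], rule imageI[OF cd(2)])
  then obtain v w where vw: "v \<in> ?S" "w \<in> ?S" "\<sigma> c = ref v" "\<sigma> d = ref w" by (elim imageE)
  obtain m t where m: "coprime m (int n)" "[m * v + t = w] (mod int n)"
    "\<forall>y\<in>?S. \<exists>y'\<in>?S. [m * y + t = y'] (mod int n)"
    using standard_affine_move[OF s vw(1,2)] unfolding affine_move_def by blast
  obtain \<tau> where \<tau>: "\<tau> \<in> auto G" "\<And>x. \<tau> (ref x) = ref (m * x + t)" using affine_auto[OF m(1)] by metis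
  have bij: "inj_on f (carrier G)" "f ` carrier G = carrier G" if "f \<in> auto G" for f
    using that by (auto simp: auto_def Bij_def bij_betw_def)
  have \<tau>v: "\<tau> (ref v) = ref w" using m(2) by (simp add: \<tau>(2) nf_eq_iff)
  have "\<tau> ` \<sigma> ` C \<subseteq> \<sigma> ` C"
  proof -
    have "\<tau> (ref y) \<in> ref ` ?S" if "y \<in> ?S" for y
    proof -
      obtain y' where y': "y' \<in> ?S" "[m * y + t = y'] (mod int n)" using m(3) \<open>y \<in> ?S\<close> by blast
      have "\<tau> (ref y) = ref y'" unfolding \<tau>(2) by (rule nf_cong[OF y'(2)])
      then show ?thesis using y'(1) by blast
    qed
    then show ?thesis unfolding im by blast
  qed
  moreover have sub: "\<sigma> ` C \<subseteq> carrier G" unfolding im by auto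
  then have "inj_on \<tau> (\<sigma> ` C)" using bij(1)[OF \<tau>(1)] inj_on_subset by blast
  moreover have "finite (\<sigma> ` C)" unfolding im by simp
  ultimately have \<tau>C: "\<tau> ` \<sigma> ` C = \<sigma> ` C" using endo_inj_surj by blast
  \<comment> \<open>\<open>\<tau>\<close> acts on the normal form; conjugation by
    \<open>\<sigma>\<close> carries this action back to \<open>C\<close>.\<close>
  define \<rho> where "\<rho> = inv\<^bsub>?B\<^esub> \<sigma> \<otimes>\<^bsub>?B\<^esub> (\<tau> \<otimes>\<^bsub>?B\<^esub> \<sigma>)"
  have \<rho>: "\<rho> \<in> auto G" unfolding \<rho>_def using \<sigma> \<tau>(1) by (intro S.m_closed S.m_inv_closed)
  have mult: "f \<otimes>\<^bsub>?B\<^esub> g = compose (carrier G) f g" if "f \<in> auto G" "g \<in> auto G" for f g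
    using that by (simp add: BijGroup_def auto_def)
  have "\<sigma> \<otimes>\<^bsub>?B\<^esub> \<rho> = \<tau> \<otimes>\<^bsub>?B\<^esub> \<sigma>"
    unfolding \<rho>_def using S.mem_carrier[OF \<sigma>] S.mem_carrier[OF \<tau>(1)] by (simp add: B.m_assoc[symmetric])
  then have comp: "compose (carrier G) \<sigma> \<rho> = compose (carrier G) \<tau> \<sigma>" using mult \<sigma> \<rho> \<tau>(1) by simp
  have eq: "\<sigma> (\<rho> x) = \<tau> (\<sigma> x)" if "x \<in> carrier G" for x
    using fun_cong[OF comp, of x] that by (simp add: compose_def)
  have \<rho>in: "\<rho> x \<in> carrier G" if "x \<in> carrier G" for x using bij(2)[OF \<rho>] that by blast
  have "\<rho> c = d"
  proof (rule inj_onD[OF bij(1)[OF \<sigma>]])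
    show "\<sigma> (\<rho> c) = \<sigma> d" using eq[of c] cd(1) CG vw \<tau>v by auto
  qed (use \<rho>in cd CG in auto)
  moreover have "\<rho> ` C = C"
  proof -
    have "\<sigma> ` \<rho> ` C = \<tau> ` \<sigma> ` C" unfolding image_image using eq CG by (intro image_cong) auto
    then have "\<sigma> ` \<rho> ` C = \<sigma> ` C" using \<tau>C by simp
    moreover have "\<rho> ` C \<subseteq> carrier G" using \<rho>in CG by blast
    ultimately show ?thesis using inj_on_image_eq_iff[OF bij(1)[OF \<sigma>] _ CG] by blast
  qed
  ultimately show "\<exists>\<sigma>\<in>auto_stabilizer G C. \<sigma> c = d" using \<rho> unfolding auto_stabilizer_def by blast
qed

theorem normal_edge_transitive_iff_standard:
  assumes C: "inverse_closed_generating_set G C" "card C = 4"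
  shows "has_valency (cayley_graph G C) 4 \<and> normal_edge_transitive G C \<longleftrightarrow>
    (\<exists>\<sigma>\<in>auto G. \<exists>p q r. standard n p q r \<and> \<sigma> ` C = {b, b \<otimes> a [^] p, b \<otimes> a [^] q, b \<otimes> a [^] r})"
proof -
  have CG: "C \<subseteq> carrier G" and inv: "\<And>c. c \<in> C \<Longrightarrow> inv c \<in> C"
    using C(1) by (auto simp: inverse_closed_generating_set_def)
  have "has_valency (cayley_graph G C) 4" using valency_card[OF CG inv] C(2) by simp
  moreover have "ref ` {0, p, q, r} = {b, b \<otimes> a [^] p, b \<otimes> a [^] q, b \<otimes> a [^] r}" for p q r
    by (simp add: nf_gens(2) ref_eq[symmetric])
  ultimately show ?thesis
    using normal_edge_transitive_imp_standard[OF C] standard_imp_normal_edge_transitive[OF CG] by metis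
qed

end

theorem theorem1p4:
  fixes G :: "('a, 'm) monoid_scheme" (structure)
    and a b :: 'a and n :: nat and C :: "'a set"
  assumes "n \<ge> 3"
    and "dihedral_group G n a b"
    and "inverse_closed_generating_set G C"
    and "card C = 4"
  shows "has_valency (cayley_graph G C) 4 \<and> normal_edge_transitive G C \<longleftrightarrow>
    (\<exists>\<sigma> \<in> auto G.
       (\<exists>i::int. 2 \<le> i \<and> i \<le> int n - 1 \<and> gcd (2 * i - 1) (int n) = 1 \<and>
          [2 * i * (i - 1) = 0] (mod int n) \<and>
          \<sigma> ` C = {b, b \<otimes> a, b \<otimes> a [^] i, b \<otimes> a [^] (1 - i)})
     \<or> (\<exists>k::int. 1 \<le> k \<and> k \<le> int n - 2 \<and> gcd k (int n) = 1 \<and>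
          [1 + k + k^2 + k^3 = 0] (mod int n) \<and>
          \<sigma> ` C = {b, b \<otimes> a, b \<otimes> a [^] (k + 1), b \<otimes> a [^] (k^2 + k + 1)})
     \<or> (n \<ge> 5 \<and>
        (\<exists>i j k :: int.
          (1 < i \<and> i < int n \<and> 1 < j \<and> j < int n \<and> 1 < k \<and> k < int n \<and>
           coprime i j \<and> coprime i k \<and> coprime j k) \<and>
          (\<forall>x \<in> {i, j, k}. gcd x (int n) > 1) \<and>
          (\<exists>l m :: int.
             [l^2 = 1] (mod int n) \<and> [m^2 = 1] (mod int n) \<and>
             \<not> [l = 1] (mod int n) \<and> \<not> [m = 1] (mod int n) \<and> \<not> [l * m = 1] (mod int n) \<and>
             [k = j * l + i] (mod int n) \<and> [k = i * m + j] (mod int n) \<and>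
             [i * (l + 1) = 0] (mod int n) \<and> [j * (m + 1) = 0] (mod int n)) \<and>
          \<sigma> ` C = {b, b \<otimes> a [^] i, b \<otimes> a [^] j, b \<otimes> a [^] k})))"
proof -
  \<comment> \<open>The presentation enters through the group order, which makes the locale
    \<open>dihedral\<close> available.\<close>
  have D: "group G \<and> dihedral_relations G n a b \<and> generate G {a, b} = carrier G \<and> order G = 2 * n"
    by (rule iffD1[OF dihedral_group_iff_order]) (use assms(1,2) in simp_all)
  then interpret dihedral G n a b
    using assms(1) by (simp add: dihedral_def dihedral_axioms_def dihedral_pair_def dihedral_pair_axioms_def)
  let ?A = "\<lambda>i. 2 \<le> i \<and> i \<le> int n - 1 \<and> gcd (2 * i - 1) (int n) = 1 \<and> [2 * i * (i - 1) = 0] (mod int n)"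
  let ?B = "\<lambda>k. 1 \<le> k \<and> k \<le> int n - 2 \<and> gcd k (int n) = 1 \<and> [1 + k + k^2 + k^3 = 0] (mod int n)"
  let ?C = "\<lambda>i j k. (1 < i \<and> i < int n \<and> 1 < j \<and> j < int n \<and> 1 < k \<and> k < int n \<and>
           coprime i j \<and> coprime i k \<and> coprime j k) \<and>
          (\<forall>x \<in> {i, j, k}. gcd x (int n) > 1) \<and>
          (\<exists>l m :: int.
             [l^2 = 1] (mod int n) \<and> [m^2 = 1] (mod int n) \<and>
             \<not> [l = 1] (mod int n) \<and> \<not> [m = 1] (mod int n) \<and> \<not> [l * m = 1] (mod int n) \<and>
             [k = j * l + i] (mod int n) \<and> [k = i * m + j] (mod int n) \<and>
             [i * (l + 1) = 0] (mod int n) \<and> [j * (m + 1) = 0] (mod int n))"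
  let ?X = "\<lambda>p q r. {b, b \<otimes> a [^] p, b \<otimes> a [^] q, b \<otimes> a [^] r}"
  have standard: "standard n p q r \<longleftrightarrow> (\<exists>i. ?A i \<and> p = 1 \<and> q = i \<and> r = 1 - i) \<or>
      (\<exists>k. ?B k \<and> p = 1 \<and> q = k + 1 \<and> r = k^2 + k + 1) \<or> n \<ge> 5 \<and> ?C p q r" for p q r
    unfolding standard_def conj_assoc ..
  \<comment> \<open>A purely logical regrouping, stated for abstract predicates to keep the
    arithmetic out of it.\<close>
  have cases: "(\<exists>p q r. ((\<exists>i. A i \<and> p = 1 \<and> q = i \<and> r = 1 - i) \<or>
      (\<exists>k. B k \<and> p = 1 \<and> q = k + 1 \<and> r = k^2 + k + 1) \<or> N \<and> D p q r) \<and> F p q r) \<longleftrightarrow>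
      (\<exists>i. A i \<and> F 1 i (1 - i)) \<or> (\<exists>k. B k \<and> F 1 (k + 1) (k^2 + k + 1)) \<or>
      (N \<and> (\<exists>p q r. D p q r \<and> F p q r))"
    for A B :: "int \<Rightarrow> bool" and D F :: "int \<Rightarrow> int \<Rightarrow> int \<Rightarrow> bool" and N
    by blast
  have one: "a [^] (1::int) = a" by simp
  have "(\<exists>p q r. standard n p q r \<and> X = ?X p q r) \<longleftrightarrow>
      (\<exists>i. ?A i \<and> X = {b, b \<otimes> a, b \<otimes> a [^] i, b \<otimes> a [^] (1 - i)}) \<or>
      (\<exists>k. ?B k \<and> X = {b, b \<otimes> a, b \<otimes> a [^] (k + 1), b \<otimes> a [^] (k^2 + k + 1)}) \<or>
      n \<ge> 5 \<and> (\<exists>p q r. ?C p q r \<and> X = ?X p q r)" for X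
    unfolding standard cases[of ?A ?B "n \<ge> 5" ?C "\<lambda>p q r. X = ?X p q r"] one ..
  then show ?thesis unfolding normal_edge_transitive_iff_standard[OF assms(3,4)] by (simp only: conj_assoc)
qed

end
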